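(* Let $n\ge1$ and consider an exceptional set for the quiver of type $\mathbb A_n$ with straight orientation. A strand $c(i,j)$ (with $i<j$) of its strand diagram corresponds to a relatively injective object $M_{i,j}$ in the exceptional set if and only if $c(i,j)$ is oriented to the right.
   Context: The quiver is $1\to2\to\cdots\to n$ over a field $\Bbbk$; modules are finite dimensional. For $0\le i<j\le n$, $M_{i,j}$ is the indecomposable module with support $(i,j]=\{i+1,\dots,j\}$. An exceptional sequence is a sequence $(E_1,\dots,E_n)$ of indecomposable modules with $\mathrm{Ext}^1(E_p,E_p)=0$ and $\mathrm{Hom}(E_p,E_q)=0=\mathrm{Ext}^1(E_p,E_q)$ for all $q<p$; an exceptional set is a set of $n$ modules which can be so ordered. $E_p$ is relatively injective in the sequence if it is an injective object of ${}^\perp(E_1\oplus\cdots\oplus E_{p-1})$, where ${}^\perp V$ is the full subcategory of modules $W$ with $\mathrm{Hom}(W,V)=0=\mathrm{Ext}^1(W,V)$; this property does not depend on the ordering of the exceptional set into an exceptional sequence. The strand diagram of an exceptional set is the graph with vertex set $\{0,1,\dots,n\}$ and an edge (strand) $c(i,j)$ joining $i$ and $j$ for each object $M_{i,j}$ of the set; it is a tree. A strand $c(i,j)$ with $i<j$ is oriented to the right if the unique path in this tree from $0$ to $j$ passes through $i$. *)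

theory Defs
  imports "Jordan_Normal_Form.Matrix_Kernel" "Graph_Theory.Graph_Theory"
begin

section \<open>Representations of the quiver 1 \<rightarrow> 2 \<rightarrow> \<dots> \<rightarrow> n\<close>

text \<open>
  A finite dimensional module is given as a representation in coordinates: the space at vertex v is
  the space of column vectors of length \<open>vdim M v\<close>, and the arrow from v to v + 1 acts by
  multiplication with the matrix \<open>amap M v\<close>. Only the values of \<open>vdim\<close> at the vertices 1, \<dots>, n and of
  \<open>amap\<close> at 1, \<dots>, n - 1 are meaningful. A morphism is a family of matrices indexed by the vertices,
  made extensional (undefined outside 1, \<dots>, n) so that equality of morphisms is equality in HOL.
\<close>

datatype 'k quiver_rep = Rep (vdim: "nat \<Rightarrow> nat") (amap: "nat \<Rightarrow> 'k mat")

definition is_rep :: "nat \<Rightarrow> 'k quiver_rep \<Rightarrow> bool" where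
  "is_rep n M \<longleftrightarrow> (\<forall>v\<in>{1..<n}. amap M v \<in> carrier_mat (vdim M (v + 1)) (vdim M v))"

definition rep_hom :: "nat \<Rightarrow> 'k::field quiver_rep \<Rightarrow> 'k quiver_rep \<Rightarrow> (nat \<Rightarrow> 'k mat) set" where
  "rep_hom n V W = {f \<in> (\<Pi>\<^sub>E v\<in>{1..n}. carrier_mat (vdim W v) (vdim V v)).
     \<forall>v\<in>{1..<n}. f (v + 1) * amap V v = amap W v * f v}"

definition rep_comp ::
  "nat \<Rightarrow> (nat \<Rightarrow> 'k::field mat) \<Rightarrow> (nat \<Rightarrow> 'k mat) \<Rightarrow> (nat \<Rightarrow> 'k mat)" where
  "rep_comp n g f = (\<lambda>v\<in>{1..n}. g v * f v)"

definition rep_id :: "nat \<Rightarrow> 'k::field quiver_rep \<Rightarrow> (nat \<Rightarrow> 'k mat)" where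
  "rep_id n V = (\<lambda>v\<in>{1..n}. 1\<^sub>m (vdim V v))"

definition rep_0 :: "nat \<Rightarrow> 'k::field quiver_rep \<Rightarrow> 'k quiver_rep \<Rightarrow> (nat \<Rightarrow> 'k mat)" where
  "rep_0 n V W = (\<lambda>v\<in>{1..n}. 0\<^sub>m (vdim W v) (vdim V v))"

definition rep_isos :: "nat \<Rightarrow> 'k::field quiver_rep \<Rightarrow> 'k quiver_rep \<Rightarrow> (nat \<Rightarrow> 'k mat) set" where
  "rep_isos n V W = {f \<in> rep_hom n V W.
     \<exists>g\<in>rep_hom n W V. rep_comp n g f = rep_id n V \<and> rep_comp n f g = rep_id n W}"

definition isomorphic :: "nat \<Rightarrow> 'k::field quiver_rep \<Rightarrow> 'k quiver_rep \<Rightarrow> bool" where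
  "isomorphic n V W \<longleftrightarrow> rep_isos n V W \<noteq> {}"

definition is_zero_rep :: "nat \<Rightarrow> 'k quiver_rep \<Rightarrow> bool" where
  "is_zero_rep n M \<longleftrightarrow> (\<forall>v\<in>{1..n}. vdim M v = 0)"

definition zero_rep :: "'k::field quiver_rep" where
  "zero_rep = Rep (\<lambda>v. 0) (\<lambda>v. 0\<^sub>m 0 0)"

definition direct_sum :: "'k::field quiver_rep \<Rightarrow> 'k quiver_rep \<Rightarrow> 'k quiver_rep" where
  "direct_sum V W = Rep (\<lambda>v. vdim V v + vdim W v)
     (\<lambda>v. four_block_mat (amap V v) (0\<^sub>m (vdim V (v + 1)) (vdim W v))
                        (0\<^sub>m (vdim W (v + 1)) (vdim V v)) (amap W v))"

definition direct_sum_list :: "'k::field quiver_rep list \<Rightarrow> 'k quiver_rep" where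
  "direct_sum_list Vs = foldr direct_sum Vs zero_rep"

definition indecomposable :: "nat \<Rightarrow> 'k::field quiver_rep \<Rightarrow> bool" where
  "indecomposable n M \<longleftrightarrow> is_rep n M \<and> \<not> is_zero_rep n M \<and>
     (\<forall>V W. is_rep n V \<longrightarrow> is_rep n W \<longrightarrow> isomorphic n M (direct_sum V W) \<longrightarrow>
        is_zero_rep n V \<or> is_zero_rep n W)"

text \<open>
  The module M(i,j) with support (i,j]: the field at the vertices i + 1, \<dots>, j and zero elsewhere.
  An arrow inside the support acts by the one-by-one matrix with entry 1, i.e. as the identity;
  the matrices of all other arrows have no entries.
\<close>

definition interval_module :: "nat \<Rightarrow> nat \<Rightarrow> 'k::field quiver_rep" where
  "interval_module i j =
     (let d = (\<lambda>v. if i < v \<and> v \<le> j then 1 else 0)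
      in Rep d (\<lambda>v. mat (d (v + 1)) (d v) (\<lambda>_. 1)))"


section \<open>Extensions\<close>

definition short_exact :: "nat \<Rightarrow> 'k::field quiver_rep \<Rightarrow> (nat \<Rightarrow> 'k mat) \<Rightarrow> 'k quiver_rep \<Rightarrow>
    (nat \<Rightarrow> 'k mat) \<Rightarrow> 'k quiver_rep \<Rightarrow> bool" where
  "short_exact n V f U g W \<longleftrightarrow> is_rep n V \<and> is_rep n U \<and> is_rep n W \<and>
     f \<in> rep_hom n V U \<and> g \<in> rep_hom n U W \<and>
     (\<forall>v\<in>{1..n}.
        inj_on (\<lambda>x. f v *\<^sub>v x) (carrier_vec (vdim V v)) \<and>
        (\<lambda>x. f v *\<^sub>v x) ` carrier_vec (vdim V v) = mat_kernel (g v) \<and>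
        (\<lambda>x. g v *\<^sub>v x) ` carrier_vec (vdim U v) = carrier_vec (vdim W v))"

text \<open>
  The Yoneda group \<open>Ext\<^sup>1(W,V)\<close>: short exact sequences from V to W up to isomorphisms of the middle
  terms compatible with the identities of V and W. Its group structure is not needed, since a
  group vanishes if and only if it has exactly one element.
\<close>

definition extensions :: "nat \<Rightarrow> 'k::field quiver_rep \<Rightarrow> 'k quiver_rep \<Rightarrow>
    ((nat \<Rightarrow> 'k mat) \<times> 'k quiver_rep \<times> (nat \<Rightarrow> 'k mat)) set" where
  "extensions n W V = {(f, U, g). short_exact n V f U g W}"

definition ext_equiv :: "nat \<Rightarrow> 'k::field quiver_rep \<Rightarrow> 'k quiver_rep \<Rightarrow>
    ((nat \<Rightarrow> 'k mat) \<times> 'k quiver_rep \<times> (nat \<Rightarrow> 'k mat)) rel" where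
  "ext_equiv n W V = {((f, U, g), (f', U', g')).
     (f, U, g) \<in> extensions n W V \<and> (f', U', g') \<in> extensions n W V \<and>
     (\<exists>h\<in>rep_isos n U U'. rep_comp n h f = f' \<and> rep_comp n g' h = g)}"

definition Ext1 :: "nat \<Rightarrow> 'k::field quiver_rep \<Rightarrow> 'k quiver_rep \<Rightarrow>
    ((nat \<Rightarrow> 'k mat) \<times> 'k quiver_rep \<times> (nat \<Rightarrow> 'k mat)) set set" where
  "Ext1 n W V = extensions n W V // ext_equiv n W V"

definition Hom_zero :: "nat \<Rightarrow> 'k::field quiver_rep \<Rightarrow> 'k quiver_rep \<Rightarrow> bool" where
  "Hom_zero n W V \<longleftrightarrow> rep_hom n W V = {rep_0 n W V}"

definition Ext1_zero :: "nat \<Rightarrow> 'k::field quiver_rep \<Rightarrow> 'k quiver_rep \<Rightarrow> bool" where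
  "Ext1_zero n W V \<longleftrightarrow> is_singleton (Ext1 n W V)"


section \<open>Exceptional sequences and relatively injective objects\<close>

text \<open>
  Lists are indexed from 0: \<open>E ! p\<close> is the (p + 1)-st module, and \<open>take p E\<close> consists of
  the modules preceding it.
\<close>

definition exceptional_sequence :: "nat \<Rightarrow> 'k::field quiver_rep list \<Rightarrow> bool" where
  "exceptional_sequence n E \<longleftrightarrow> length E = n \<and>
     (\<forall>p<n. indecomposable n (E ! p) \<and> Ext1_zero n (E ! p) (E ! p)) \<and>
     (\<forall>p<n. \<forall>q<p. Hom_zero n (E ! p) (E ! q) \<and> Ext1_zero n (E ! p) (E ! q))"

text \<open>
  The modules of an exceptional sequence are pairwise non-isomorphic, because a nonzero module has a
  nonzero endomorphism; so an exceptional set automatically has exactly n elements.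
\<close>

definition exceptional_set :: "nat \<Rightarrow> 'k::field quiver_rep set \<Rightarrow> bool" where
  "exceptional_set n S \<longleftrightarrow> (\<exists>E. exceptional_sequence n E \<and> set E = S)"

definition left_perp :: "nat \<Rightarrow> 'k::field quiver_rep \<Rightarrow> 'k quiver_rep set" where
  "left_perp n V = {W. is_rep n W \<and> Hom_zero n W V \<and> Ext1_zero n W V}"

text \<open>Monomorphisms and injective objects of the full subcategory with class of objects C.\<close>

definition mono_in :: "nat \<Rightarrow> 'k::field quiver_rep set \<Rightarrow> 'k quiver_rep \<Rightarrow> 'k quiver_rep \<Rightarrow>
    (nat \<Rightarrow> 'k mat) \<Rightarrow> bool" where
  "mono_in n C X Y f \<longleftrightarrow> X \<in> C \<and> Y \<in> C \<and> f \<in> rep_hom n X Y \<and>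
     (\<forall>Z\<in>C. \<forall>g\<in>rep_hom n Z X. \<forall>h\<in>rep_hom n Z X. rep_comp n f g = rep_comp n f h \<longrightarrow> g = h)"

definition injective_in :: "nat \<Rightarrow> 'k::field quiver_rep set \<Rightarrow> 'k quiver_rep \<Rightarrow> bool" where
  "injective_in n C I \<longleftrightarrow> I \<in> C \<and>
     (\<forall>X Y f. mono_in n C X Y f \<longrightarrow>
        (\<forall>g\<in>rep_hom n X I. \<exists>h\<in>rep_hom n Y I. rep_comp n h f = g))"

definition relatively_injective :: "nat \<Rightarrow> 'k::field quiver_rep list \<Rightarrow> nat \<Rightarrow> bool" where
  "relatively_injective n E p \<longleftrightarrow>
     injective_in n (left_perp n (direct_sum_list (take p E))) (E ! p)"


section \<open>Strand diagrams\<close>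

text \<open>
  The undirected strand diagram is encoded as the symmetric digraph with both arcs (i,j) and (j,i)
  for each strand c(i,j).
\<close>

definition strands :: "nat \<Rightarrow> 'k::field quiver_rep set \<Rightarrow> nat rel" where
  "strands n S = {(i, j). i < j \<and> j \<le> n \<and> (\<exists>X\<in>S. isomorphic n X (interval_module i j))}"

definition strand_diagram :: "nat \<Rightarrow> 'k::field quiver_rep set \<Rightarrow> nat pair_pre_digraph" where
  "strand_diagram n S = \<lparr> pverts = {0..n}, parcs = strands n S \<union> (strands n S)\<inverse> \<rparr>"

definition oriented_right :: "nat pair_pre_digraph \<Rightarrow> nat \<Rightarrow> nat \<Rightarrow> bool" where
  "oriented_right G i j \<longleftrightarrow>
     i \<in> set (pre_digraph.awalk_verts (with_proj G) 0
               (THE \<pi>. pre_digraph.apath (with_proj G) 0 \<pi> j))"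

end

theory Submission
  imports Defs
begin

text \<open>
  To a strand c(i,j) attach the half-open interval \<open>{i..<j}\<close>. A representation W lies in the left
  perpendicular category of M(i,j) if and only if the path from \<open>W\<^sub>i\<close> to \<open>W\<^sub>j\<close> acts bijectively (with
  \<open>W\<^sub>0 = 0\<close>); for W = M(a,b) this says that \<open>{i..<j}\<close> contains both or neither of a and b. Hence the
  perpendicular category of the first p modules of the sequence is closed under kernels and cokernels,
  and its interval modules are the M(a,b) with a and b in the same intervals of the first p strands.
  By the exact sequence of a monomorphism, M(i,j) is relatively injective unless some such M(a,b)
  satisfies \<open>Ext\<^sup>1(M(a,b), M(i,j)) \<noteq> 0\<close>, that is, a < i \<open>\<le>\<close> b < j.

  Deleting the strand c(i,j) cuts the tree into a part containing i and a part containing j. If a and b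
  are as above, then the strands from the p-th one on connect a and b, and the path between them
  traverses c(i,j), so that a lies on the side of j and b on the side of i; since strands do not cross,
  0 lies on the side of j. Conversely, if 0 lies on the side of j, the pair (0,i) is pushed through the
  perpendicular categories one strand at a time until it becomes such a pair (a,b).
\<close>

section \<open>Strands and their perpendicularity\<close>

definition link :: "(nat \<times> nat) list \<Rightarrow> nat set \<Rightarrow> nat rel" where
  "link s P = (\<Union>p\<in>P. {s ! p, prod.swap (s ! p)})"

abbreviation cut :: "(nat \<times> nat) list \<Rightarrow> nat \<Rightarrow> nat \<Rightarrow> nat rel" where
  "cut s n p \<equiv> (link s ({..<n} - {p}))\<^sup>*"

lemma link_mono: "P \<subseteq> Q \<Longrightarrow> link s P \<subseteq> link s Q"
  unfolding link_def by blast

lemma sym_link: "sym (link s P)"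
  unfolding link_def sym_def by (auto simp: prod_eq_iff)

lemma link_rtrancl_sym: "(x, y) \<in> (link s P)\<^sup>* \<Longrightarrow> (y, x) \<in> (link s P)\<^sup>*"
  by (rule symD[OF sym_rtrancl[OF sym_link]])

lemma link_rtrancl_mono: "(x, y) \<in> (link s P)\<^sup>* \<Longrightarrow> P \<subseteq> Q \<Longrightarrow> (x, y) \<in> (link s Q)\<^sup>*"
  by (rule subsetD[OF rtrancl_mono[OF link_mono]])

lemma link_rtrancl_join:
  "(x, y) \<in> (link s P)\<^sup>* \<Longrightarrow> (z, y) \<in> (link s P)\<^sup>* \<Longrightarrow> (x, z) \<in> (link s P)\<^sup>*"
  by (rule rtrancl_trans[OF _ link_rtrancl_sym])

lemma link_insert_cases:
  assumes "(x, y) \<in> (link s (insert p P))\<^sup>*" and "s ! p = (c, d)"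
  obtains "(x, y) \<in> (link s P)\<^sup>*"
  | "(x, c) \<in> (link s P)\<^sup>*" "(d, y) \<in> (link s P)\<^sup>*"
  | "(x, d) \<in> (link s P)\<^sup>*" "(c, y) \<in> (link s P)\<^sup>*"
proof -
  have "(x, y) \<in> (link s P)\<^sup>* \<or> ((x, c) \<in> (link s P)\<^sup>* \<and> (d, y) \<in> (link s P)\<^sup>*) \<or>
     ((x, d) \<in> (link s P)\<^sup>* \<and> (c, y) \<in> (link s P)\<^sup>*)"
    using assms(1)
  proof (induction rule: rtrancl_induct)
    case base
    then show ?case by blast
  next
    case (step y z)
    have "(y, z) \<in> link s P \<or> (y, z) = (c, d) \<or> (y, z) = (d, c)"
      using step(2) assms(2) by (auto simp: link_def)
    then consider "(y, z) \<in> link s P" | "y = c" "z = d" | "y = d" "z = c" by auto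
    then show ?case
    proof cases
      case 1
      then show ?thesis using step.IH by (meson rtrancl.rtrancl_into_rtrancl)
    next
      case 2
      then show ?thesis using step.IH by (metis link_rtrancl_sym rtrancl.rtrancl_refl rtrancl_trans)
    next
      case 3
      then show ?thesis using step.IH by (metis link_rtrancl_sym rtrancl.rtrancl_refl rtrancl_trans)
    qed
  qed
  then show ?thesis using that by blast
qed

definition perp_seq :: "nat \<Rightarrow> (nat \<times> nat) list \<Rightarrow> bool" where
  "perp_seq n s \<longleftrightarrow> length s = n \<and> (\<forall>p<n. fst (s ! p) < snd (s ! p) \<and> snd (s ! p) \<le> n) \<and>
     (\<forall>p<n. \<forall>q<p. fst (s ! p) \<in> {fst (s ! q)..<snd (s ! q)} \<longleftrightarrow>
                    snd (s ! p) \<in> {fst (s ! q)..<snd (s ! q)})"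

text \<open>For a < b, \<open>sim s r a b\<close> says that M(a,b) is left perpendicular to the first r strands.\<close>

definition sim :: "(nat \<times> nat) list \<Rightarrow> nat \<Rightarrow> nat \<Rightarrow> nat \<Rightarrow> bool" where
  "sim s r x y \<longleftrightarrow> (\<forall>q<r. x \<in> {fst (s ! q)..<snd (s ! q)} \<longleftrightarrow> y \<in> {fst (s ! q)..<snd (s ! q)})"

lemma sim_refl [simp]: "sim s r x x"
  and sim_sym: "sim s r x y \<Longrightarrow> sim s r y x"
  and sim_trans: "sim s r x y \<Longrightarrow> sim s r y z \<Longrightarrow> sim s r x z"
  unfolding sim_def by blast+

lemma sim_Suc: "sim s (Suc r) x y \<longleftrightarrow>
    sim s r x y \<and> (x \<in> {fst (s ! r)..<snd (s ! r)} \<longleftrightarrow> y \<in> {fst (s ! r)..<snd (s ! r)})"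
  unfolding sim_def less_Suc_eq by blast

lemma sim_cross:
  assumes "sim s r u w" "sim s r v z" "u \<le> v" "v \<le> w" "w \<le> z"
  shows "sim s r u v"
  \<comment> \<open>since intervals are convex\<close>
  unfolding sim_def
proof (intro allI impI)
  fix q assume q: "q < r"
  then have "u \<in> {fst (s ! q)..<snd (s ! q)} \<longleftrightarrow> w \<in> {fst (s ! q)..<snd (s ! q)}"
    "v \<in> {fst (s ! q)..<snd (s ! q)} \<longleftrightarrow> z \<in> {fst (s ! q)..<snd (s ! q)}"
    using assms(1,2) unfolding sim_def by blast+
  then show "u \<in> {fst (s ! q)..<snd (s ! q)} \<longleftrightarrow> v \<in> {fst (s ! q)..<snd (s ! q)}"
    using assms(3-5) by auto
qed

context
  fixes n :: nat and s :: "(nat \<times> nat) list"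
  assumes s: "perp_seq n s"
begin

lemma perp_seq_strand: "p < n \<Longrightarrow> s ! p = (c, d) \<Longrightarrow> c < d \<and> d \<le> n"
  using s unfolding perp_seq_def by (metis fst_conv snd_conv)

lemma perp_seq_sim: "p < n \<Longrightarrow> s ! p = (c, d) \<Longrightarrow> r \<le> p \<Longrightarrow> sim s r c d"
  using s unfolding perp_seq_def sim_def by (metis fst_conv snd_conv less_le_trans)

lemma linked_imp_sim:
  assumes "(x, y) \<in> (link s {r..<n})\<^sup>*"
  shows "sim s r x y"
  using assms
proof (induction rule: rtrancl_induct)
  case base
  then show ?case by simp
next
  case (step y z)
  then obtain p where p: "r \<le> p" "p < n" "(y, z) = s ! p \<or> (y, z) = prod.swap (s ! p)"
    by (auto simp: link_def)
  then have "sim s r y z"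
    using perp_seq_sim sim_sym by (metis swap_simp prod.exhaust prod.inject)
  then show ?case using step.IH sim_trans by blast
qed

lemma not_sim_strand: "p < n \<Longrightarrow> s ! p = (c, d) \<Longrightarrow> \<not> sim s (Suc p) c d"
  using perp_seq_strand[of p c d] by (auto simp: sim_Suc)

text \<open>Any cycle contains a strand of least index, whose removal leaves its end points \<open>sim\<close>-related.\<close>

lemma acyclic_strands:
  assumes p: "p < n" "s ! p = (c, d)"
  shows "(c, d) \<notin> cut s n p"
proof
  assume *: "(c, d) \<in> cut s n p"
  have "r \<le> p \<Longrightarrow> (c, d) \<in> (link s ({r..<n} - {p}))\<^sup>*" for r
  proof (induction r)
    case 0
    then show ?case using * by (simp add: atLeast0LessThan)
  next
    case (Suc r)
    obtain e f where r: "s ! r = (e, f)" by fastforce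
    have eq: "{r..<n} - {p} = insert r ({Suc r..<n} - {p})" using Suc p by auto
    have sub: "(x, y) \<in> (link s ({Suc r..<n} - {p}))\<^sup>* \<Longrightarrow> sim s (Suc r) x y" for x y
      using linked_imp_sim link_rtrancl_mono by (metis Diff_subset)
    have cd: "sim s (Suc r) c d" using perp_seq_sim p Suc by blast
    have ef: "\<not> sim s (Suc r) e f" using not_sim_strand r Suc p by simp
    from Suc have "(c, d) \<in> (link s (insert r ({Suc r..<n} - {p})))\<^sup>*" by (simp add: eq)
    then show ?case
    proof (rule link_insert_cases[OF _ r])
      assume a: "(c, e) \<in> (link s ({Suc r..<n} - {p}))\<^sup>*" "(f, d) \<in> (link s ({Suc r..<n} - {p}))\<^sup>*"
      have "sim s (Suc r) e f"
        using sim_trans[OF sim_sym[OF sub[OF a(1)]] sim_trans[OF cd sim_sym[OF sub[OF a(2)]]]] .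
      with ef show ?thesis by simp
    next
      assume a: "(c, f) \<in> (link s ({Suc r..<n} - {p}))\<^sup>*" "(e, d) \<in> (link s ({Suc r..<n} - {p}))\<^sup>*"
      have "sim s (Suc r) e f"
        using sim_trans[OF sub[OF a(2)] sim_trans[OF sim_sym[OF cd] sub[OF a(1)]]] .
      with ef show ?thesis by simp
    qed
  qed
  then have "(c, d) \<in> (link s ({p..<n} - {p}))\<^sup>*" by simp
  then have "sim s (Suc p) c d"
    by (intro linked_imp_sim) (rule link_rtrancl_mono, auto)
  then show False using not_sim_strand p by simp
qed

lemma connected_strands:
  assumes "x \<le> n" "y \<le> n"
  shows "(x, y) \<in> (link s {..<n})\<^sup>*"
proof -
  have "\<exists>T. finite T \<and> card T \<le> Suc (n - k) \<and> (\<forall>v\<le>n. \<exists>t\<in>T. (v, t) \<in> (link s {n - k..<n})\<^sup>*)"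
    if "k \<le> n" for k
    using that
  proof (induction k)
    case 0
    show ?case by (intro exI[of _ "{..n}"]) auto
  next
    case (Suc k)
    define r where "r = n - Suc k"
    have r: "r < n" "n - k = Suc r" using Suc unfolding r_def by auto
    obtain T where T: "finite T" "card T \<le> Suc (Suc r)"
      "\<And>v. v \<le> n \<Longrightarrow> \<exists>t\<in>T. (v, t) \<in> (link s {Suc r..<n})\<^sup>*" using Suc r by auto
    obtain c d where cd: "s ! r = (c, d)" by fastforce
    then have le: "c < d" "d \<le> n" using perp_seq_strand r by auto
    obtain t where t: "t \<in> T" "(c, t) \<in> (link s {Suc r..<n})\<^sup>*" using T(3)[of c] le by auto
    obtain u where u: "u \<in> T" "(d, u) \<in> (link s {Suc r..<n})\<^sup>*" using T(3)[of d] le by auto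
    have "t \<noteq> u"
    proof
      assume "t = u"
      then have "(c, d) \<in> (link s {Suc r..<n})\<^sup>*"
        using t u link_rtrancl_join by blast
      then show False using linked_imp_sim not_sim_strand r cd by blast
    qed
    have up: "(v, w) \<in> (link s {Suc r..<n})\<^sup>* \<Longrightarrow> (v, w) \<in> (link s {r..<n})\<^sup>*" for v w
      by (rule link_rtrancl_mono) auto
    have "(c, d) \<in> (link s {r..<n})\<^sup>*" using cd r by (intro r_into_rtrancl) (auto simp: link_def intro!: bexI[of _ r])
    then have tu: "(t, u) \<in> (link s {r..<n})\<^sup>*"
      using rtrancl_trans[OF link_rtrancl_sym[OF up[OF t(2)]]] rtrancl_trans[OF _ up[OF u(2)]] by blast
    have "\<exists>t'\<in>T - {t}. (v, t') \<in> (link s {r..<n})\<^sup>*" if v: "v \<le> n" for v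
    proof -
      obtain t' where t': "t' \<in> T" "(v, t') \<in> (link s {r..<n})\<^sup>*" using T(3)[OF v] up by blast
      show ?thesis
      proof (cases "t' = t")
        case True
        then show ?thesis using rtrancl_trans[OF t'(2)] tu \<open>t \<noteq> u\<close> u(1) by blast
      next
        case False
        then show ?thesis using t' by blast
      qed
    qed
    moreover have "card (T - {t}) \<le> Suc r" using T t by simp
    ultimately show ?case using T(1) unfolding r_def[symmetric] by (intro exI[of _ "T - {t}"]) auto
  qed
  from this[of n] obtain T where T: "finite T" "card T \<le> 1"
    "\<And>v. v \<le> n \<Longrightarrow> \<exists>t\<in>T. (v, t) \<in> (link s {..<n})\<^sup>*" by (auto simp: atLeast0LessThan)
  obtain t where "T \<subseteq> {t}" using T(1,2) card_le_Suc0_iff_eq[OF T(1)] by (cases "T = {}") auto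
  then have "(x, t) \<in> (link s {..<n})\<^sup>*" "(y, t) \<in> (link s {..<n})\<^sup>*" using T(3) assms by blast+
  then show ?thesis by (rule link_rtrancl_join)
qed

lemma sim_imp_linked:
  assumes "sim s r x y" "x \<le> n" "y \<le> n" "r \<le> n"
  shows "(x, y) \<in> (link s {r..<n})\<^sup>*"
  using assms
proof (induction r)
  case 0
  then show ?case using connected_strands by (simp add: atLeast0LessThan)
next
  case (Suc r)
  obtain c d where cd: "s ! r = (c, d)" by fastforce
  have not_cd: "\<not> sim s (Suc r) c d" using not_sim_strand cd Suc by simp
  have "(x, y) \<in> (link s {r..<n})\<^sup>*" using Suc by (simp add: sim_Suc)
  moreover have "{r..<n} = insert r {Suc r..<n}" using Suc by auto
  ultimately have "(x, y) \<in> (link s (insert r {Suc r..<n}))\<^sup>*" by simp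
  then show ?case
  proof (rule link_insert_cases[OF _ cd])
    assume a: "(x, c) \<in> (link s {Suc r..<n})\<^sup>*" "(d, y) \<in> (link s {Suc r..<n})\<^sup>*"
    have "sim s (Suc r) c d"
      using sim_trans[OF sim_sym[OF linked_imp_sim[OF a(1)]]
          sim_trans[OF Suc.prems(1) sim_sym[OF linked_imp_sim[OF a(2)]]]] .
    with not_cd show ?thesis by simp
  next
    assume a: "(x, d) \<in> (link s {Suc r..<n})\<^sup>*" "(c, y) \<in> (link s {Suc r..<n})\<^sup>*"
    have "sim s (Suc r) c d"
      using sim_trans[OF linked_imp_sim[OF a(2)] sim_trans[OF sim_sym[OF Suc.prems(1)]
          linked_imp_sim[OF a(1)]]] .
    with not_cd show ?thesis by simp
  qed
qed

lemma noncrossing_strands: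
  assumes "p < n" "q < n" "s ! p = (c, d)" "s ! q = (e, f)" "{c, d} \<inter> {e, f} = {}"
  shows "(e < c \<longleftrightarrow> e < d) \<longleftrightarrow> (f < c \<longleftrightarrow> f < d)"
proof -
  have lt: "c < d" "e < f" using perp_seq_strand assms by blast+
  consider "p < q" | "q < p" | "p = q" by linarith
  then show ?thesis
  proof cases
    case 1
    then have "sim s (Suc p) e f" using perp_seq_sim assms by simp
    then show ?thesis using assms(3,5) lt by (auto simp: sim_Suc)
  next
    case 2
    then have "sim s (Suc q) c d" using perp_seq_sim assms by simp
    then show ?thesis using assms(4,5) lt by (auto simp: sim_Suc)
  next
    case 3
    then show ?thesis using assms by auto
  qed
qed

text \<open>A discrete Jordan curve argument: the parity of the position of a vertex relative to the
  steps of a path does not change along a disjoint path.\<close>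

lemma noncrossing_paths:
  assumes xy: "(x, y) \<in> (link s P)\<^sup>*" and uw: "(u, w) \<in> (link s P)\<^sup>*"
    and P: "P \<subseteq> {..<n}" and disj: "(x, u) \<notin> (link s P)\<^sup>*"
  shows "(u < x \<longleftrightarrow> u < y) \<longleftrightarrow> (w < x \<longleftrightarrow> w < y)"
  using xy
proof (induction rule: rtrancl_induct)
  case base
  then show ?case by simp
next
  case (step y z)
  have "(u < y \<longleftrightarrow> u < z) \<longleftrightarrow> (w < y \<longleftrightarrow> w < z)"
    using uw
  proof (induction rule: rtrancl_induct)
    case base
    then show ?case by simp
  next
    case (step w w')
    have yz: "(y, z) \<in> link s P" by fact
    have ww: "(w, w') \<in> link s P" by fact
    have xy: "(x, y) \<in> (link s P)\<^sup>*" by fact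
    have xz: "(x, z) \<in> (link s P)\<^sup>*" using xy yz by simp
    have uw: "(u, w) \<in> (link s P)\<^sup>*" by fact
    have uw': "(u, w') \<in> (link s P)\<^sup>*" using uw ww by simp
    have "v \<noteq> v'" if "(x, v) \<in> (link s P)\<^sup>*" "(u, v') \<in> (link s P)\<^sup>*" for v v'
      using disj that link_rtrancl_join by blast
    then have ne: "{y, z} \<inter> {w, w'} = {}"
      using xy xz uw uw' by blast
    obtain p where p: "p < n" "s ! p = (y, z) \<or> s ! p = (z, y)"
      using yz P unfolding link_def by (force simp: prod_eq_iff)
    obtain q where q: "q < n" "s ! q = (w, w') \<or> s ! q = (w', w)"
      using ww P unfolding link_def by (force simp: prod_eq_iff)
    have "(w < y \<longleftrightarrow> w < z) \<longleftrightarrow> (w' < y \<longleftrightarrow> w' < z)"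
      using p(2) q(2) noncrossing_strands[OF p(1) q(1)] ne by (elim disjE) blast+
    then show ?case using step.IH by blast
  qed
  then show ?case using step.IH by blast
qed

lemma link_sides:
  assumes p: "p < n" "s ! p = (i, j)" and x: "x \<le> n"
  shows "(x, i) \<in> cut s n p \<longleftrightarrow> (x, j) \<notin> cut s n p"
proof -
  have "{..<n} = insert p ({..<n} - {p})" using p by auto
  then have "(x, i) \<in> (link s (insert p ({..<n} - {p})))\<^sup>*"
    using connected_strands[OF x, of i] perp_seq_strand[OF p] by auto
  then have "(x, i) \<in> cut s n p \<or> (x, j) \<in> cut s n p"
    by (rule link_insert_cases[OF _ p(2)]) auto
  then show ?thesis
    using acyclic_strands[OF p] link_rtrancl_join link_rtrancl_sym by blast
qed

lemma sim_crossing_sides: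
  assumes p: "p < n" "s ! p = (i, j)" and xy: "sim s p x y" "x \<le> n" "y \<le> n"
  shows "x \<notin> {i..<j} \<and> y \<in> {i..<j} \<longleftrightarrow>
    (x, j) \<in> cut s n p \<and> (y, i) \<in> cut s n p"
proof -
  have ij: "i < j" "j \<le> n" using perp_seq_strand p by auto
  have "{p..<n} = insert p {Suc p..<n}" using p by auto
  then have linked: "(x, y) \<in> (link s (insert p {Suc p..<n}))\<^sup>*"
    using sim_imp_linked[OF xy] p by simp
  have up: "(x, y) \<in> cut s n p" if "(x, y) \<in> (link s {Suc p..<n})\<^sup>*" for x y
    using that by (rule link_rtrancl_mono) auto
  have mem: "x \<in> {i..<j} \<longleftrightarrow> y \<in> {i..<j}" if "(x, y) \<in> (link s {Suc p..<n})\<^sup>*" for x y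
    using linked_imp_sim[OF that] p by (auto simp: sim_Suc)
  note * = up mem link_sides[OF p xy(2)] link_sides[OF p xy(3)]
  show ?thesis
    using linked
  proof (rule link_insert_cases[OF _ p(2)])
    assume "(x, y) \<in> (link s {Suc p..<n})\<^sup>*"
    then have xy_link: "(x, y) \<in> cut s n p"
      and xy_mem: "x \<in> {i..<j} \<longleftrightarrow> y \<in> {i..<j}"
      using up mem by blast+
    have "\<not> ((x, j) \<in> cut s n p \<and> (y, i) \<in> cut s n p)"
    proof
      assume b: "(x, j) \<in> cut s n p \<and> (y, i) \<in> cut s n p"
      then have "(x, i) \<in> cut s n p"
        using rtrancl_trans[OF xy_link] by blast
      then show False using b link_sides[OF p xy(2)] by blast
    qed
    then show ?thesis using xy_mem by blast
  next
    assume a: "(x, i) \<in> (link s {Suc p..<n})\<^sup>*" "(j, y) \<in> (link s {Suc p..<n})\<^sup>*"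
    have "x \<in> {i..<j}" using mem[OF a(1)] ij by simp
    moreover have "(x, i) \<in> cut s n p" using up a by blast
    ultimately show ?thesis using * by blast
  next
    assume a: "(x, j) \<in> (link s {Suc p..<n})\<^sup>*" "(i, y) \<in> (link s {Suc p..<n})\<^sup>*"
    have "x \<notin> {i..<j}" using mem[OF a(1)] by simp
    moreover have "y \<in> {i..<j}" using mem[OF a(2)] ij by simp
    ultimately show ?thesis using up a link_rtrancl_sym by blast
  qed
qed

text \<open>
  The invariant says that M(x,y) is an injective object of the perpendicular category of the first
  r modules and that its class has coefficient -1 at the p-th module of the sequence. It starts at
  the injective module M(0,i); each step replaces M(x,y) by an indecomposable summand of its image
  in the next perpendicular category.
\<close>

lemma exists_sim_crossing:
  assumes p: "p < n" "s ! p = (i, j)" and 0: "(0, j) \<in> cut s n p"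
  shows "\<exists>x y. x < y \<and> y \<le> n \<and> sim s p x y \<and> x \<notin> {i..<j} \<and> y \<in> {i..<j}"
proof -
  define B where "B x \<longleftrightarrow> (x, j) \<in> cut s n p" for x
  have A: "(x, i) \<in> cut s n p \<longleftrightarrow> \<not> B x" if "x \<le> n" for x
    using link_sides[OF p that] B_def by simp
  have ij: "i < j" "j \<le> n" using perp_seq_strand p by auto
  have Bsame: "B c \<longleftrightarrow> B d" if "r < p" "s ! r = (c, d)" for r c d
  proof -
    have "(c, d) \<in> cut s n p"
      using that p by (intro r_into_rtrancl) (auto simp: link_def intro!: bexI[of _ r])
    then show ?thesis
      unfolding B_def by (metis link_rtrancl_sym rtrancl_trans)
  qed
  have "\<exists>x y. x < y \<and> y \<le> n \<and> sim s r x y \<and> B x \<and> \<not> B y \<and>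
      (\<forall>u w. sim s r u w \<and> u < x \<and> x \<le> w \<and> w \<le> n \<longrightarrow> y \<le> w)" if "r \<le> p" for r
    using that
  proof (induction r)
    case 0
    have "\<not> B i" using A[of i] ij by simp
    moreover have "B 0" using assms(3) B_def by simp
    ultimately have "0 < i" by (cases "i = 0") auto
    then show ?case using ij \<open>\<not> B i\<close> \<open>B 0\<close> by (intro exI[of _ 0] exI[of _ i]) (auto simp: sim_def)
  next
    case (Suc r)
    then obtain x y where xy: "x < y" "y \<le> n" "sim s r x y" "B x" "\<not> B y"
      and inj: "\<And>u w. sim s r u w \<Longrightarrow> u < x \<Longrightarrow> x \<le> w \<Longrightarrow> w \<le> n \<Longrightarrow> y \<le> w" by auto
    obtain c d where cd: "s ! r = (c, d)" by fastforce
    have r: "r < n" using Suc p by simp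
    have lt: "c < d" "d \<le> n" using perp_seq_strand[OF r cd] by auto
    have B: "B c \<longleftrightarrow> B d" using Bsame[OF _ cd] Suc.prems by simp
    have sim_cd: "sim s r c d" using perp_seq_sim[OF r cd] by simp
    have S: "sim s (Suc r) u w \<longleftrightarrow> sim s r u w \<and> (u \<in> {c..<d} \<longleftrightarrow> w \<in> {c..<d})" for u w
      by (simp add: sim_Suc cd)
    consider "x \<in> {c..<d} \<longleftrightarrow> y \<in> {c..<d}" | "c \<le> x" "x < d" "d \<le> y" | "x < c" "c \<le> y" "y < d"
      using xy(1) by fastforce
    then show ?case
    proof cases
      case 1
      then show ?thesis using xy inj by (intro exI[of _ x] exI[of _ y]) (auto simp: S)
    next
      case 2
      have cx: "c = x"
      proof (rule ccontr)
        assume "c \<noteq> x"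
        then have "sim s r c x" using sim_cross[OF sim_cd xy(3)] 2 by simp
        then show False using inj[of c x] \<open>c \<noteq> x\<close> 2 xy by simp
      qed
      have dy: "d < y" using B cx xy 2 by (cases "d = y") auto
      have "sim s r d y" using sim_cd xy(3) cx by (blast intro: sim_trans sim_sym)
      moreover have "y \<le> w" if "sim s (Suc r) u w" "u < d" "d \<le> w" "w \<le> n" for u w
      proof -
        have "u < c" using that by (auto simp: S)
        then show ?thesis using inj[of u w] that cx 2 by (auto simp: S)
      qed
      ultimately show ?thesis using dy xy B cx by (intro exI[of _ d] exI[of _ y]) (auto simp: S)
    next
      case 3
      have xc: "sim s r x c" using sim_cross[OF xy(3) sim_cd] 3 by simp
      have xd: "sim s r x d" and cy: "sim s r c y"
        using xc xy(3) sim_cd by (blast intro: sim_trans sim_sym)+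
      show ?thesis
      proof (cases "B d")
        case False
        moreover have "d \<le> w" if "sim s (Suc r) u w" "u < x" "x \<le> w" "w \<le> n" for u w
        proof -
          have "y \<le> w" using inj that by (auto simp: S)
          then show ?thesis using that 3 by (auto simp: S)
        qed
        ultimately show ?thesis
          using xd 3 xy lt by (intro exI[of _ x] exI[of _ d]) (auto simp: S)
      next
        case True
        then have "c < y" using B xy 3 by (cases "c = y") auto
        moreover have "y \<le> w" if *: "sim s (Suc r) u w" "u < c" "c \<le> w" "w \<le> n" for u w
        proof -
          have "d \<le> w" using * by (auto simp: S)
          then show ?thesis using 3 by simp
        qed
        ultimately show ?thesis
          using cy 3 xy lt B True by (intro exI[of _ c] exI[of _ y]) (auto simp: S)
      qed
    qed
  qed
  from this[of p] obtain x y where xy: "x < y" "y \<le> n" "sim s p x y" "B x" "\<not> B y" by auto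
  have x: "x \<le> n" using xy by simp
  have "(x, j) \<in> cut s n p \<and> (y, i) \<in> cut s n p"
    using xy(4,5) A[OF xy(2)] unfolding B_def by blast
  then have "x \<notin> {i..<j} \<and> y \<in> {i..<j}"
    using sim_crossing_sides[OF p xy(3) x xy(2)] by (rule iffD2[rotated])
  then show ?thesis using xy by blast
qed

lemma sim_crossing_iff:
  assumes p: "p < n" "s ! p = (i, j)"
  shows "(\<exists>x y. x < y \<and> y \<le> n \<and> sim s p x y \<and> x \<notin> {i..<j} \<and> y \<in> {i..<j}) \<longleftrightarrow>
    (0, i) \<notin> cut s n p" (is "?L \<longleftrightarrow> ?R")
proof
  assume ?L
  then obtain x y where xy: "x < y" "y \<le> n" "sim s p x y" "x \<notin> {i..<j}" "y \<in> {i..<j}" by blast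
  have x: "x \<le> n" using xy by simp
  have B: "(x, j) \<in> cut s n p"
    using sim_crossing_sides[OF p xy(3) x xy(2)] xy(4,5) by blast
  show ?R
  proof
    assume A: "(0, i) \<in> cut s n p"
    have disj: "(0, x) \<notin> cut s n p"
    proof
      assume "(0, x) \<in> cut s n p"
      from rtrancl_trans[OF this B] show False using A link_sides[OF p, of 0] by blast
    qed
    have "(x < 0 \<longleftrightarrow> x < i) \<longleftrightarrow> (j < 0 \<longleftrightarrow> j < i)"
      using noncrossing_paths[OF A B _ disj] by blast
    then show False using xy by auto
  qed
next
  assume ?R
  then show ?L using exists_sim_crossing[OF p] link_sides[OF p, of 0] by blast
qed

end

section \<open>Paths in the strand diagram\<close>

lemma awalk_avoiding_vertex:
  assumes "wf_digraph (with_proj G)" and "parcs G = link s {..<n}"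
    and "pre_digraph.awalk (with_proj G) u \<pi> v"
    and "w \<notin> set (pre_digraph.awalk_verts (with_proj G) u \<pi>)"
    and "p < n" "w = fst (s ! p) \<or> w = snd (s ! p)"
  shows "(u, v) \<in> cut s n p"
proof -
  interpret wf_digraph "with_proj G" by fact
  show ?thesis using assms(3,4)
  proof (induction \<pi> arbitrary: u)
    case Nil
    then show ?case by (simp add: awalk_Nil_iff)
  next
    case (Cons e \<pi>)
    obtain x where e: "e = (u, x)" using Cons.prems by (cases e) (auto simp: awalk_Cons_iff)
    have ux: "(u, x) \<in> link s {..<n}" using Cons.prems assms(2) by (simp add: awalk_Cons_iff e)
    have walk: "awalk x \<pi> v" using Cons.prems by (simp add: awalk_Cons_iff e)
    then have "x \<in> set (awalk_verts x \<pi>)" by (rule hd_in_awalk_verts)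
    then have "w \<noteq> u" "w \<noteq> x" "w \<notin> set (awalk_verts x \<pi>)" using Cons.prems by (auto simp: e)
    moreover obtain q where "q < n" "(u, x) = s ! q \<or> (u, x) = prod.swap (s ! q)"
      using ux by (auto simp: link_def)
    moreover from calculation have "q \<noteq> p" using assms(6) by (metis fst_conv snd_conv fst_swap snd_swap)
    ultimately have "(u, x) \<in> link s ({..<n} - {p})" by (auto simp: link_def)
    then show ?case using Cons.IH[OF walk] \<open>w \<notin> set (awalk_verts x \<pi>)\<close>
      by (meson converse_rtrancl_into_rtrancl)
  qed
qed

lemma apath_unique_strands:
  assumes "wf_digraph (with_proj G)" and G: "parcs G = link s {..<n}" and s: "perp_seq n s"
    and "pre_digraph.apath (with_proj G) u \<pi> v" and "pre_digraph.apath (with_proj G) u \<rho> v"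
  shows "\<pi> = \<rho>"
proof -
  interpret wf_digraph "with_proj G" by fact
  have nil: "\<rho> = []" if "apath v \<rho> v" for v \<rho>
    using that by (metis apath_nonempty_ends)
  show ?thesis using assms(4,5)
  proof (induction \<pi> arbitrary: u \<rho>)
    case Nil
    then show ?case using nil by (auto simp: apath_Nil_iff)
  next
    case (Cons e \<pi>)
    obtain x where e: "e = (u, x)" using Cons.prems by (cases e) (auto simp: apath_Cons_iff)
    have "\<rho> \<noteq> []" using nil Cons.prems by (metis apath_Nil_iff list.distinct(1))
    then obtain f \<rho>' where rho: "\<rho> = f # \<rho>'" by (cases \<rho>) auto
    obtain y where f: "f = (u, y)" using Cons.prems rho by (cases f) (auto simp: apath_Cons_iff)
    have x: "(u, x) \<in> link s {..<n}" "apath x \<pi> v" "u \<notin> set (awalk_verts x \<pi>)"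
      using Cons.prems(1) G by (simp_all add: e apath_Cons_iff)
    have y: "(u, y) \<in> link s {..<n}" "apath y \<rho>' v" "u \<notin> set (awalk_verts y \<rho>')"
      using Cons.prems(2) G by (simp_all add: f rho apath_Cons_iff)
    have "x = y"
    proof (rule ccontr)
      assume "x \<noteq> y"
      obtain p where p: "p < n" "(u, x) = s ! p \<or> (u, x) = prod.swap (s ! p)"
        using x(1) by (auto simp: link_def)
      obtain q where q: "q < n" "(u, y) = s ! q \<or> (u, y) = prod.swap (s ! q)"
        using y(1) by (auto simp: link_def)
      have "u \<noteq> x" "u \<noteq> y" using x(2,3) y(2,3) hd_in_awalk_verts by blast+
      then have "p \<noteq> q" using p q \<open>x \<noteq> y\<close> by (auto simp: prod_eq_iff)
      then have uy: "(u, y) \<in> cut s n p"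
        using q by (intro r_into_rtrancl) (auto simp: link_def)
      have end_u: "u = fst (s ! p) \<or> u = snd (s ! p)" using p(2) by (metis fst_conv fst_swap)
      note avoid = awalk_avoiding_vertex[OF assms(1) G _ _ p(1) end_u]
      have "(x, v) \<in> cut s n p" "(y, v) \<in> cut s n p"
        using avoid[OF awalkI_apath[OF x(2)] x(3)] avoid[OF awalkI_apath[OF y(2)] y(3)] by auto
      then have "(y, x) \<in> cut s n p" using link_rtrancl_join by blast
      from rtrancl_trans[OF uy this] have ux: "(u, x) \<in> cut s n p" .
      have "s ! p = (u, x) \<or> s ! p = (x, u)" using p(2) by (auto simp: prod_eq_iff)
      then show False
        using acyclic_strands[OF s p(1)] ux link_rtrancl_sym[OF ux] by auto
    qed
    then show ?case using Cons.IH[OF x(2)] y(2) by (simp add: e f rho)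
  qed
qed

lemma oriented_right_iff:
  assumes s: "perp_seq n s" and G: "pverts G = {0..n}" "parcs G = link s {..<n}"
    and p: "p < n" "s ! p = (i, j)"
  shows "oriented_right G i j \<longleftrightarrow> (0, i) \<in> cut s n p"
proof -
  have ij: "i < j" "j \<le> n" using perp_seq_strand[OF s p] by auto
  have verts: "u \<le> n \<and> v \<le> n" if "(u, v) \<in> link s {..<n}" for u v
  proof -
    obtain q where q: "q < n" "(u, v) = s ! q \<or> (u, v) = prod.swap (s ! q)"
      using \<open>(u, v) \<in> link s {..<n}\<close> by (auto simp: link_def)
    obtain c d where cd: "s ! q = (c, d)" by fastforce
    then show ?thesis using q perp_seq_strand[OF s q(1) cd] by auto
  qed
  have wf: "wf_digraph (with_proj G)"
    by unfold_locales (use verts G in auto)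
  interpret wf_digraph "with_proj G" by fact
  have "(v, j) \<in> (link s {..<n})\<^sup>* \<Longrightarrow> v \<le> n \<Longrightarrow> \<exists>\<pi>. awalk v \<pi> j" for v
  proof (induction rule: converse_rtrancl_induct)
    case base
    then show ?case using G by (auto simp: awalk_Nil_iff intro!: exI[of _ "[]"])
  next
    case (step v w)
    then obtain \<pi> where "awalk w \<pi> j" using verts by blast
    then show ?case using step(1) G by (intro exI[of _ "(v, w) # \<pi>"]) (auto simp: awalk_Cons_iff)
  qed
  then obtain \<pi> where "awalk 0 \<pi> j" using connected_strands[OF s, of 0 j] ij by auto
  then have path: "apath 0 (awalk_to_apath \<pi>) j" by (rule apath_awalk_to_apath)
  define \<rho> where "\<rho> = awalk_to_apath \<pi>"
  have rho: "apath 0 \<rho> j" using path by (simp add: \<rho>_def)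
  have the: "(THE \<pi>. apath 0 \<pi> j) = \<rho>"
    using rho apath_unique_strands[OF wf G(2) s] by (intro the_equality) blast+
  note avoid = awalk_avoiding_vertex[OF wf G(2) _ _ p(1)]
  have "i \<in> set (awalk_verts 0 \<rho>) \<longleftrightarrow> (0, i) \<in> cut s n p"
  proof
    assume "i \<in> set (awalk_verts 0 \<rho>)"
    then obtain q r where qr: "\<rho> = q @ r" "awalk 0 q i" "awalk i r j"
      using awalk_decomp[of 0 \<rho> j i] rho unfolding apath_def by blast
    have last: "awlast 0 q = i" using qr(2) by auto
    have "apath 0 q i" "apath i r j" 
      and disj: "set (awalk_verts 0 q) \<inter> set (tl (awalk_verts i r)) = {}"
      using rho qr(1) last by (auto simp: apath_append_iff)
    moreover have "j \<in> set (tl (awalk_verts i r))"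
      using qr(3) ij by (cases r) (auto simp: awalk_Nil_iff awalk_Cons_iff dest: awalk_last_in_verts intro: awlast_in_verts elim!: awalkE)
    ultimately have "j \<notin> set (awalk_verts 0 q)" by blast
    then show "(0, i) \<in> cut s n p" using avoid[OF qr(2)] p by simp
  next
    assume A: "(0, i) \<in> cut s n p"
    show "i \<in> set (awalk_verts 0 \<rho>)"
    proof (rule ccontr)
      assume "i \<notin> set (awalk_verts 0 \<rho>)"
      then have "(0, j) \<in> cut s n p"
        using avoid[OF awalkI_apath[OF rho]] p by simp
      then show False using A link_sides[OF s p, of 0] by blast
    qed
  qed
  then show ?thesis unfolding oriented_right_def the .
qed

section \<open>Splitting matrices\<close>

text \<open>Versions of the matrix laws with dimension premises instead of carriers; unlike the carrier
  versions, they are usable as rewrite rules.\<close>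

lemma mat_assoc_dim:
  fixes A :: "'a::semiring_0 mat"
  shows "dim_col A = dim_row B \<Longrightarrow> dim_col B = dim_row C \<Longrightarrow> A * B * C = A * (B * C)"
  by (rule assoc_mult_mat[of _ "dim_row A" "dim_row B" _ "dim_row C" _ "dim_col C"]) auto

lemma mat_add_mult_dim:
  fixes A :: "'a::semiring_0 mat"
  shows "dim_row A = dim_row B \<Longrightarrow> dim_col A = dim_col B \<Longrightarrow> dim_row C = dim_col A \<Longrightarrow>
    (A + B) * C = A * C + B * C"
  by (rule add_mult_distrib_mat[of _ "dim_row B" "dim_col B" _ _ "dim_col C"]) auto

lemma mat_mult_add_dim:
  fixes A :: "'a::semiring_0 mat"
  shows "dim_row A = dim_row B \<Longrightarrow> dim_col A = dim_col B \<Longrightarrow> dim_col C = dim_row A \<Longrightarrow>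
    C * (A + B) = C * A + C * B"
  by (rule mult_add_distrib_mat[of _ "dim_row C" "dim_row B" _ "dim_col B"]) auto

lemma mat_minus_mult_dim:
  fixes A :: "'a::ring mat"
  shows "dim_row A = dim_row B \<Longrightarrow> dim_col A = dim_col B \<Longrightarrow> dim_row C = dim_col A \<Longrightarrow>
    (A - B) * C = A * C - B * C"
  by (rule minus_mult_distrib_mat[of _ "dim_row B" "dim_col B" _ _ "dim_col C"]) auto

lemma mat_mult_minus_dim:
  fixes A :: "'a::ring mat"
  shows "dim_row A = dim_row B \<Longrightarrow> dim_col A = dim_col B \<Longrightarrow> dim_col C = dim_row A \<Longrightarrow>
    C * (A - B) = C * A - C * B"
  by (rule mult_minus_distrib_mat[of _ "dim_row C" "dim_row B" _ "dim_col B"]) auto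

lemma mat_mult_zero_right_dim [simp]:
  "dim_col (A :: 'a::semiring_0 mat) = r \<Longrightarrow> A * 0\<^sub>m r c = 0\<^sub>m (dim_row A) c"
  by (rule right_mult_zero_mat) auto

lemmas mat_dim_simps = mat_assoc_dim mat_add_mult_dim mat_mult_add_dim mat_minus_mult_dim
  mat_mult_minus_dim

lemma mat_zero_dims:
  "dim_row A = 0 \<or> dim_col A = 0 \<Longrightarrow> dim_row B = dim_row A \<Longrightarrow> dim_col B = dim_col A \<Longrightarrow> A = B"
  by (intro eq_matI) auto

lemma mat_add_zero_dim [simp]:
  fixes A :: "'a::monoid_add mat"
  shows "dim_row A = r \<Longrightarrow> dim_col A = c \<Longrightarrow> A + 0\<^sub>m r c = A"
    and "dim_row A = r \<Longrightarrow> dim_col A = c \<Longrightarrow> 0\<^sub>m r c + A = A"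
  by (auto intro!: eq_matI)

lemma mat_minus_zero_dim [simp]:
  fixes A :: "'a::group_add mat"
  shows "dim_row A = r \<Longrightarrow> dim_col A = c \<Longrightarrow> A - 0\<^sub>m r c = A"
  by (auto intro!: eq_matI)

lemma mat_minus_self_dim [simp]:
  fixes A :: "'a::group_add mat"
  shows "A - A = 0\<^sub>m (dim_row A) (dim_col A)"
  by (auto intro!: eq_matI)

definition hcat :: "'a::zero mat \<Rightarrow> 'a mat \<Rightarrow> 'a mat" where
  "hcat A B = four_block_mat A B (0\<^sub>m 0 (dim_col A)) (0\<^sub>m 0 (dim_col B))"

definition vcat :: "'a::zero mat \<Rightarrow> 'a mat \<Rightarrow> 'a mat" where
  "vcat A B = four_block_mat A (0\<^sub>m (dim_row A) 0) B (0\<^sub>m (dim_row B) 0)"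

lemma dim_hcat [simp]: "dim_row (hcat A B) = dim_row A" "dim_col (hcat A B) = dim_col A + dim_col B"
  by (simp_all add: hcat_def)

lemma dim_vcat [simp]: "dim_row (vcat A B) = dim_row A + dim_row B" "dim_col (vcat A B) = dim_col A"
  by (simp_all add: vcat_def)

lemma hcat_vcat:
  fixes A :: "'a::semiring_0 mat"
  assumes "A \<in> carrier_mat m r" "B \<in> carrier_mat m r'" "C \<in> carrier_mat r d" "D \<in> carrier_mat r' d"
  shows "hcat A B * vcat C D = A * C + B * D"
proof -
  have "hcat A B * vcat C D = four_block_mat (A * C + B * D) (A * 0\<^sub>m r 0 + B * 0\<^sub>m r' 0)
      (0\<^sub>m 0 r * C + 0\<^sub>m 0 r' * D) (0\<^sub>m 0 r * 0\<^sub>m r 0 + 0\<^sub>m 0 r' * 0\<^sub>m r' 0)"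
    using assms unfolding hcat_def vcat_def
    by (subst mult_four_block_mat[of _ m r _ r' _ 0 _ _ d _ 0]) auto
  also have "\<dots> = A * C + B * D"
    using assms by (intro eq_matI) auto
  finally show ?thesis .
qed

lemma vcat_hcat:
  fixes A :: "'a::semiring_0 mat"
  assumes "A \<in> carrier_mat m r" "B \<in> carrier_mat m' r" "C \<in> carrier_mat r d" "D \<in> carrier_mat r d'"
  shows "vcat A B * hcat C D = four_block_mat (A * C) (A * D) (B * C) (B * D)"
proof -
  have "vcat A B * hcat C D = four_block_mat (A * C + 0\<^sub>m m 0 * 0\<^sub>m 0 d) (A * D + 0\<^sub>m m 0 * 0\<^sub>m 0 d')
      (B * C + 0\<^sub>m m' 0 * 0\<^sub>m 0 d) (B * D + 0\<^sub>m m' 0 * 0\<^sub>m 0 d')"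
    using assms unfolding hcat_def vcat_def
    by (subst mult_four_block_mat[of _ m r _ 0 _ m' _ _ d _ d']) auto
  also have "\<dots> = four_block_mat (A * C) (A * D) (B * C) (B * D)"
    using assms by (intro arg_cong4[where f = four_block_mat]) auto
  finally show ?thesis .
qed

lemma select_row:
  fixes M :: "'k::field mat"
  assumes "dim_row M = m" "p < m"
  shows "mat 1 m (\<lambda>(_, i). if i = p then c else 0) * M = mat 1 (dim_col M) (\<lambda>(_, j). c * M $$ (p, j))"
    (is "?E * M = ?R")
proof (intro eq_matI)
  fix i j assume ij: "i < dim_row ?R" "j < dim_col ?R"
  then have "(?E * M) $$ (i, j) = (\<Sum>k = 0..<m. (if k = p then c else 0) * M $$ (k, j))"
    using assms by (simp add: scalar_prod_def)
  also have "\<dots> = (\<Sum>k = 0..<m. if k = p then c * M $$ (k, j) else 0)" by (intro sum.cong) auto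
  finally show "(?E * M) $$ (i, j) = ?R $$ (i, j)" using ij assms by simp
qed (use assms in simp_all)

lemma select_col:
  fixes M :: "'k::field mat"
  assumes "dim_col M = d" "q < d"
  shows "M * mat d 1 (\<lambda>(j, _). if j = q then c else 0) = mat (dim_row M) 1 (\<lambda>(i, _). M $$ (i, q) * c)"
    (is "M * ?E = ?R")
proof (intro eq_matI)
  fix i j assume ij: "i < dim_row ?R" "j < dim_col ?R"
  then have "(M * ?E) $$ (i, j) = (\<Sum>k = 0..<d. M $$ (i, k) * (if k = q then c else 0))"
    using assms by (simp add: scalar_prod_def)
  also have "\<dots> = (\<Sum>k = 0..<d. if k = q then M $$ (i, k) * c else 0)" by (intro sum.cong) auto
  finally show "(M * ?E) $$ (i, j) = ?R $$ (i, j)" using ij assms by simp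
qed (use assms in simp_all)

text \<open>Wedderburn rank reduction: subtracting the rank-one matrix spanned by the column and the row
  through a nonzero entry makes that column and row vanish.\<close>

lemma rank_factorization:
  fixes A :: "'k::field mat"
  assumes "A \<in> carrier_mat m d"
  obtains r L R L' R' where "L \<in> carrier_mat m r" "R \<in> carrier_mat r d"
    "L' \<in> carrier_mat r m" "R' \<in> carrier_mat d r" "L' * L = 1\<^sub>m r" "R * R' = 1\<^sub>m r" "A = L * R"
proof -
  have "\<exists>r L R L' R'. L \<in> carrier_mat m r \<and> R \<in> carrier_mat r d \<and> L' \<in> carrier_mat r m \<and>
    R' \<in> carrier_mat d r \<and> L' * L = 1\<^sub>m r \<and> R * R' = 1\<^sub>m r \<and> A = L * R"
    using assms
  proof (induction "card {i. i < m \<and> (\<exists>j<d. A $$ (i, j) \<noteq> 0)}" arbitrary: A rule: less_induct)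
    case less
    note A = less.prems
    show ?case
    proof (cases "\<exists>p q. p < m \<and> q < d \<and> A $$ (p, q) \<noteq> 0")
      case False
      then have "A = 0\<^sub>m m 0 * 0\<^sub>m 0 d" using A by (intro eq_matI) auto
      then show ?thesis
        by (intro exI[of _ 0] exI[of _ "0\<^sub>m m 0"] exI[of _ "0\<^sub>m 0 d"] exI[of _ "0\<^sub>m 0 m"]
            exI[of _ "0\<^sub>m d 0"]) (auto intro!: mat_zero_dims)
    next
      case True
      then obtain p q where pq: "p < m" "q < d" "A $$ (p, q) \<noteq> 0" by blast
      define u where "u = mat m 1 (\<lambda>(i, _). A $$ (i, q) / A $$ (p, q))"
      define v where "v = mat 1 d (\<lambda>(_, j). A $$ (p, j))"
      define e where "e = mat 1 m (\<lambda>(_, i). if i = p then 1 else 0 :: 'k)"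
      define f where "f = mat d 1 (\<lambda>(j, _). if j = q then 1 / A $$ (p, q) else 0)"
      define A' where "A' = A - u * v"
      have car [simp]: "u \<in> carrier_mat m 1" "v \<in> carrier_mat 1 d" "e \<in> carrier_mat 1 m"
        "f \<in> carrier_mat d 1" "A' \<in> carrier_mat m d"
        using A by (auto simp: u_def v_def e_def f_def A'_def)
      have dims [simp]: "dim_row u = m" "dim_col u = 1" "dim_row v = 1" "dim_col v = d"
        "dim_row e = 1" "dim_col e = m" "dim_row f = d" "dim_col f = 1" "dim_row A' = m" "dim_col A' = d"
        using car by (auto simp del: car)
      have A'_idx: "A' $$ (i, j) = A $$ (i, j) - A $$ (i, q) / A $$ (p, q) * A $$ (p, j)"
        if "i < m" "j < d" for i j
        using that A by (auto simp: A'_def u_def v_def scalar_prod_def)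
      have "{i. i < m \<and> (\<exists>j<d. A' $$ (i, j) \<noteq> 0)} \<subset> {i. i < m \<and> (\<exists>j<d. A $$ (i, j) \<noteq> 0)}"
      proof
        show "{i. i < m \<and> (\<exists>j<d. A' $$ (i, j) \<noteq> 0)} \<subseteq> {i. i < m \<and> (\<exists>j<d. A $$ (i, j) \<noteq> 0)}"
        proof (intro subsetI CollectI conjI)
          fix i assume "i \<in> {i. i < m \<and> (\<exists>j<d. A' $$ (i, j) \<noteq> 0)}"
          then obtain j where ij: "i < m" "j < d" "A' $$ (i, j) \<noteq> 0" by blast
          then show "i < m" by simp
          have "A $$ (i, j) \<noteq> 0 \<or> A $$ (i, q) \<noteq> 0" using ij A'_idx by auto
          then show "\<exists>j<d. A $$ (i, j) \<noteq> 0" using ij pq by blast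
        qed
        have "p \<notin> {i. i < m \<and> (\<exists>j<d. A' $$ (i, j) \<noteq> 0)}" using pq A'_idx by auto
        then show "{i. i < m \<and> (\<exists>j<d. A' $$ (i, j) \<noteq> 0)} \<noteq> {i. i < m \<and> (\<exists>j<d. A $$ (i, j) \<noteq> 0)}"
          using pq by blast
      qed
      then have "card {i. i < m \<and> (\<exists>j<d. A' $$ (i, j) \<noteq> 0)} < card {i. i < m \<and> (\<exists>j<d. A $$ (i, j) \<noteq> 0)}"
        by (rule psubset_card_mono[rotated]) simp
      then obtain r L R L' R' where fac: "L \<in> carrier_mat m r" "R \<in> carrier_mat r d"
        "L' \<in> carrier_mat r m" "R' \<in> carrier_mat d r" "L' * L = 1\<^sub>m r" "R * R' = 1\<^sub>m r" "A' = L * R"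
        using less.hyps[of A'] by auto
      have [simp]: "dim_row L = m" "dim_col L = r" "dim_row R = r" "dim_col R = d"
        "dim_row L' = r" "dim_col L' = m" "dim_row R' = d" "dim_col R' = r" using fac by auto
      have eu: "e * u = 1\<^sub>m 1" unfolding e_def select_row[OF dims(1) pq(1)] using pq by (intro eq_matI) (auto simp: u_def)
      have vf: "v * f = 1\<^sub>m 1" unfolding f_def select_col[OF dims(4) pq(2)] using pq by (intro eq_matI) (auto simp: v_def)
      have eA: "e * A' = 0\<^sub>m 1 d" unfolding e_def select_row[OF dims(9) pq(1)] using pq by (intro eq_matI) (auto simp: A'_idx)
      have Af: "A' * f = 0\<^sub>m m 1" unfolding f_def select_col[OF dims(10) pq(2)] using pq by (intro eq_matI) (auto simp: A'_idx)
      have "A' * R' = L" using fac by (simp add: mat_assoc_dim)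
      then have eL: "e * L = 0\<^sub>m 1 r" 
        using mat_assoc_dim[of e A' R'] eA by simp
      have "L' * A' = R" using fac by (simp add: mat_assoc_dim[symmetric])
      then have Rf: "R * f = 0\<^sub>m r 1" 
        using mat_assoc_dim[of L' A' f] Af by simp
      define X where "X = L' - L' * u * e"
      define Y where "Y = R' - f * (v * R')"
      have XY: "X \<in> carrier_mat r m" "Y \<in> carrier_mat d r"
        unfolding X_def Y_def
        by (rule minus_carrier_mat[OF mult_carrier_mat[OF mult_carrier_mat[OF fac(3) car(1)] car(3)]],
            rule minus_carrier_mat[OF mult_carrier_mat[OF car(4) mult_carrier_mat[OF car(2) fac(4)]]])
      have XL: "X * L = 1\<^sub>m r" "X * u = 0\<^sub>m r 1" "R * Y = 1\<^sub>m r" "v * Y = 0\<^sub>m 1 r"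
      proof -
        have "X * L = L' * L - L' * u * (e * L)"
          unfolding X_def by (subst mat_minus_mult_dim) (simp_all add: mat_assoc_dim)
        then show "X * L = 1\<^sub>m r" using fac(5) by (simp add: eL)
        have "X * u = L' * u - L' * u * (e * u)"
          unfolding X_def by (subst mat_minus_mult_dim) (simp_all add: mat_assoc_dim)
        then show "X * u = 0\<^sub>m r 1" by (simp add: eu)
        have "R * Y = R * R' - R * f * (v * R')"
          unfolding Y_def by (subst mat_mult_minus_dim) (simp_all add: mat_assoc_dim)
        then show "R * Y = 1\<^sub>m r" using fac(6) by (simp add: Rf)
        have "v * Y = v * R' - v * f * (v * R')"
          unfolding Y_def by (subst mat_mult_minus_dim) (simp_all add: mat_assoc_dim)
        then show "v * Y = 0\<^sub>m 1 r" by (simp add: vf)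
      qed
      have "A = L * R + u * v"
        unfolding fac(7)[symmetric] A'_def using A by (intro eq_matI) auto
      then have 1: "A = hcat L u * vcat R v"
        unfolding hcat_vcat[OF fac(1) car(1) fac(2) car(2)] .
      have 2: "vcat X e * hcat L u = 1\<^sub>m (r + 1)"
        unfolding vcat_hcat[OF XY(1) car(3) fac(1) car(1)] XL(1,2) eL eu by (rule four_block_one_mat)
      have 3: "vcat R v * hcat Y f = 1\<^sub>m (r + 1)"
        unfolding vcat_hcat[OF fac(2) car(2) XY(2) car(4)] XL(3,4) Rf vf by (rule four_block_one_mat)
      have "hcat L u \<in> carrier_mat m (r + 1)" "vcat R v \<in> carrier_mat (r + 1) d"
        "vcat X e \<in> carrier_mat (r + 1) m" "hcat Y f \<in> carrier_mat d (r + 1)"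
        using XY by (auto intro!: carrier_matI)
      then show ?thesis using 1 2 3 by blast
    qed
  qed
  then show ?thesis using that by blast
qed

lemma idempotent_split:
  fixes E :: "'k::field mat"
  assumes E: "E \<in> carrier_mat d d" "E * E = E"
  obtains k S P where "S \<in> carrier_mat d k" "P \<in> carrier_mat k d" "S * P = E" "P * S = 1\<^sub>m k"
proof -
  obtain k S P S' P' where fac: "S \<in> carrier_mat d k" "P \<in> carrier_mat k d"
    "S' \<in> carrier_mat k d" "P' \<in> carrier_mat d k" "S' * S = 1\<^sub>m k" "P * P' = 1\<^sub>m k" "E = S * P"
    by (rule rank_factorization[OF E(1)])
  have [simp]: "dim_row S = d" "dim_col S = k" "dim_row P = k" "dim_col P = d"
    "dim_row S' = k" "dim_col S' = d" "dim_row P' = d" "dim_col P' = k" using fac by auto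
  have "S' * (E * E) * P' = (S' * S) * (P * S) * (P * P')" unfolding fac(7) by (simp add: mat_assoc_dim)
  moreover have "S' * E * P' = (S' * S) * (P * P')" unfolding fac(7) by (simp add: mat_assoc_dim)
  ultimately have "P * S = 1\<^sub>m k" unfolding E(2) fac(5,6) by simp
  then show ?thesis using that[OF fac(1,2)] fac(7) by simp
qed

lemma cokernel_split:
  fixes A :: "'k::field mat"
  assumes A: "A \<in> carrier_mat m d"
  obtains k S P B where "S \<in> carrier_mat m k" "P \<in> carrier_mat k m" "B \<in> carrier_mat d m"
    "P * S = 1\<^sub>m k" "P * A = 0\<^sub>m k d" "S * P + A * B = 1\<^sub>m m"
proof -
  obtain r L R L' R' where fac: "L \<in> carrier_mat m r" "R \<in> carrier_mat r d"
    "L' \<in> carrier_mat r m" "R' \<in> carrier_mat d r" "L' * L = 1\<^sub>m r" "R * R' = 1\<^sub>m r" "A = L * R"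
    by (rule rank_factorization[OF A])
  have [simp]: "dim_row L = m" "dim_col L = r" "dim_row R = r" "dim_col R = d"
    "dim_row L' = r" "dim_col L' = m" "dim_row R' = d" "dim_col R' = r" using fac by auto
  have "A * (R' * L') = L * (R * R') * L'" unfolding fac(7) by (simp add: mat_assoc_dim)
  then have AB: "A * (R' * L') = L * L'" by (simp add: fac)
  have LL: "L * L' * L = L" by (simp add: mat_assoc_dim fac)
  have "L * L' * (L * L') = L * L' * L * L'" by (simp add: mat_assoc_dim)
  then have idem: "L * L' * (L * L') = L * L'" unfolding LL .
  define E where "E = 1\<^sub>m m - L * L'"
  have E: "E \<in> carrier_mat m m" "E * E = E"
    by (auto simp: E_def mat_minus_mult_dim mat_mult_minus_dim idem intro!: eq_matI)
  obtain k S P where SP: "S \<in> carrier_mat m k" "P \<in> carrier_mat k m" "S * P = E" "P * S = 1\<^sub>m k"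
    by (rule idempotent_split[OF E])
  have [simp]: "dim_row S = m" "dim_col S = k" "dim_row P = k" "dim_col P = m" using SP by auto
  have "E * A = 0\<^sub>m m d"
  proof -
    have "L * L' * A = L * L' * L * R" unfolding fac(7) by (simp add: mat_assoc_dim)
    then have "L * L' * A = A" unfolding LL fac(7) .
    then show ?thesis using A by (simp add: E_def mat_minus_mult_dim)
  qed
  then have "S * (P * A) = 0\<^sub>m m d" using A SP(3) mat_assoc_dim[of S P A] by simp
  then have "P * S * (P * A) = 0\<^sub>m k d" using A mat_assoc_dim[of P S "P * A"] by simp
  then have "P * A = 0\<^sub>m k d" using A SP by simp
  moreover have "S * P + A * (R' * L') = 1\<^sub>m m" unfolding AB SP(3) E_def by (intro eq_matI) auto
  ultimately show ?thesis using that[of S k P "R' * L'"] SP fac by auto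
qed

lemma kernel_split:
  fixes A :: "'k::field mat"
  assumes A: "A \<in> carrier_mat m d"
  obtains k S P B where "S \<in> carrier_mat d k" "P \<in> carrier_mat k d" "B \<in> carrier_mat d m"
    "P * S = 1\<^sub>m k" "A * S = 0\<^sub>m m k" "S * P + B * A = 1\<^sub>m d"
proof -
  have At: "A\<^sup>T \<in> carrier_mat d m" using A by simp
  obtain k S P B where c: "S \<in> carrier_mat d k" "P \<in> carrier_mat k d" "B \<in> carrier_mat m d"
    "P * S = 1\<^sub>m k" "P * A\<^sup>T = 0\<^sub>m k m" "S * P + A\<^sup>T * B = 1\<^sub>m d"
    by (rule cokernel_split[OF At])
  have "S\<^sup>T * P\<^sup>T = 1\<^sub>m k"
    using transpose_mult[OF c(2,1)] unfolding c(4) by simp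
  moreover have "A * P\<^sup>T = 0\<^sub>m m k"
    using transpose_mult[OF c(2) At] unfolding c(5) by simp
  moreover have "P\<^sup>T * S\<^sup>T + B\<^sup>T * A = 1\<^sub>m d"
    using transpose_add[OF mult_carrier_mat[OF c(1,2)] mult_carrier_mat[OF At c(3)]]
    unfolding c(6) transpose_mult[OF c(1,2)] transpose_mult[OF At c(3)] by simp
  ultimately show ?thesis using that[of "P\<^sup>T" k "S\<^sup>T" "B\<^sup>T"] c by simp
qed

section \<open>Morphisms and extensions in coordinates\<close>

definition inl :: "nat \<Rightarrow> nat \<Rightarrow> 'a::{zero,one} mat" where "inl a b = vcat (1\<^sub>m a) (0\<^sub>m b a)"
definition inr :: "nat \<Rightarrow> nat \<Rightarrow> 'a::{zero,one} mat" where "inr a b = vcat (0\<^sub>m a b) (1\<^sub>m b)"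
definition prl :: "nat \<Rightarrow> nat \<Rightarrow> 'a::{zero,one} mat" where "prl a b = hcat (1\<^sub>m a) (0\<^sub>m a b)"
definition prr :: "nat \<Rightarrow> nat \<Rightarrow> 'a::{zero,one} mat" where "prr a b = hcat (0\<^sub>m b a) (1\<^sub>m b)"

lemma dim_biproduct [simp]:
  "dim_row (inl a b) = a + b" "dim_col (inl a b) = a"
  "dim_row (inr a b) = a + b" "dim_col (inr a b) = b"
  "dim_row (prl a b) = a" "dim_col (prl a b) = a + b"
  "dim_row (prr a b) = b" "dim_col (prr a b) = a + b"
  by (simp_all add: inl_def inr_def prl_def prr_def)

lemma biproduct [simp]:
  "prl a b * inl a b = (1\<^sub>m a :: 'a::semiring_1 mat)"
  "prl a b * inr a b = (0\<^sub>m a b :: 'a mat)"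
  "prr a b * inl a b = (0\<^sub>m b a :: 'a mat)"
  "prr a b * inr a b = (1\<^sub>m b :: 'a mat)"
  unfolding prl_def prr_def inl_def inr_def
  by (subst hcat_vcat[of _ _ a _ b]; force)+

lemma biproduct_assoc [simp]:
  fixes X :: "'a::semiring_1 mat"
  shows "dim_row X = a \<Longrightarrow> prl a b * (inl a b * X) = X"
    and "dim_row X = b \<Longrightarrow> prl a b * (inr a b * X) = 0\<^sub>m a (dim_col X)"
    and "dim_row X = a \<Longrightarrow> prr a b * (inl a b * X) = 0\<^sub>m b (dim_col X)"
    and "dim_row X = b \<Longrightarrow> prr a b * (inr a b * X) = X"
  by (simp_all flip: mat_assoc_dim)

lemma four_block_mat_biproduct:
  fixes A :: "'a::semiring_1 mat"
  assumes "A \<in> carrier_mat m d" "B \<in> carrier_mat m d'" "D \<in> carrier_mat m' d'"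
  shows "four_block_mat A B (0\<^sub>m m' d) D =
    inl m m' * A * prl d d' + inl m m' * B * prr d d' + inr m m' * D * prr d d'"
proof -
  have l: "inl m m' * X = vcat X (0\<^sub>m m' (dim_col X))" if "dim_row X = m" for X :: "'a mat"
  proof -
    have "vcat (1\<^sub>m m) (0\<^sub>m m' m) * hcat X (0\<^sub>m m 0) =
        four_block_mat X (0\<^sub>m m 0) (0\<^sub>m m' (dim_col X)) (0\<^sub>m m' 0)"
      using that by (subst vcat_hcat[of _ m m _ m' _ "dim_col X" _ 0]) auto
    moreover have "hcat X (0\<^sub>m m 0) = X" using that by (intro eq_matI) (auto simp: hcat_def)
    ultimately show ?thesis using that by (simp add: inl_def vcat_def)
  qed
  have r: "inr m m' * X = vcat (0\<^sub>m m (dim_col X)) X" if "dim_row X = m'" for X :: "'a mat"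
  proof -
    have "vcat (0\<^sub>m m m') (1\<^sub>m m') * hcat X (0\<^sub>m m' 0) =
        four_block_mat (0\<^sub>m m (dim_col X)) (0\<^sub>m m 0) X (0\<^sub>m m' 0)"
      using that by (subst vcat_hcat[of _ m m' _ m' _ "dim_col X" _ 0]) auto
    moreover have "hcat X (0\<^sub>m m' 0) = X" using that by (intro eq_matI) (auto simp: hcat_def)
    ultimately show ?thesis using that by (simp add: inr_def vcat_def)
  qed
  have 1: "inl m m' * A * prl d d' = four_block_mat A (0\<^sub>m m d') (0\<^sub>m m' d) (0\<^sub>m m' d')"
    using assms unfolding prl_def by (simp add: l) (subst vcat_hcat[of _ m d _ m' _ d _ d'], auto)
  have 2: "inl m m' * B * prr d d' = four_block_mat (0\<^sub>m m d) B (0\<^sub>m m' d) (0\<^sub>m m' d')"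
    using assms unfolding prr_def by (simp add: l) (subst vcat_hcat[of _ m d' _ m' _ d _ d'], auto)
  have 3: "inr m m' * D * prr d d' = four_block_mat (0\<^sub>m m d) (0\<^sub>m m d') (0\<^sub>m m' d) D"
    using assms unfolding prr_def by (simp add: r) (subst vcat_hcat[of _ m d' _ m' _ d _ d'], auto)
  show ?thesis unfolding 1 2 3 using assms by (intro eq_matI) auto
qed

lemma biproduct_sum [simp]:
  "inl a b * prl a b + inr a b * prr a b = (1\<^sub>m (a + b) :: 'a::semiring_1 mat)"
proof -
  have "inl a b * 1\<^sub>m a * prl a b + inl a b * 0\<^sub>m a b * prr a b + inr a b * 1\<^sub>m b * prr a b
      = (1\<^sub>m (a + b) :: 'a mat)"
    using four_block_mat_biproduct[OF one_carrier_mat[of a] zero_carrier_mat[of a b] one_carrier_mat[of b]]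
    unfolding four_block_one_mat by (rule sym)
  then show ?thesis by simp
qed

abbreviation in_l :: "'k::field quiver_rep \<Rightarrow> 'k quiver_rep \<Rightarrow> nat \<Rightarrow> 'k mat" where
  "in_l V W v \<equiv> inl (vdim V v) (vdim W v)"
abbreviation in_r :: "'k::field quiver_rep \<Rightarrow> 'k quiver_rep \<Rightarrow> nat \<Rightarrow> 'k mat" where
  "in_r V W v \<equiv> inr (vdim V v) (vdim W v)"
abbreviation pr_l :: "'k::field quiver_rep \<Rightarrow> 'k quiver_rep \<Rightarrow> nat \<Rightarrow> 'k mat" where
  "pr_l V W v \<equiv> prl (vdim V v) (vdim W v)"
abbreviation pr_r :: "'k::field quiver_rep \<Rightarrow> 'k quiver_rep \<Rightarrow> nat \<Rightarrow> 'k mat" where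
  "pr_r V W v \<equiv> prr (vdim V v) (vdim W v)"

lemma is_repD:
  assumes "is_rep n M" "0 < v" "v < n"
  shows "dim_row (amap M v) = vdim M (Suc v)" "dim_col (amap M v) = vdim M v"
  using assms unfolding is_rep_def by auto

lemma is_repI:
  assumes "\<And>v. 0 < v \<Longrightarrow> v < n \<Longrightarrow> dim_row (amap M v) = vdim M (Suc v)"
    "\<And>v. 0 < v \<Longrightarrow> v < n \<Longrightarrow> dim_col (amap M v) = vdim M v"
  shows "is_rep n M"
  using assms unfolding is_rep_def by auto

definition is_hom :: "nat \<Rightarrow> 'k::field quiver_rep \<Rightarrow> 'k quiver_rep \<Rightarrow> (nat \<Rightarrow> 'k mat) \<Rightarrow> bool" where
  "is_hom n V W f \<longleftrightarrow>
     (\<forall>v. 0 < v \<longrightarrow> v \<le> n \<longrightarrow> dim_row (f v) = vdim W v \<and> dim_col (f v) = vdim V v) \<and>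
     (\<forall>v. 0 < v \<longrightarrow> v < n \<longrightarrow> f (Suc v) * amap V v = amap W v * f v)"

lemma is_homD:
  assumes "is_hom n V W f" "0 < v"
  shows "v \<le> n \<Longrightarrow> dim_row (f v) = vdim W v" "v \<le> n \<Longrightarrow> dim_col (f v) = vdim V v"
    "v < n \<Longrightarrow> f (Suc v) * amap V v = amap W v * f v"
  using assms unfolding is_hom_def by auto

lemma is_homI:
  assumes "\<And>v. 0 < v \<Longrightarrow> v \<le> n \<Longrightarrow> dim_row (f v) = vdim W v"
    "\<And>v. 0 < v \<Longrightarrow> v \<le> n \<Longrightarrow> dim_col (f v) = vdim V v"
    "\<And>v. 0 < v \<Longrightarrow> v < n \<Longrightarrow> f (Suc v) * amap V v = amap W v * f v"
  shows "is_hom n V W f"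
  using assms unfolding is_hom_def by auto

lemma rep_hom_iff: "f \<in> rep_hom n V W \<longleftrightarrow> is_hom n V W f \<and> f \<in> extensional {1..n}"
proof -
  have le: "v \<in> {1..n} \<longleftrightarrow> 0 < v \<and> v \<le> n" and lt: "v \<in> {1..<n} \<longleftrightarrow> 0 < v \<and> v < n" for v
    by auto
  have car: "X \<in> carrier_mat a b \<longleftrightarrow> dim_row X = a \<and> dim_col X = b" for X :: "'a mat" and a b
    by auto
  show ?thesis
    unfolding rep_hom_def is_hom_def PiE_iff mem_Collect_eq Ball_def le lt car Suc_eq_plus1[symmetric]
    by blast
qed

lemma is_hom_dims:
  assumes "is_hom n V W f" "0 < v" "v < n"
  shows "dim_row (f v) = vdim W v" "dim_col (f v) = vdim V v"
    "dim_row (f (Suc v)) = vdim W (Suc v)" "dim_col (f (Suc v)) = vdim V (Suc v)"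
  using is_homD(1,2)[OF assms(1)] assms(2,3) by auto

lemma is_hom_cong:
  assumes "is_hom n V W f" "\<And>v. 0 < v \<Longrightarrow> v \<le> n \<Longrightarrow> g v = f v"
  shows "is_hom n V W g"
  using assms unfolding is_hom_def by auto

lemma restrict_rep_hom: "is_hom n V W f \<Longrightarrow> restrict f {1..n} \<in> rep_hom n V W"
  by (auto simp: rep_hom_iff intro: is_hom_cong)

lemma rep_comp_eq_iff:
  assumes "h \<in> extensional {1..n}"
  shows "rep_comp n g f = h \<longleftrightarrow> (\<forall>v. 0 < v \<longrightarrow> v \<le> n \<longrightarrow> g v * f v = h v)"
proof
  assume eq: "rep_comp n g f = h"
  show "\<forall>v. 0 < v \<longrightarrow> v \<le> n \<longrightarrow> g v * f v = h v"
    unfolding eq[symmetric] rep_comp_def by simp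
next
  assume "\<forall>v. 0 < v \<longrightarrow> v \<le> n \<longrightarrow> g v * f v = h v"
  then have "\<And>v. v \<in> {1..n} \<Longrightarrow> restrict (\<lambda>v. g v * f v) {1..n} v = h v" by simp
  then show "rep_comp n g f = h"
    unfolding rep_comp_def by (rule extensionalityI[OF restrict_extensional assms])
qed

lemma is_hom_comp:
  assumes "is_rep n U" "is_rep n V" "is_rep n W" and f: "is_hom n U V f" and g: "is_hom n V W g"
  shows "is_hom n U W (\<lambda>v. g v * f v)"
proof (rule is_homI)
  fix v assume v: "0 < v" "v < n"
  have [simp]: "dim_row (amap U v) = vdim U (Suc v)" "dim_col (amap U v) = vdim U v"
    "dim_row (amap V v) = vdim V (Suc v)" "dim_col (amap V v) = vdim V v"
    "dim_row (amap W v) = vdim W (Suc v)" "dim_col (amap W v) = vdim W v"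
    using is_repD[OF assms(1) v] is_repD[OF assms(2) v] is_repD[OF assms(3) v] by auto
  have [simp]: "dim_row (f v) = vdim V v" "dim_col (f v) = vdim U v"
    "dim_row (f (Suc v)) = vdim V (Suc v)" "dim_col (f (Suc v)) = vdim U (Suc v)"
    "dim_row (g v) = vdim W v" "dim_col (g v) = vdim V v"
    "dim_row (g (Suc v)) = vdim W (Suc v)" "dim_col (g (Suc v)) = vdim V (Suc v)"
    using v is_homD[OF f] is_homD[OF g] by auto
  have "g (Suc v) * f (Suc v) * amap U v = g (Suc v) * amap V v * f v"
    using is_homD(3)[OF f] v by (simp add: mat_assoc_dim)
  also have "\<dots> = amap W v * (g v * f v)"
    using is_homD(3)[OF g] v by (simp add: mat_assoc_dim)
  finally show "g (Suc v) * f (Suc v) * amap U v = amap W v * (g v * f v)" .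
qed (use is_homD[OF f] is_homD[OF g] in auto)

text \<open>
  \<open>Ext\<^sup>1(W,V)\<close> is the cokernel and Hom(W,V) the kernel of the map sending a family of matrices
  \<open>f v\<close> from \<open>W v\<close> to \<open>V v\<close> to the family of the defects of the naturality squares.
\<close>

definition hom0 :: "nat \<Rightarrow> 'k::field quiver_rep \<Rightarrow> 'k quiver_rep \<Rightarrow> bool" where
  "hom0 n W V \<longleftrightarrow> (\<forall>f. is_hom n W V f \<longrightarrow> (\<forall>v. 0 < v \<longrightarrow> v \<le> n \<longrightarrow> f v = 0\<^sub>m (vdim V v) (vdim W v)))"

definition solves :: "nat \<Rightarrow> 'k::field quiver_rep \<Rightarrow> 'k quiver_rep \<Rightarrow> (nat \<Rightarrow> 'k mat) \<Rightarrow> (nat \<Rightarrow> 'k mat) \<Rightarrow> bool" where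
  "solves n W V \<theta> f \<longleftrightarrow>
     (\<forall>v. 0 < v \<longrightarrow> v \<le> n \<longrightarrow> dim_row (f v) = vdim V v \<and> dim_col (f v) = vdim W v) \<and>
     (\<forall>v. 0 < v \<longrightarrow> v < n \<longrightarrow> f (Suc v) * amap W v = amap V v * f v + \<theta> v)"

definition ext0 :: "nat \<Rightarrow> 'k::field quiver_rep \<Rightarrow> 'k quiver_rep \<Rightarrow> bool" where
  "ext0 n W V \<longleftrightarrow> (\<forall>\<theta>. (\<forall>v. 0 < v \<longrightarrow> v < n \<longrightarrow> dim_row (\<theta> v) = vdim V (Suc v) \<and> dim_col (\<theta> v) = vdim W v) \<longrightarrow>
     (\<exists>f. solves n W V \<theta> f))"

lemma solvesD:
  assumes "solves n W V \<theta> f" "0 < v"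
  shows "v \<le> n \<Longrightarrow> dim_row (f v) = vdim V v" "v \<le> n \<Longrightarrow> dim_col (f v) = vdim W v"
    "v < n \<Longrightarrow> f (Suc v) * amap W v = amap V v * f v + \<theta> v"
  using assms unfolding solves_def by auto

lemma ext0E:
  assumes "ext0 n W V"
    and "\<And>v. 0 < v \<Longrightarrow> v < n \<Longrightarrow> dim_row (\<theta> v) = vdim V (Suc v)"
    and "\<And>v. 0 < v \<Longrightarrow> v < n \<Longrightarrow> dim_col (\<theta> v) = vdim W v"
  obtains f where "solves n W V \<theta> f"
  using assms unfolding ext0_def by blast

lemma ext0I:
  fixes W V :: "'k::field quiver_rep"
  assumes "\<And>\<theta> :: nat \<Rightarrow> 'k mat. (\<And>v. 0 < v \<Longrightarrow> v < n \<Longrightarrow> dim_row (\<theta> v) = vdim V (Suc v)) \<Longrightarrow>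
    (\<And>v. 0 < v \<Longrightarrow> v < n \<Longrightarrow> dim_col (\<theta> v) = vdim W v) \<Longrightarrow> \<exists>f. solves n W V \<theta> f"
  shows "ext0 n W V"
  unfolding ext0_def using assms by blast

lemma Hom_zero_iff:
  assumes "is_rep n W" "is_rep n V"
  shows "Hom_zero n W V \<longleftrightarrow> hom0 n W V"
proof
  assume H: "Hom_zero n W V"
  show "hom0 n W V"
    unfolding hom0_def
  proof (intro allI impI)
    fix f v assume f: "is_hom n W V f" and v: "0 < v" "v \<le> n"
    have "restrict f {1..n} = rep_0 n W V"
      using restrict_rep_hom[OF f] H unfolding Hom_zero_def by blast
    then have "restrict f {1..n} v = rep_0 n W V v" by simp
    then show "f v = 0\<^sub>m (vdim V v) (vdim W v)" using v by (auto simp: rep_0_def)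
  qed
next
  assume H: "hom0 n W V"
  have "is_hom n W V (\<lambda>v. 0\<^sub>m (vdim V v) (vdim W v))"
    using is_repD[OF assms(1)] is_repD[OF assms(2)] by (intro is_homI) auto
  then have "rep_0 n W V \<in> rep_hom n W V"
    unfolding rep_0_def by (rule restrict_rep_hom)
  moreover have "f = rep_0 n W V" if "f \<in> rep_hom n W V" for f
  proof
    fix v show "f v = rep_0 n W V v"
      using that H by (cases "v \<in> {1..n}")
        (auto simp: rep_hom_iff hom0_def rep_0_def extensional_def)
  qed
  ultimately show "Hom_zero n W V" unfolding Hom_zero_def by blast
qed

definition retract :: "nat \<Rightarrow> 'k::field quiver_rep \<Rightarrow> 'k quiver_rep \<Rightarrow> bool" where
  "retract n A B \<longleftrightarrow> (\<exists>s r. is_hom n A B s \<and> is_hom n B A r \<and>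
     (\<forall>v. 0 < v \<longrightarrow> v \<le> n \<longrightarrow> r v * s v = 1\<^sub>m (vdim A v)))"

lemma isomorphicD:
  assumes "isomorphic n V W"
  obtains f g where "is_hom n V W f" "is_hom n W V g"
    "\<And>v. 0 < v \<Longrightarrow> v \<le> n \<Longrightarrow> g v * f v = 1\<^sub>m (vdim V v)"
    "\<And>v. 0 < v \<Longrightarrow> v \<le> n \<Longrightarrow> f v * g v = 1\<^sub>m (vdim W v)"
proof -
  obtain f g where fg: "f \<in> rep_hom n V W" "g \<in> rep_hom n W V"
    "rep_comp n g f = rep_id n V" "rep_comp n f g = rep_id n W"
    using assms unfolding isomorphic_def rep_isos_def by blast
  have ext: "rep_id n X \<in> extensional {1..n}" for X :: "'a quiver_rep" by (simp add: rep_id_def)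
  have "g v * f v = 1\<^sub>m (vdim V v)" "f v * g v = 1\<^sub>m (vdim W v)" if "0 < v" "v \<le> n" for v
    using fg(3,4)[unfolded rep_comp_eq_iff[OF ext]] that by (auto simp: rep_id_def)
  then show ?thesis using that fg(1,2) rep_hom_iff by blast
qed

lemma rep_isosI:
  assumes "is_hom n V W f" "is_hom n W V g"
    and "\<And>v. 0 < v \<Longrightarrow> v \<le> n \<Longrightarrow> g v * f v = 1\<^sub>m (vdim V v)"
    and "\<And>v. 0 < v \<Longrightarrow> v \<le> n \<Longrightarrow> f v * g v = 1\<^sub>m (vdim W v)"
  shows "restrict f {1..n} \<in> rep_isos n V W"
proof -
  have ext: "rep_id n X \<in> extensional {1..n}" for X :: "'a quiver_rep" by (simp add: rep_id_def)
  have "rep_comp n (restrict g {1..n}) (restrict f {1..n}) = rep_id n V"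
    "rep_comp n (restrict f {1..n}) (restrict g {1..n}) = rep_id n W"
    unfolding rep_comp_eq_iff[OF ext] using assms(3,4) by (auto simp: rep_id_def)
  then show ?thesis
    unfolding rep_isos_def using restrict_rep_hom[OF assms(1)] restrict_rep_hom[OF assms(2)] by blast
qed

lemma isomorphicI:
  assumes "is_hom n V W f" "is_hom n W V g"
    and "\<And>v. 0 < v \<Longrightarrow> v \<le> n \<Longrightarrow> g v * f v = 1\<^sub>m (vdim V v)"
    and "\<And>v. 0 < v \<Longrightarrow> v \<le> n \<Longrightarrow> f v * g v = 1\<^sub>m (vdim W v)"
  shows "isomorphic n V W"
  using rep_isosI[OF assms] unfolding isomorphic_def by blast

lemma isomorphic_retract:
  assumes "isomorphic n V W" shows "retract n V W" "retract n W V"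
proof -
  obtain f g where "is_hom n V W f" "is_hom n W V g"
    "\<And>v. 0 < v \<Longrightarrow> v \<le> n \<Longrightarrow> g v * f v = 1\<^sub>m (vdim V v)"
    "\<And>v. 0 < v \<Longrightarrow> v \<le> n \<Longrightarrow> f v * g v = 1\<^sub>m (vdim W v)"
    by (rule isomorphicD[OF assms], rule that)
  then show "retract n V W" "retract n W V" unfolding retract_def by blast+
qed

lemma hom0_retract:
  assumes reps: "is_rep n W" "is_rep n C" "is_rep n D" and "retract n C D" and "hom0 n W D"
  shows "hom0 n W C"
  unfolding hom0_def
proof (intro allI impI)
  fix f v assume f: "is_hom n W C f" and v: "0 < v" "v \<le> n"
  obtain t q where tq: "is_hom n C D t" "is_hom n D C q"
    "\<And>v. 0 < v \<Longrightarrow> v \<le> n \<Longrightarrow> q v * t v = 1\<^sub>m (vdim C v)"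
    using \<open>retract n C D\<close> unfolding retract_def by blast
  note [simp] = is_homD(1,2)[OF f v] is_homD(1,2)[OF tq(1) v] is_homD(1,2)[OF tq(2) v]
  have "t v * f v = 0\<^sub>m (vdim D v) (vdim W v)"
    using \<open>hom0 n W D\<close> v is_hom_comp[OF reps f tq(1)] unfolding hom0_def by blast
  then have "q v * t v * f v = 0\<^sub>m (vdim C v) (vdim W v)" by (simp add: mat_assoc_dim)
  then show "f v = 0\<^sub>m (vdim C v) (vdim W v)" by (simp add: tq(3)[OF v])
qed

lemma ext0_retract:
  assumes reps: "is_rep n W" "is_rep n C" "is_rep n D" and "retract n C D" and "ext0 n W D"
  shows "ext0 n W C"
proof (rule ext0I)
  fix \<theta> :: "nat \<Rightarrow> 'a mat"
  assume \<theta>: "\<And>v. 0 < v \<Longrightarrow> v < n \<Longrightarrow> dim_row (\<theta> v) = vdim C (Suc v)"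
    "\<And>v. 0 < v \<Longrightarrow> v < n \<Longrightarrow> dim_col (\<theta> v) = vdim W v"
  obtain t q where tq: "is_hom n C D t" "is_hom n D C q"
    "\<And>v. 0 < v \<Longrightarrow> v \<le> n \<Longrightarrow> q v * t v = 1\<^sub>m (vdim C v)"
    using \<open>retract n C D\<close> unfolding retract_def by blast
  obtain f where f0: "solves n W D (\<lambda>v. t (Suc v) * \<theta> v) f"
    by (rule ext0E[OF \<open>ext0 n W D\<close>, of "\<lambda>v. t (Suc v) * \<theta> v"]) (use is_homD(1,2)[OF tq(1)] \<theta> in auto)
  note f = solvesD[OF f0]
  have "q (Suc v) * f (Suc v) * amap W v = amap C v * (q v * f v) + \<theta> v" if v: "0 < v" "v < n" for v
  proof -
    have v': "v \<le> n" "0 < Suc v" "Suc v \<le> n" using v by auto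
    note [simp] = \<theta>[OF v] f(1,2)[OF v(1) v'(1)] f(1,2)[OF v'(2,3)] is_hom_dims[OF tq(1) v]
      is_hom_dims[OF tq(2) v] is_repD[OF reps(1) v] is_repD[OF reps(2) v] is_repD[OF reps(3) v]
    have "q (Suc v) * f (Suc v) * amap W v = q (Suc v) * amap D v * f v + (q (Suc v) * t (Suc v)) * \<theta> v"
      by (simp add: f(3)[OF v] mat_dim_simps)
    then show ?thesis
      by (simp add: tq(3)[OF v'(2,3)] is_homD(3)[OF tq(2) v] mat_assoc_dim)
  qed
  then have "solves n W C \<theta> (\<lambda>v. q v * f v)"
    using is_homD(1)[OF tq(2)] f(2) by (simp add: solves_def)
  then show "\<exists>f. solves n W C \<theta> f" by blast
qed

lemma mat_factor_image:
  fixes f N :: "'k::field mat"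
  assumes f: "f \<in> carrier_mat u a" and N: "N \<in> carrier_mat u c"
    and im: "\<And>j. j < c \<Longrightarrow> col N j \<in> (\<lambda>x. f *\<^sub>v x) ` carrier_vec a"
  obtains P where "P \<in> carrier_mat a c" "f * P = N"
proof -
  have "\<exists>y. y \<in> carrier_vec a \<and> f *\<^sub>v y = col N j" if "j < c" for j
    using im[OF that] by auto
  then obtain y where y: "\<And>j. j < c \<Longrightarrow> y j \<in> carrier_vec a" "\<And>j. j < c \<Longrightarrow> f *\<^sub>v y j = col N j"
    by metis
  define P where "P = mat a c (\<lambda>(i, j). y j $ i)"
  have P: "P \<in> carrier_mat a c" by (simp add: P_def)
  have colP: "col P j = y j" if "j < c" for j
    using y(1)[OF that] that by (intro eq_vecI) (auto simp: P_def)
  have "f * P = N"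
  proof (rule mat_col_eqI)
    fix j assume "j < dim_col N"
    then have j: "j < c" using N by simp
    have "col (f * P) j = f *\<^sub>v col P j" using f P j by (rule col_mult2)
    then show "col (f * P) j = col N j" using colP[OF j] y(2)[OF j] by simp
  qed (use f P N in auto)
  with P show ?thesis by (rule that)
qed

lemma mat_mult_left_cancel:
  fixes f :: "'k::field mat"
  assumes f: "f \<in> carrier_mat u a" and inj: "inj_on (\<lambda>x. f *\<^sub>v x) (carrier_vec a)"
    and A: "A \<in> carrier_mat a c" and B: "B \<in> carrier_mat a c" and eq: "f * A = f * B"
  shows "A = B"
proof (rule mat_col_eqI)
  fix j assume "j < dim_col B"
  then have j: "j < c" using B by simp
  have "f *\<^sub>v col A j = f *\<^sub>v col B j"
    using col_mult2[OF f A j] col_mult2[OF f B j] eq by simp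
  then show "col A j = col B j"
    using inj_onD[OF inj] A B j by (meson col_carrier_vec carrier_matD)
qed (use A B in auto)

lemma zero_mat_mult_vec: "x \<in> carrier_vec b \<Longrightarrow> 0\<^sub>m a b *\<^sub>v x = (0\<^sub>v a :: 'a::semiring_0 vec)"
  by (intro eq_vecI) auto

lemma exact_vertex_split:
  fixes f g :: "'k::field mat"
  assumes f: "f \<in> carrier_mat u a" and g: "g \<in> carrier_mat b u"
    and inj: "inj_on (\<lambda>x. f *\<^sub>v x) (carrier_vec a)"
    and ex: "(\<lambda>x. f *\<^sub>v x) ` carrier_vec a = mat_kernel g"
    and surj: "(\<lambda>x. g *\<^sub>v x) ` carrier_vec u = carrier_vec b"
  shows "\<exists>p s. p \<in> carrier_mat a u \<and> s \<in> carrier_mat u b \<and> p * f = 1\<^sub>m a \<and> g * s = 1\<^sub>m b \<and>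
    g * f = 0\<^sub>m b a \<and> f * p + s * g = 1\<^sub>m u"
proof -
  obtain s where s: "s \<in> carrier_mat u b" "g * s = 1\<^sub>m b"
    by (rule mat_factor_image[OF g one_carrier_mat]) (auto simp: surj)
  have ker: "g * N = 0\<^sub>m b c \<longleftrightarrow> (\<forall>j<c. col N j \<in> mat_kernel g)" if "N \<in> carrier_mat u c" for N c
  proof -
    have cols: "col (g * N) j = g *\<^sub>v col N j" "col (0\<^sub>m b c) j = (0\<^sub>v b :: 'k vec)" if "j < c" for j
      using col_mult2[OF g \<open>N \<in> carrier_mat u c\<close> that] that by simp_all
    have mem: "col N j \<in> mat_kernel g \<longleftrightarrow> g *\<^sub>v col N j = 0\<^sub>v b" if "j < c" for j
      using \<open>N \<in> carrier_mat u c\<close> by (auto simp: mat_kernel[OF g])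
    show ?thesis
    proof
      assume "g * N = 0\<^sub>m b c"
      then show "\<forall>j<c. col N j \<in> mat_kernel g" using cols mem by metis
    next
      assume "\<forall>j<c. col N j \<in> mat_kernel g"
      then have "\<And>j. j < dim_col (0\<^sub>m b c :: 'k mat) \<Longrightarrow> col (g * N) j = col (0\<^sub>m b c) j"
        using cols mem by simp
      then show "g * N = 0\<^sub>m b c" by (rule mat_col_eqI) (use that g in auto)
    qed
  qed
  note [simp] = carrier_matD[OF f] carrier_matD[OF g] carrier_matD[OF s(1)]
  have gf: "g * f = 0\<^sub>m b a"
    unfolding ker[OF f]
  proof (intro allI impI)
    fix j assume "j < a"
    then have "col f j = f *\<^sub>v col (1\<^sub>m a) j" using col_mult2[OF f one_carrier_mat] f by simp
    then show "col f j \<in> mat_kernel g" unfolding ex[symmetric] using \<open>j < a\<close> by simp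
  qed
  define N where "N = 1\<^sub>m u - s * g"
  have N: "N \<in> carrier_mat u u" unfolding N_def by (intro minus_carrier_mat mult_carrier_mat[OF s(1) g])
  have "g * N = g - g * s * g" by (simp add: N_def mat_mult_minus_dim mat_assoc_dim)
  then have "g * N = 0\<^sub>m b u" by (simp add: s(2))
  then have "\<forall>j<u. col N j \<in> mat_kernel g" using ker[OF N] by simp
  then have im: "\<And>j. j < u \<Longrightarrow> col N j \<in> (\<lambda>x. f *\<^sub>v x) ` carrier_vec a" using ex by blast
  obtain p where p: "p \<in> carrier_mat a u" "f * p = N"
    by (rule mat_factor_image[OF f N im])
  note [simp] = carrier_matD[OF p(1)]
  have "f * (p * f) = N * f" using p by (simp flip: mat_assoc_dim)
  also have "\<dots> = f * 1\<^sub>m a" by (simp add: N_def mat_minus_mult_dim mat_assoc_dim gf)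
  finally have "p * f = 1\<^sub>m a"
    using mat_mult_left_cancel[OF f inj mult_carrier_mat[OF p(1) f] one_carrier_mat] by simp
  moreover have "f * p + s * g = 1\<^sub>m u" unfolding p(2) N_def by (intro eq_matI) auto
  ultimately show ?thesis using p(1) s gf by blast
qed

lemma short_exactI:
  assumes reps: "is_rep n V" "is_rep n U" "is_rep n W" and f: "is_hom n V U f" and g: "is_hom n U W g"
    and sp: "\<And>v. 0 < v \<Longrightarrow> v \<le> n \<Longrightarrow> p v \<in> carrier_mat (vdim V v) (vdim U v) \<and>
      s v \<in> carrier_mat (vdim U v) (vdim W v) \<and> p v * f v = 1\<^sub>m (vdim V v) \<and> g v * s v = 1\<^sub>m (vdim W v) \<and>
      g v * f v = 0\<^sub>m (vdim W v) (vdim V v) \<and> f v * p v + s v * g v = 1\<^sub>m (vdim U v)"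
  shows "short_exact n V (restrict f {1..n}) U (restrict g {1..n}) W"
proof -
  have "inj_on (\<lambda>x. f v *\<^sub>v x) (carrier_vec (vdim V v)) \<and>
        (\<lambda>x. f v *\<^sub>v x) ` carrier_vec (vdim V v) = mat_kernel (g v) \<and>
        (\<lambda>x. g v *\<^sub>v x) ` carrier_vec (vdim U v) = carrier_vec (vdim W v)" if v: "0 < v" "v \<le> n" for v
  proof -
    have fv: "f v \<in> carrier_mat (vdim U v) (vdim V v)" using is_homD(1,2)[OF f v] by auto
    have gv: "g v \<in> carrier_mat (vdim W v) (vdim U v)" using is_homD(1,2)[OF g v] by auto
    have p: "p v \<in> carrier_mat (vdim V v) (vdim U v)" and s: "s v \<in> carrier_mat (vdim U v) (vdim W v)"
      and pf: "p v * f v = 1\<^sub>m (vdim V v)" and gs: "g v * s v = 1\<^sub>m (vdim W v)"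
      and gf: "g v * f v = 0\<^sub>m (vdim W v) (vdim V v)" and fpsg: "f v * p v + s v * g v = 1\<^sub>m (vdim U v)"
      using sp[OF v] by auto
    have 1: "p v *\<^sub>v (f v *\<^sub>v x) = x" if "x \<in> carrier_vec (vdim V v)" for x
      using assoc_mult_mat_vec[OF p fv that] that pf by simp
    have 2: "g v *\<^sub>v (s v *\<^sub>v x) = x" if "x \<in> carrier_vec (vdim W v)" for x
      using assoc_mult_mat_vec[OF gv s that] that gs by simp
    have 3: "g v *\<^sub>v (f v *\<^sub>v x) = 0\<^sub>v (vdim W v)" if "x \<in> carrier_vec (vdim V v)" for x
      using assoc_mult_mat_vec[OF gv fv that] that gf by (metis zero_mat_mult_vec)
    have 4: "f v *\<^sub>v (p v *\<^sub>v x) = x" if "x \<in> carrier_vec (vdim U v)" "g v *\<^sub>v x = 0\<^sub>v (vdim W v)" for x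
    proof -
      have "x = (f v * p v + s v * g v) *\<^sub>v x" using that fpsg by simp
      also have "\<dots> = f v *\<^sub>v (p v *\<^sub>v x) + s v *\<^sub>v (g v *\<^sub>v x)"
        using add_mult_distrib_mat_vec[OF mult_carrier_mat[OF fv p] mult_carrier_mat[OF s gv] that(1)]
          assoc_mult_mat_vec[OF fv p that(1)] assoc_mult_mat_vec[OF s gv that(1)] by simp
      also have "s v *\<^sub>v (g v *\<^sub>v x) = 0\<^sub>v (vdim U v)" unfolding that(2) using s by (intro eq_vecI) auto
      finally show ?thesis using fv p that(1) by simp
    qed
    have "inj_on (\<lambda>x. f v *\<^sub>v x) (carrier_vec (vdim V v))" using 1 by (metis inj_onI)
    moreover have "(\<lambda>x. f v *\<^sub>v x) ` carrier_vec (vdim V v) = mat_kernel (g v)"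
    proof
      show "(\<lambda>x. f v *\<^sub>v x) ` carrier_vec (vdim V v) \<subseteq> mat_kernel (g v)"
        using 3 fv by (auto simp: mat_kernel[OF gv])
      show "mat_kernel (g v) \<subseteq> (\<lambda>x. f v *\<^sub>v x) ` carrier_vec (vdim V v)"
      proof
        fix x assume "x \<in> mat_kernel (g v)"
        then have x: "x \<in> carrier_vec (vdim U v)" "g v *\<^sub>v x = 0\<^sub>v (vdim W v)"
          by (auto simp: mat_kernel[OF gv])
        show "x \<in> (\<lambda>x. f v *\<^sub>v x) ` carrier_vec (vdim V v)"
          using 4[OF x, symmetric] mult_mat_vec_carrier[OF p x(1)] by (rule image_eqI)
      qed
    qed
    moreover have "(\<lambda>x. g v *\<^sub>v x) ` carrier_vec (vdim U v) = carrier_vec (vdim W v)"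
    proof
      show "(\<lambda>x. g v *\<^sub>v x) ` carrier_vec (vdim U v) \<subseteq> carrier_vec (vdim W v)"
        using gv by auto
      show "carrier_vec (vdim W v) \<subseteq> (\<lambda>x. g v *\<^sub>v x) ` carrier_vec (vdim U v)"
      proof
        fix x :: "'a vec" assume x: "x \<in> carrier_vec (vdim W v)"
        show "x \<in> (\<lambda>x. g v *\<^sub>v x) ` carrier_vec (vdim U v)"
          using 2[OF x, symmetric] mult_mat_vec_carrier[OF s x] by (rule image_eqI)
      qed
    qed
    ultimately show ?thesis by blast
  qed
  then show ?thesis
    unfolding short_exact_def using reps restrict_rep_hom[OF f] restrict_rep_hom[OF g] by simp
qed

definition ext_rep :: "'k::field quiver_rep \<Rightarrow> (nat \<Rightarrow> 'k mat) \<Rightarrow> 'k quiver_rep \<Rightarrow> 'k quiver_rep" where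
  "ext_rep V \<theta> W = Rep (\<lambda>v. vdim V v + vdim W v) (\<lambda>v.
     in_l V W (Suc v) * amap V v * pr_l V W v +
     in_l V W (Suc v) * \<theta> v * pr_r V W v +
     in_r V W (Suc v) * amap W v * pr_r V W v)"

lemma ext_rep_biproduct:
  fixes V W :: "'k::field quiver_rep"
  assumes reps: "is_rep n V" "is_rep n W"
    and \<theta>: "\<And>v. 0 < v \<Longrightarrow> v < n \<Longrightarrow> dim_row (\<theta> v) = vdim V (Suc v)"
      "\<And>v. 0 < v \<Longrightarrow> v < n \<Longrightarrow> dim_col (\<theta> v) = vdim W v"
  shows "is_rep n (ext_rep V \<theta> W)"
    and "is_hom n V (ext_rep V \<theta> W) (\<lambda>v. in_l V W v)"
    and "is_hom n (ext_rep V \<theta> W) W (\<lambda>v. pr_r V W v)"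
proof -
  show "is_rep n (ext_rep V \<theta> W)"
    using is_repD[OF reps(1)] is_repD[OF reps(2)] \<theta> by (intro is_repI) (auto simp: ext_rep_def)
  show "is_hom n V (ext_rep V \<theta> W) (\<lambda>v. in_l V W v)"
  proof (rule is_homI)
    fix v assume v: "0 < v" "v < n"
    note [simp] = is_repD[OF reps(1) v] is_repD[OF reps(2) v] \<theta>[OF v]
    show "in_l V W (Suc v) * amap V v
        = amap (ext_rep V \<theta> W) v * in_l V W v"
      by (simp add: ext_rep_def mat_dim_simps)
  qed (simp_all add: ext_rep_def)
  show "is_hom n (ext_rep V \<theta> W) W (\<lambda>v. pr_r V W v)"
  proof (rule is_homI)
    fix v assume v: "0 < v" "v < n"
    note [simp] = is_repD[OF reps(1) v] is_repD[OF reps(2) v] \<theta>[OF v]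
    show "pr_r V W (Suc v) * amap (ext_rep V \<theta> W) v
        = amap W v * pr_r V W v"
      by (simp add: ext_rep_def mat_dim_simps)
  qed (simp_all add: ext_rep_def)
qed

lemma ext_rep_extension:
  fixes V W :: "'k::field quiver_rep"
  assumes reps: "is_rep n V" "is_rep n W"
    and \<theta>: "\<And>v. 0 < v \<Longrightarrow> v < n \<Longrightarrow> dim_row (\<theta> v) = vdim V (Suc v)"
      "\<And>v. 0 < v \<Longrightarrow> v < n \<Longrightarrow> dim_col (\<theta> v) = vdim W v"
  shows "((\<lambda>v\<in>{1..n}. in_l V W v), ext_rep V \<theta> W, (\<lambda>v\<in>{1..n}. pr_r V W v))
    \<in> extensions n W V"
proof -
  note e = ext_rep_biproduct[OF reps \<theta>]
  have "short_exact n V (\<lambda>v\<in>{1..n}. in_l V W v) (ext_rep V \<theta> W)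
      (\<lambda>v\<in>{1..n}. pr_r V W v) W"
    by (rule short_exactI[OF reps(1) e(1) reps(2) e(2) e(3),
          where p = "\<lambda>v. pr_l V W v" and s = "\<lambda>v. in_r V W v"])
      (auto simp: ext_rep_def intro!: carrier_matI)
  then show ?thesis unfolding extensions_def by simp
qed

lemma ext_equiv_iff:
  "((f, U, g), (f', U', g')) \<in> ext_equiv n W V \<longleftrightarrow>
     (f, U, g) \<in> extensions n W V \<and> (f', U', g') \<in> extensions n W V \<and>
     (\<exists>h\<in>rep_isos n U U'. rep_comp n h f = f' \<and> rep_comp n g' h = g)"
  by (simp add: ext_equiv_def)

lemma Ext1_zero_imp_ext0:
  fixes V W :: "'k::field quiver_rep"
  assumes reps: "is_rep n W" "is_rep n V" and E: "Ext1_zero n W V"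
  shows "ext0 n W V"
proof (rule ext0I)
  fix \<theta> :: "nat \<Rightarrow> 'k mat"
  assume \<theta>: "\<And>v. 0 < v \<Longrightarrow> v < n \<Longrightarrow> dim_row (\<theta> v) = vdim V (Suc v)"
    "\<And>v. 0 < v \<Longrightarrow> v < n \<Longrightarrow> dim_col (\<theta> v) = vdim W v"
  define z :: "nat \<Rightarrow> 'k mat" where "z v = 0\<^sub>m (vdim V (Suc v)) (vdim W v)" for v
  have z: "dim_row (z v) = vdim V (Suc v)" "dim_col (z v) = vdim W v" for v by (simp_all add: z_def)
  define f :: "nat \<Rightarrow> 'k mat" where "f = (\<lambda>v\<in>{1..n}. in_l V W v)"
  define g :: "nat \<Rightarrow> 'k mat" where "g = (\<lambda>v\<in>{1..n}. pr_r V W v)"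
  define U where "U = ext_rep V z W"
  define U' where "U' = ext_rep V \<theta> W"
  have xy: "(f, U, g) \<in> extensions n W V" "(f, U', g) \<in> extensions n W V"
    unfolding f_def g_def U_def U'_def
    by (rule ext_rep_extension[OF reps(2,1) z(1) z(2)], rule ext_rep_extension[OF reps(2,1) \<theta>(1) \<theta>(2)])
  have ext: "f \<in> extensional {1..n}" "g \<in> extensional {1..n}" by (simp_all add: f_def g_def)
  have rU': "is_rep n U'" unfolding U'_def by (rule ext_rep_biproduct(1)[OF reps(2,1) \<theta>])
  have dU: "vdim U' v = vdim V v + vdim W v" "vdim U v = vdim V v + vdim W v" for v
    by (simp_all add: U_def U'_def ext_rep_def)
  have id: "is_hom n U' U' (\<lambda>v. 1\<^sub>m (vdim U' v))"
    using is_repD[OF rU'] by (intro is_homI) auto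
  have "(\<lambda>v\<in>{1..n}. 1\<^sub>m (vdim U' v)) \<in> rep_isos n U' U'"
    by (rule rep_isosI[OF id id]) simp_all
  moreover have "rep_comp n (\<lambda>v\<in>{1..n}. 1\<^sub>m (vdim U' v)) f = f" "rep_comp n g (\<lambda>v\<in>{1..n}. 1\<^sub>m (vdim U' v)) = g"
    unfolding rep_comp_eq_iff[OF ext(1)] rep_comp_eq_iff[OF ext(2)] by (auto simp: f_def g_def dU)
  ultimately have refl: "((f, U', g), (f, U', g)) \<in> ext_equiv n W V"
    unfolding ext_equiv_iff using xy(2) by blast
  have "ext_equiv n W V `` {(f, U, g)} = ext_equiv n W V `` {(f, U', g)}"
    using E quotientI[OF xy(1), of "ext_equiv n W V"] quotientI[OF xy(2), of "ext_equiv n W V"]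
    unfolding Ext1_zero_def Ext1_def is_singleton_def by (metis singletonD)
  then have "((f, U, g), (f, U', g)) \<in> ext_equiv n W V" using refl by blast
  then obtain h where h: "h \<in> rep_isos n U U'" "rep_comp n h f = f" "rep_comp n g h = g"
    unfolding ext_equiv_iff by blast
  have hom: "is_hom n U U' h" using h(1) unfolding rep_isos_def rep_hom_iff by blast
  have hf: "h v * in_l V W v = in_l V W v"
    and gh: "pr_r V W v * h v = pr_r V W v" if "0 < v" "v \<le> n" for v
    using h(2,3)[unfolded rep_comp_eq_iff[OF ext(1)] rep_comp_eq_iff[OF ext(2)]] that
    by (auto simp: f_def g_def)
  define \<phi> where "\<phi> v = pr_l V W v * (h v * in_r V W v)" for v
  have "\<phi> (Suc v) * amap W v = amap V v * \<phi> v + \<theta> v" if v: "0 < v" "v < n" for v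
  proof -
    have v': "v \<le> n" "0 < Suc v" "Suc v \<le> n" using v by auto
    note [simp] = is_repD[OF reps(1) v] is_repD[OF reps(2) v] \<theta>[OF v] z
      is_homD(1,2)[OF hom v(1) v'(1), unfolded dU] is_homD(1,2)[OF hom v'(2,3), unfolded dU]
    let ?l = "pr_l V W (Suc v) :: 'k mat" and ?r = "in_r V W v :: 'k mat"
    have 1: "amap U v * ?r = in_r V W (Suc v) * amap W v"
      by (simp add: U_def ext_rep_def mat_dim_simps z_def)
    have 2: "?l * amap U' v = amap V v * pr_l V W v + \<theta> v * pr_r V W v"
      by (simp add: U'_def ext_rep_def mat_dim_simps)
    have [simp]: "dim_row (amap U v) = vdim V (Suc v) + vdim W (Suc v)" "dim_col (amap U v) = vdim V v + vdim W v"
      "dim_row (amap U' v) = vdim V (Suc v) + vdim W (Suc v)" "dim_col (amap U' v) = vdim V v + vdim W v"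
      by (simp_all add: U_def U'_def ext_rep_def)
    have "\<phi> (Suc v) * amap W v = ?l * (h (Suc v) * (in_r V W (Suc v) * amap W v))"
      by (simp add: \<phi>_def mat_assoc_dim)
    also have "\<dots> = ?l * (h (Suc v) * amap U v * ?r)"
      unfolding 1[symmetric] by (simp add: mat_assoc_dim)
    also have "\<dots> = (?l * amap U' v) * (h v * ?r)"
      unfolding is_homD(3)[OF hom v] by (simp add: mat_assoc_dim)
    also have "\<dots> = amap V v * \<phi> v + \<theta> v * ((pr_r V W v * h v) * ?r)"
      unfolding 2 by (simp add: mat_dim_simps \<phi>_def)
    also have "\<dots> = amap V v * \<phi> v + \<theta> v"
      unfolding gh[OF v(1) v'(1)] by simp
    finally show ?thesis .
  qed
  moreover have "dim_row (\<phi> v) = vdim V v \<and> dim_col (\<phi> v) = vdim W v" for v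
    by (simp add: \<phi>_def)
  ultimately show "\<exists>f. solves n W V \<theta> f"
    unfolding solves_def by blast
qed

lemma mat_complement_zero:
  fixes f :: "'k::field mat"
  assumes [simp]: "dim_row f = u" "dim_col f = a" "dim_row p = a" "dim_col p = u"
    "dim_row s = u" "dim_col s = b" "dim_row g = b" "dim_col g = u"
    and pf: "p * f = 1\<^sub>m a" and gs: "g * s = 1\<^sub>m b" and sum: "f * p + s * g = 1\<^sub>m u"
  shows "p * s = 0\<^sub>m a b" "g * f = 0\<^sub>m b a"
proof -
  have zero: "X = 0\<^sub>m c d" if "X = X + X" "X \<in> carrier_mat c d" for X :: "'k mat" and c d
  proof -
    have "X - X = X + X - X" using that(1) by simp
    also have "\<dots> = X" by (intro eq_matI) auto
    finally show ?thesis using that(2) by simp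
  qed
  have "p * s = p * (f * p + s * g) * s" by (simp add: sum)
  also have "\<dots> = (p * f) * (p * s) + p * s * (g * s)" by (simp add: mat_dim_simps)
  finally show "p * s = 0\<^sub>m a b" by (intro zero carrier_matI) (simp_all add: pf gs)
  have "g * f = g * (f * p + s * g) * f" by (simp add: sum)
  also have "\<dots> = g * f * (p * f) + (g * s) * (g * f)" by (simp add: mat_dim_simps)
  finally show "g * f = 0\<^sub>m b a" by (intro zero carrier_matI) (simp_all add: pf gs)
qed

definition biprod :: "nat \<Rightarrow> 'k::field quiver_rep \<Rightarrow> 'k quiver_rep \<Rightarrow> 'k quiver_rep \<Rightarrow>
    (nat \<Rightarrow> 'k mat) \<Rightarrow> (nat \<Rightarrow> 'k mat) \<Rightarrow> (nat \<Rightarrow> 'k mat) \<Rightarrow> (nat \<Rightarrow> 'k mat) \<Rightarrow> bool" where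
  "biprod n V W U f p s g \<longleftrightarrow> is_rep n V \<and> is_rep n W \<and> is_rep n U \<and>
     is_hom n V U f \<and> is_hom n U V p \<and> is_hom n W U s \<and> is_hom n U W g \<and>
     (\<forall>v. 0 < v \<longrightarrow> v \<le> n \<longrightarrow> p v * f v = 1\<^sub>m (vdim V v) \<and> g v * s v = 1\<^sub>m (vdim W v) \<and>
        f v * p v + s v * g v = 1\<^sub>m (vdim U v))"

lemma biprodD:
  assumes "biprod n V W U f p s g"
  shows "is_rep n V" "is_rep n W" "is_rep n U" "is_hom n V U f" "is_hom n U V p" "is_hom n W U s" "is_hom n U W g"
    and "0 < v \<Longrightarrow> v \<le> n \<Longrightarrow> p v * f v = 1\<^sub>m (vdim V v)"
    and "0 < v \<Longrightarrow> v \<le> n \<Longrightarrow> g v * s v = 1\<^sub>m (vdim W v)"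
    and "0 < v \<Longrightarrow> v \<le> n \<Longrightarrow> f v * p v + s v * g v = 1\<^sub>m (vdim U v)"
  using assms unfolding biprod_def by blast+

lemma biprodI:
  assumes reps: "is_rep n V" "is_rep n W" "is_rep n U"
    and f: "is_hom n V U f" and s: "is_hom n W U s" and g: "is_hom n U W g"
    and dp: "\<And>v. 0 < v \<Longrightarrow> v \<le> n \<Longrightarrow> dim_row (p v) = vdim V v" "\<And>v. 0 < v \<Longrightarrow> v \<le> n \<Longrightarrow> dim_col (p v) = vdim U v"
    and eqs: "\<And>v. 0 < v \<Longrightarrow> v \<le> n \<Longrightarrow> p v * f v = 1\<^sub>m (vdim V v)"
      "\<And>v. 0 < v \<Longrightarrow> v \<le> n \<Longrightarrow> g v * s v = 1\<^sub>m (vdim W v)"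
      "\<And>v. 0 < v \<Longrightarrow> v \<le> n \<Longrightarrow> f v * p v + s v * g v = 1\<^sub>m (vdim U v)"
  shows "biprod n V W U f p s g"
proof -
  have "p (Suc v) * amap U v = amap V v * p v" if v: "0 < v" "v < n" for v
  proof -
    have v': "v \<le> n" "0 < Suc v" "Suc v \<le> n" using v by auto
    note d = is_homD(1,2)[OF f v'(2,3)] dp[OF v'(2,3)] is_homD(1,2)[OF s v'(2,3)] is_homD(1,2)[OF g v'(2,3)]
    note [simp] = d is_homD(1,2)[OF f v(1) v'(1)] dp[OF v(1) v'(1)] is_homD(1,2)[OF s v(1) v'(1)]
      is_homD(1,2)[OF g v(1) v'(1)] is_repD[OF reps(1) v] is_repD[OF reps(2) v] is_repD[OF reps(3) v]
    have "p (Suc v) * amap U v = p (Suc v) * (amap U v * (f v * p v + s v * g v))"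
      by (simp add: eqs(3)[OF v(1) v'(1)])
    also have "\<dots> = p (Suc v) * (amap U v * f v * p v) + p (Suc v) * (amap U v * s v * g v)"
      by (simp add: mat_dim_simps)
    also have "\<dots> = (p (Suc v) * f (Suc v)) * (amap V v * p v) + (p (Suc v) * s (Suc v)) * (amap W v * g v)"
      unfolding is_homD(3)[OF f v, symmetric] is_homD(3)[OF s v, symmetric] by (simp add: mat_assoc_dim)
    also have "\<dots> = amap V v * p v"
      unfolding mat_complement_zero(1)[OF d eqs[OF v'(2,3)]] eqs(1)[OF v'(2,3)] by simp
    finally show ?thesis .
  qed
  then have "is_hom n U V p" using dp by (intro is_homI) auto
  then show ?thesis using assms unfolding biprod_def by blast
qed

lemma biprod_iso:
  fixes V W U U' :: "'k::field quiver_rep"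
  assumes B: "biprod n V W U f p s g" and B': "biprod n V W U' f' p' s' g'"
  obtains h where "restrict h {1..n} \<in> rep_isos n U U'"
    "\<And>v. 0 < v \<Longrightarrow> v \<le> n \<Longrightarrow> h v * f v = f' v" "\<And>v. 0 < v \<Longrightarrow> v \<le> n \<Longrightarrow> g' v * h v = g v"
proof -
  note D = biprodD[OF B] and D' = biprodD[OF B']
  have sum: "is_hom n X Y (\<lambda>v. a v * b v + c v * d v)"
    if "is_rep n X" "is_rep n Y" "is_hom n V Y a" "is_hom n X V b" "is_hom n W Y c" "is_hom n X W d" for X Y a b c d
  proof (rule is_homI)
    fix v assume v: "0 < v" "v < n"
    then have v': "v \<le> n" "0 < Suc v" "Suc v \<le> n" by auto
    note h1 = is_hom_comp[OF that(1) D(1) that(2) that(4) that(3)]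
      and h2 = is_hom_comp[OF that(1) D(2) that(2) that(6) that(5)]
    note d = is_hom_dims[OF h1 v] is_hom_dims[OF h2 v]
    note [simp] = d is_repD[OF that(1) v] is_repD[OF that(2) v]
    show "(a (Suc v) * b (Suc v) + c (Suc v) * d (Suc v)) * amap X v = amap Y v * (a v * b v + c v * d v)"
      using is_homD(3)[OF h1 v] is_homD(3)[OF h2 v] d by (simp add: mat_add_mult_dim mat_mult_add_dim)
  qed (use is_homD[OF that(3)] is_homD[OF that(4)] is_homD[OF that(5)] is_homD[OF that(6)] in auto)
  define h where "h v = f' v * p v + s' v * g v" for v
  define k where "k v = f v * p' v + s v * g' v" for v
  have h: "is_hom n U U' h" unfolding h_def by (rule sum[OF D(3) D'(3) D'(4) D(5) D'(6) D(7)])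
  have k: "is_hom n U' U k" unfolding k_def by (rule sum[OF D'(3) D(3) D(4) D'(5) D(6) D'(7)])
  have inv: "k v * h v = 1\<^sub>m (vdim U v)" "h v * k v = 1\<^sub>m (vdim U' v)" "h v * f v = f' v" "g' v * h v = g v"
    if v: "0 < v" "v \<le> n" for v
  proof -
    note d = is_homD(1,2)[OF D(4) v] is_homD(1,2)[OF D(5) v] is_homD(1,2)[OF D(6) v] is_homD(1,2)[OF D(7) v]
    note d' = is_homD(1,2)[OF D'(4) v] is_homD(1,2)[OF D'(5) v] is_homD(1,2)[OF D'(6) v] is_homD(1,2)[OF D'(7) v]
    note [simp] = d d'
    note c = D(8-10)[OF v] mat_complement_zero[OF d D(8-10)[OF v]]
    note c' = D'(8-10)[OF v] mat_complement_zero[OF d' D'(8-10)[OF v]]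
    have "k v * h v = f v * ((p' v * f' v) * p v) + s v * ((g' v * f' v) * p v)
        + (f v * ((p' v * s' v) * g v) + s v * ((g' v * s' v) * g v))"
      by (simp add: h_def k_def mat_dim_simps)
    then show "k v * h v = 1\<^sub>m (vdim U v)" using c(3) by (simp add: c')
    have "h v * k v = f' v * ((p v * f v) * p' v) + s' v * ((g v * f v) * p' v)
        + (f' v * ((p v * s v) * g' v) + s' v * ((g v * s v) * g' v))"
      by (simp add: h_def k_def mat_dim_simps)
    then show "h v * k v = 1\<^sub>m (vdim U' v)" using c'(3) by (simp add: c)
    show "h v * f v = f' v" by (simp add: h_def mat_dim_simps c)
    have "g' v * h v = (g' v * f' v) * p v + (g' v * s' v) * g v" by (simp add: h_def mat_dim_simps)
    then show "g' v * h v = g v" by (simp add: c')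
  qed
  have "restrict h {1..n} \<in> rep_isos n U U'" by (rule rep_isosI[OF h k]) (use inv in auto)
  then show ?thesis using inv(3,4) by (rule that)
qed

lemma ext0_split:
  fixes V W :: "'k::field quiver_rep"
  assumes E: "ext0 n W V" and ex: "short_exact n V f U g W"
  shows "\<exists>p s. biprod n V W U f p s g"
proof -
  have reps: "is_rep n V" "is_rep n U" "is_rep n W" and f: "is_hom n V U f" and g: "is_hom n U W g"
    using ex unfolding short_exact_def rep_hom_iff by blast+
  define Q where "Q v p s \<longleftrightarrow> p \<in> carrier_mat (vdim V v) (vdim U v) \<and> s \<in> carrier_mat (vdim U v) (vdim W v) \<and>
     p * f v = 1\<^sub>m (vdim V v) \<and> g v * s = 1\<^sub>m (vdim W v) \<and> g v * f v = 0\<^sub>m (vdim W v) (vdim V v) \<and>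
     f v * p + s * g v = 1\<^sub>m (vdim U v)" for v p s
  have "\<exists>p s. Q v p s" if v: "0 < v" "v \<le> n" for v
  proof -
    have "v \<in> {1..n}" using v by simp
    then show ?thesis
      using ex is_homD(1,2)[OF f v] is_homD(1,2)[OF g v] unfolding short_exact_def Q_def
      by (intro exact_vertex_split) auto
  qed
  then obtain p s where "\<And>v. 0 < v \<Longrightarrow> v \<le> n \<Longrightarrow> Q v (p v) (s v)" by metis
  then have ps: "\<And>v. 0 < v \<Longrightarrow> v \<le> n \<Longrightarrow> p v \<in> carrier_mat (vdim V v) (vdim U v)"
    "\<And>v. 0 < v \<Longrightarrow> v \<le> n \<Longrightarrow> s v \<in> carrier_mat (vdim U v) (vdim W v)"
    "\<And>v. 0 < v \<Longrightarrow> v \<le> n \<Longrightarrow> p v * f v = 1\<^sub>m (vdim V v)"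
    "\<And>v. 0 < v \<Longrightarrow> v \<le> n \<Longrightarrow> g v * s v = 1\<^sub>m (vdim W v)"
    "\<And>v. 0 < v \<Longrightarrow> v \<le> n \<Longrightarrow> g v * f v = 0\<^sub>m (vdim W v) (vdim V v)"
    "\<And>v. 0 < v \<Longrightarrow> v \<le> n \<Longrightarrow> f v * p v + s v * g v = 1\<^sub>m (vdim U v)"
    unfolding Q_def by blast+
  define \<theta> where "\<theta> v = p (Suc v) * (amap U v * s v)" for v
  obtain \<phi> where \<phi>0: "solves n W V (\<theta>) \<phi>"
    by (rule ext0E[OF E, of \<theta>]) (use carrier_matD(1)[OF ps(1)] carrier_matD(2)[OF ps(2)] in \<open>auto simp: \<theta>_def\<close>)
  note \<phi> = solvesD[OF \<phi>0]
  define s' where "s' v = s v + f v * \<phi> v" for v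
  define p' where "p' v = p v - \<phi> v * g v" for v
  have d: "dim_row (p v) = vdim V v" "dim_col (p v) = vdim U v" "dim_row (s v) = vdim U v"
    "dim_col (s v) = vdim W v" "dim_row (f v) = vdim U v" "dim_col (f v) = vdim V v"
    "dim_row (g v) = vdim W v" "dim_col (g v) = vdim U v" "dim_row (\<phi> v) = vdim V v" "dim_col (\<phi> v) = vdim W v"
    if "0 < v" "v \<le> n" for v
    using ps(1,2)[OF that] is_homD(1,2)[OF f that] is_homD(1,2)[OF g that] \<phi>(1,2)[OF that] by auto
  have split: "p' v * f v = 1\<^sub>m (vdim V v)" "g v * s' v = 1\<^sub>m (vdim W v)"
    "f v * p' v + s' v * g v = 1\<^sub>m (vdim U v)" if v: "0 < v" "v \<le> n" for v
  proof -
    note [simp] = d[OF v]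
    show "p' v * f v = 1\<^sub>m (vdim V v)"
      by (simp add: p'_def mat_dim_simps ps(3,5)[OF v])
    have "g v * s' v = g v * s v + g v * f v * \<phi> v" by (simp add: s'_def mat_dim_simps)
    then show "g v * s' v = 1\<^sub>m (vdim W v)" by (simp add: ps(4,5)[OF v])
    have "f v * p' v + s' v * g v = (f v * p v - f v * (\<phi> v * g v)) + (s v * g v + f v * (\<phi> v * g v))"
      by (simp add: p'_def s'_def mat_dim_simps)
    also have "\<dots> = f v * p v + s v * g v"
      by (intro eq_matI) auto
    finally show "f v * p' v + s' v * g v = 1\<^sub>m (vdim U v)" by (simp add: ps(6)[OF v])
  qed
  have d': "dim_row (p' v) = vdim V v" "dim_col (p' v) = vdim U v" "dim_row (s' v) = vdim U v"
    "dim_col (s' v) = vdim W v" if v: "0 < v" "v \<le> n" for v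
    using d[OF v] by (simp_all add: p'_def s'_def)
  have s'_nat: "s' (Suc v) * amap W v = amap U v * s' v" if v: "0 < v" "v < n" for v
  proof -
    have v': "v \<le> n" "0 < Suc v" "Suc v \<le> n" using v by auto
    note [simp] = d[OF v(1) v'(1)] d[OF v'(2,3)] is_repD[OF reps(1) v] is_repD[OF reps(2) v] is_repD[OF reps(3) v]
    have "amap U v * s v = (f (Suc v) * p (Suc v) + s (Suc v) * g (Suc v)) * (amap U v * s v)"
      by (simp add: ps(6)[OF v'(2,3)])
    also have "\<dots> = f (Suc v) * \<theta> v + s (Suc v) * (g (Suc v) * amap U v * s v)"
      by (simp add: mat_dim_simps \<theta>_def)
    also have "g (Suc v) * amap U v * s v = amap W v"
      unfolding is_homD(3)[OF g v] by (simp add: mat_assoc_dim ps(4)[OF v(1) v'(1)])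
    finally have Us: "amap U v * s v = f (Suc v) * \<theta> v + s (Suc v) * amap W v" .
    have [simp]: "dim_row (\<theta> v) = vdim V (Suc v)" "dim_col (\<theta> v) = vdim W v" by (simp_all add: \<theta>_def)
    have "s' (Suc v) * amap W v = s (Suc v) * amap W v + f (Suc v) * (\<phi> (Suc v) * amap W v)"
      by (simp add: s'_def mat_dim_simps)
    also have "\<dots> = s (Suc v) * amap W v + (f (Suc v) * amap V v * \<phi> v + f (Suc v) * \<theta> v)"
      unfolding \<phi>(3)[OF v] by (simp add: mat_dim_simps)
    also have "\<dots> = f (Suc v) * \<theta> v + s (Suc v) * amap W v + f (Suc v) * amap V v * \<phi> v"
      by (intro eq_matI) auto
    also have "\<dots> = amap U v * s' v"
      unfolding is_homD(3)[OF f v] Us[symmetric] by (simp add: s'_def mat_dim_simps)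
    finally show ?thesis .
  qed
  have s'_hom: "is_hom n W U s'"
    using d' s'_nat by (intro is_homI) auto
  have "biprod n V W U f p' s' g"
    using d' split by (intro biprodI[OF reps(1,3,2) f s'_hom g]) auto
  then show ?thesis by blast
qed

lemma split_extensions_equiv:
  fixes V W :: "'k::field quiver_rep"
  assumes E: "ext0 n W V" and x: "(f, U, g) \<in> extensions n W V" and y: "(f', U', g') \<in> extensions n W V"
  shows "((f, U, g), (f', U', g')) \<in> ext_equiv n W V"
proof -
  have ex: "short_exact n V f U g W" "short_exact n V f' U' g' W" using x y unfolding extensions_def by auto
  then have ext: "g \<in> extensional {1..n}" "f' \<in> extensional {1..n}"
    unfolding short_exact_def rep_hom_iff by blast+
  obtain p s where B: "biprod n V W U f p s g" using ext0_split[OF E ex(1)] by blast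
  obtain p' s' where B': "biprod n V W U' f' p' s' g'" using ext0_split[OF E ex(2)] by blast
  obtain h where h: "restrict h {1..n} \<in> rep_isos n U U'"
    "\<And>v. 0 < v \<Longrightarrow> v \<le> n \<Longrightarrow> h v * f v = f' v" "\<And>v. 0 < v \<Longrightarrow> v \<le> n \<Longrightarrow> g' v * h v = g v"
    by (rule biprod_iso[OF B B']) (rule that)
  have "rep_comp n (restrict h {1..n}) f = f'" "rep_comp n g' (restrict h {1..n}) = g"
    unfolding rep_comp_eq_iff[OF ext(1)] rep_comp_eq_iff[OF ext(2)] using h(2,3) by auto
  then show ?thesis unfolding ext_equiv_iff using x y h(1) by blast
qed

lemma Ext1_zero_iff:
  fixes V W :: "'k::field quiver_rep"
  assumes reps: "is_rep n W" "is_rep n V"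
  shows "Ext1_zero n W V \<longleftrightarrow> ext0 n W V"
proof
  assume E: "ext0 n W V"
  define z :: "nat \<Rightarrow> 'k mat" where "z v = 0\<^sub>m (vdim V (Suc v)) (vdim W v)" for v
  obtain x where x: "x \<in> extensions n W V"
    using ext_rep_extension[OF reps(2,1), of z] by (auto simp: z_def)
  have "(y, y') \<in> ext_equiv n W V" if "y \<in> extensions n W V" "y' \<in> extensions n W V" for y y'
    using split_extensions_equiv[OF E] that by (cases y, cases y') auto
  moreover have "ext_equiv n W V \<subseteq> extensions n W V \<times> extensions n W V"
    unfolding ext_equiv_def by auto
  ultimately have "ext_equiv n W V `` {y} = extensions n W V" if "y \<in> extensions n W V" for y
    using that by blast
  then have "Ext1 n W V = {extensions n W V}"
    unfolding Ext1_def quotient_def using x by blast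
  then show "Ext1_zero n W V" unfolding Ext1_zero_def is_singleton_def by blast
qed (rule Ext1_zero_imp_ext0[OF reps])

section \<open>Perpendicularity to an interval module\<close>

primrec path :: "'k::field quiver_rep \<Rightarrow> nat \<Rightarrow> nat \<Rightarrow> 'k mat" where
  "path M u 0 = 1\<^sub>m (vdim M u)"
| "path M u (Suc v) = (if Suc v \<le> u then 1\<^sub>m (vdim M u) else amap M v * path M u v)"

lemma path_self [simp]: "path M u u = 1\<^sub>m (vdim M u)"
  by (cases u) auto

lemma path_Suc: "u \<le> v \<Longrightarrow> path M u (Suc v) = amap M v * path M u v"
  by simp

declare path.simps [simp del]

lemma dim_path:
  assumes "is_rep n M" "0 < u" "u \<le> v" "v \<le> n"
  shows "dim_row (path M u v) = vdim M v" "dim_col (path M u v) = vdim M u"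
proof -
  from assms(3,4) have "dim_row (path M u v) = vdim M v \<and> dim_col (path M u v) = vdim M u"
  proof (induction v rule: dec_induct)
    case base
    then show ?case by simp
  next
    case (step v)
    then show ?case using is_repD[OF assms(1), of v] assms(2) by (simp add: path_Suc)
  qed
  then show "dim_row (path M u v) = vdim M v" "dim_col (path M u v) = vdim M u" by auto
qed

lemma path_trans:
  assumes "is_rep n M" "0 < u" "u \<le> v" "v \<le> w" "w \<le> n"
  shows "path M v w * path M u v = path M u w"
  using assms(4,5)
proof (induction w rule: dec_induct)
  case base
  then show ?case using dim_path[OF assms(1-3)] by simp
next
  case (step w)
  have "path M v (Suc w) * path M u v = amap M w * (path M v w * path M u v)"
    using step assms is_repD[OF assms(1), of w] dim_path[OF assms(1), of u v] dim_path[OF assms(1), of v w]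
    by (simp add: path_Suc mat_assoc_dim)
  then show ?case using step assms by (simp add: path_Suc)
qed

lemma path_step_left:
  assumes "is_rep n M" "0 < u" "u < v" "v \<le> n"
  shows "path M (Suc u) v * amap M u = path M u v"
  using path_trans[OF assms(1,2), of "Suc u" v] assms is_repD[OF assms(1), of u] by (simp add: path_Suc)

lemma is_hom_path:
  assumes "is_rep n V" "is_rep n W" "is_hom n V W f" "0 < u" "u \<le> v" "v \<le> n"
  shows "f v * path V u v = path W u v * f u"
  using assms(5,6)
proof (induction v rule: dec_induct)
  case base
  then show ?case using is_homD[OF assms(3), of u] assms by simp
next
  case (step v)
  note [simp] = is_homD(1,2)[OF assms(3), of v] is_homD(1,2)[OF assms(3), of "Suc v"] is_homD(1,2)[OF assms(3), of u]
    is_repD[OF assms(1), of v] is_repD[OF assms(2), of v] dim_path[OF assms(1,4), of v] dim_path[OF assms(2,4), of v]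
  have "f (Suc v) * path V u (Suc v) = f (Suc v) * amap V v * path V u v"
    using step assms by (simp add: path_Suc mat_assoc_dim)
  also have "\<dots> = amap W v * (f v * path V u v)"
    using step assms is_homD(3)[OF assms(3), of v] by (simp add: mat_assoc_dim)
  also have "\<dots> = path W u (Suc v) * f u"
    using step assms by (simp add: path_Suc mat_assoc_dim)
  finally show ?case .
qed

lemma vdim_interval [simp]:
  "vdim (interval_module i j) v = (if i < v \<and> v \<le> j then 1 else 0)"
  by (simp add: interval_module_def Let_def)

lemma dim_amap_interval [simp]:
  "dim_row (amap (interval_module i j) v) = (if i < Suc v \<and> Suc v \<le> j then 1 else 0)"
  "dim_col (amap (interval_module i j) v) = (if i < v \<and> v \<le> j then 1 else 0)"
  by (simp_all add: interval_module_def Let_def)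

lemma amap_interval: "i < v \<Longrightarrow> v < j \<Longrightarrow> amap (interval_module i j) v = 1\<^sub>m 1"
  by (auto simp: interval_module_def Let_def)

lemma is_rep_interval [simp]: "is_rep n (interval_module i j)"
  by (rule is_repI) simp_all

lemma path_interval:
  assumes "i < u" "u \<le> v" "v \<le> j"
  shows "path (interval_module i j) u v = 1\<^sub>m 1"
  using assms(2,3)
proof (induction v rule: dec_induct)
  case base
  then show ?case using assms by simp
next
  case (step v)
  then show ?case using assms(1) by (simp add: path_Suc amap_interval)
qed

text \<open>The case i = 0 treats the space at vertex 0 as zero, since \<open>vdim W 0\<close> is meaningless.\<close>

definition iso_at :: "'k::field quiver_rep \<Rightarrow> nat \<Rightarrow> nat \<Rightarrow> bool" where
  "iso_at W i j \<longleftrightarrow> (if i = 0 then vdim W j = 0 else \<exists>N\<in>carrier_mat (vdim W i) (vdim W j).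
     N * path W i j = 1\<^sub>m (vdim W i) \<and> path W i j * N = 1\<^sub>m (vdim W j))"

lemma ext0_interval:
  fixes W :: "'k::field quiver_rep"
  assumes W: "is_rep n W" and ij: "i < j" "j \<le> n"
    and inj: "0 < i \<Longrightarrow> \<exists>L\<in>carrier_mat (vdim W i) (vdim W j). L * path W i j = 1\<^sub>m (vdim W i)"
  shows "ext0 n W (interval_module i j)"
proof (rule ext0I)
  fix \<theta> :: "nat \<Rightarrow> 'k mat"
  assume \<theta>: "\<And>v. 0 < v \<Longrightarrow> v < n \<Longrightarrow> dim_row (\<theta> v) = vdim (interval_module i j :: 'k quiver_rep) (Suc v)"
    "\<And>v. 0 < v \<Longrightarrow> v < n \<Longrightarrow> dim_col (\<theta> v) = vdim W v"
  have d\<theta>: "dim_row (\<theta> v) = 1" "dim_col (\<theta> v) = vdim W v" if "0 < v" "i \<le> v" "v < j" for v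
    using that \<theta>[of v] ij by auto
  define G where "G = rec_nat (0\<^sub>m 1 (vdim W j)) (\<lambda>k X. X * amap W (j - Suc k) - \<theta> (j - Suc k))"
  define \<phi> where "\<phi> v = G (j - v)" for v
  have \<phi>_rec: "\<phi> v = \<phi> (Suc v) * amap W v - \<theta> v" if "v < j" for v
  proof -
    have "j - v = Suc (j - Suc v)" "j - Suc (j - Suc v) = v" using that by auto
    then show ?thesis by (simp add: \<phi>_def G_def)
  qed
  have \<phi>_dim: "dim_row (\<phi> v) = 1 \<and> dim_col (\<phi> v) = vdim W v" if "0 < v" "i \<le> v" "v \<le> j" for v
  proof (cases "v = j")
    case True
    then show ?thesis by (simp add: \<phi>_def G_def)
  next
    case False
    then show ?thesis using \<phi>_rec[of v] d\<theta>[of v] that by simp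
  qed
  have "\<exists>c. dim_row c = 1 \<and> dim_col c = vdim W j \<and>
    (0 < i \<longrightarrow> \<phi> i + c * path W i j = 0\<^sub>m 1 (vdim W i))"
  proof (cases "i = 0")
    case True
    then show ?thesis by (intro exI[of _ "0\<^sub>m 1 (vdim W j)"]) simp
  next
    case False
    then have i: "0 < i" "i \<le> j" using ij by auto
    obtain L where L: "L \<in> carrier_mat (vdim W i) (vdim W j)" "L * path W i j = 1\<^sub>m (vdim W i)"
      using inj[OF i(1)] by (elim bexE)
    have d\<phi>i: "dim_row (\<phi> i) = 1" "dim_col (\<phi> i) = vdim W i" using \<phi>_dim[of i] i by auto
    note dims = carrier_matD[OF L(1)] dim_path[OF W i ij(2)] d\<phi>i
    have "\<phi> i * L * path W i j = \<phi> i" using L(2) dims by (simp add: mat_assoc_dim)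
    then have "- (\<phi> i * L) * path W i j = - \<phi> i"
      using uminus_mult_left_mat[of "\<phi> i * L" "path W i j"] dims by simp
    then have "\<phi> i + - (\<phi> i * L) * path W i j = 0\<^sub>m 1 (vdim W i)"
      using d\<phi>i by (intro eq_matI) auto
    then show ?thesis using dims by (intro exI[of _ "- (\<phi> i * L)"]) simp
  qed
  then obtain c where c: "dim_row c = 1" "dim_col c = vdim W j"
    and ci: "0 < i \<Longrightarrow> \<phi> i + c * path W i j = 0\<^sub>m 1 (vdim W i)" by blast
  define \<psi> where "\<psi> v = \<phi> v + c * path W v j" for v
  have \<psi>i: "0 < i \<Longrightarrow> \<psi> i = 0\<^sub>m 1 (vdim W i)" using ci by (simp add: \<psi>_def)
  have \<psi>_dim: "dim_row (\<psi> v) = 1" "dim_col (\<psi> v) = vdim W v" if "0 < v" "i \<le> v" "v \<le> j" for v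
    using \<phi>_dim[OF that] dim_path[OF W that(1,3) ij(2)] c by (simp_all add: \<psi>_def)
  have \<psi>_rec: "\<psi> (Suc v) * amap W v = \<psi> v + \<theta> v" if v: "0 < v" "i \<le> v" "v < j" for v
  proof -
    have v': "v \<le> j" "0 < Suc v" "i \<le> Suc v" "Suc v \<le> j" "v < n" using v ij by auto
    have pd: "dim_row (\<phi> v) = 1" "dim_col (\<phi> v) = vdim W v" "dim_row (\<phi> (Suc v)) = 1"
      "dim_col (\<phi> (Suc v)) = vdim W (Suc v)"
      using \<phi>_dim[OF v(1,2) v'(1)] \<phi>_dim[OF v'(2,3,4)] by auto
    note [simp] = pd d\<theta>[OF v] is_repD[OF W v(1) v'(5)] c
      dim_path[OF W v(1) v'(1) ij(2)] dim_path[OF W v'(2,4) ij(2)]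
    have "\<psi> (Suc v) * amap W v = \<phi> (Suc v) * amap W v + c * path W v j"
      using path_step_left[OF W v(1,3) ij(2)] by (simp add: \<psi>_def mat_dim_simps)
    also have "\<phi> (Suc v) * amap W v = \<phi> v + \<theta> v"
      unfolding \<phi>_rec[OF v(3)] by (intro eq_matI) auto
    finally show ?thesis by (auto simp: \<psi>_def intro!: eq_matI)
  qed
  define f where "f v = (if i < v \<and> v \<le> j then \<psi> v else 0\<^sub>m 0 (vdim W v))" for v
  have f_dim: "dim_row (f v) = vdim (interval_module i j :: 'k quiver_rep) v \<and> dim_col (f v) = vdim W v" if "0 < v" for v
    using \<psi>_dim[of v] that by (simp add: f_def)
  moreover have "f (Suc v) * amap W v = amap (interval_module i j) v * f v + \<theta> v" if v: "0 < v" "v < n" for v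
  proof -
    consider "i < v" "v < j" | "v = i" | "v < i \<or> j \<le> v" by linarith
    then show ?thesis
    proof cases
      case 1
      then show ?thesis using v \<psi>_rec[of v] \<psi>_dim[of v] by (simp add: f_def amap_interval)
    next
      case 2
      have "amap (interval_module i j) v * f v = 0\<^sub>m 1 (vdim W v)"
        using f_dim[OF v(1)] 2 ij by (intro eq_matI) (auto simp: scalar_prod_def)
      then show ?thesis using 2 v \<psi>_rec[of v] \<psi>i ij d\<theta>[of v] by (simp add: f_def)
    next
      case 3
      then have "vdim (interval_module i j :: 'k quiver_rep) (Suc v) = 0" by auto
      then show ?thesis using \<theta>[OF v] f_dim[OF v(1)] f_dim[of "Suc v"] is_repD[OF W v]
        by (intro mat_zero_dims) auto
    qed
  qed
  ultimately show "\<exists>f. solves n W (interval_module i j) \<theta> f"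
    unfolding solves_def by blast
qed

lemma hom0_interval:
  fixes W :: "'k::field quiver_rep"
  assumes W: "is_rep n W" and ij: "i < j" "j \<le> n" and iso: "iso_at W i j"
  shows "hom0 n W (interval_module i j)"
  unfolding hom0_def
proof (intro allI impI)
  fix f v assume f: "is_hom n W (interval_module i j) f" and v: "0 < v" "v \<le> n"
  have j: "0 < j" using ij by simp
  note [simp] = is_homD(1,2)[OF f j ij(2)]
  have fj: "f j = 0\<^sub>m 1 (vdim W j)"
  proof (cases "i = 0")
    case True
    then have "vdim W j = 0" using iso by (simp add: iso_at_def)
    then show ?thesis using ij by (intro mat_zero_dims) auto
  next
    case False
    then have i: "0 < i" "i \<le> j" "i \<le> n" using ij by auto
    obtain N where N: "N \<in> carrier_mat (vdim W i) (vdim W j)" "path W i j * N = 1\<^sub>m (vdim W j)"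
      using iso False unfolding iso_at_def by auto
    note [simp] = carrier_matD[OF N(1)] dim_path[OF W i(1,2) ij(2)] is_homD(1,2)[OF f i(1,3)]
      dim_path[OF is_rep_interval[of n i j] i(1,2) ij(2), where ?'a = 'k]
    have "f j * path W i j = path (interval_module i j) i j * f i"
      by (rule is_hom_path[OF W is_rep_interval f i(1,2) ij(2)])
    also have "\<dots> = 0\<^sub>m 1 (vdim W i)"
      using ij by (intro eq_matI) (auto simp: scalar_prod_def)
    finally have "f j * path W i j * N = 0\<^sub>m 1 (vdim W j)" by simp
    then show ?thesis using N(2) by (simp add: mat_assoc_dim)
  qed
  show "f v = 0\<^sub>m (vdim (interval_module i j :: 'k quiver_rep) v) (vdim W v)"
  proof (cases "i < v \<and> v \<le> j")
    case True
    have "f j * path W v j = path (interval_module i j) v j * f v"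
      using True by (intro is_hom_path[OF W is_rep_interval f v(1) _ ij(2)]) auto
    then have "f v = f j * path W v j"
      using True is_homD(1,2)[OF f v] by (simp add: path_interval)
    also have "\<dots> = 0\<^sub>m 1 (vdim W v)"
      using dim_path[OF W v(1) conjunct2[OF True] ij(2)] by (simp add: fj)
    finally show ?thesis using True by simp
  next
    case False
    then show ?thesis using is_homD(1,2)[OF f v] by (intro mat_zero_dims) auto
  qed
qed

lemma hom0_interval_row:
  fixes W :: "'k::field quiver_rep"
  assumes W: "is_rep n W" and ij: "i < j" "j \<le> n" and H: "hom0 n W (interval_module i j)"
    and r: "dim_row r = 1" "dim_col r = vdim W j" and z: "0 < i \<Longrightarrow> r * path W i j = 0\<^sub>m 1 (vdim W i)"
  shows "r = 0\<^sub>m 1 (vdim W j)"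
proof -
  define f where "f v = (if i < v \<and> v \<le> j then r * path W v j else 0\<^sub>m 0 (vdim W v))" for v
  have f_dim: "dim_row (f v) = vdim (interval_module i j :: 'k quiver_rep) v" "dim_col (f v) = vdim W v"
    if "0 < v" for v
    using that r dim_path(2)[OF W that, of j] ij by (simp_all add: f_def)
  have "is_hom n W (interval_module i j) f"
  proof (rule is_homI)
    fix v assume v: "0 < v" "v < n"
    consider "i < v" "v < j" | "v = i" | "v < i \<or> j \<le> v" by linarith
    then show "f (Suc v) * amap W v = amap (interval_module i j) v * f v"
    proof cases
      case 1
      then show ?thesis using v r dim_path[OF W v(1), of j] dim_path[OF W, of "Suc v" j] is_repD[OF W v]
          path_step_left[OF W v(1) 1(2) ij(2)] ij
        by (simp add: f_def amap_interval mat_assoc_dim)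
    next
      case 2
      have "amap (interval_module i j) v * f v = 0\<^sub>m 1 (vdim W v)"
        using f_dim[OF v(1)] 2 ij by (intro eq_matI) (auto simp: scalar_prod_def)
      then show ?thesis using 2 v r dim_path[OF W, of "Suc v" j] is_repD[OF W v]
          path_step_left[OF W v(1) _ ij(2)] ij z
        by (simp add: f_def mat_assoc_dim)
    next
      case 3
      then have "vdim (interval_module i j :: 'k quiver_rep) (Suc v) = 0" by auto
      then show ?thesis using f_dim[OF v(1)] f_dim[of "Suc v"] is_repD[OF W v]
        by (intro mat_zero_dims) auto
    qed
  qed (use f_dim in auto)
  then have "f j = 0\<^sub>m (vdim (interval_module i j :: 'k quiver_rep) j) (vdim W j)"
    using H ij unfolding hom0_def by (metis less_nat_zero_code gr0I)
  then show ?thesis using ij r by (simp add: f_def)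
qed

lemma ext0_interval_row:
  fixes W :: "'k::field quiver_rep"
  assumes W: "is_rep n W" and ij: "0 < i" "i < j" "j \<le> n" and E: "ext0 n W (interval_module i j)"
    and r: "dim_row r = 1" "dim_col r = vdim W i"
  obtains l where "dim_row l = 1" "dim_col l = vdim W j" "l * path W i j = r"
proof -
  define \<theta> where "\<theta> v = (if v = i then r else 0\<^sub>m (vdim (interval_module i j :: 'k quiver_rep) (Suc v)) (vdim W v))" for v
  obtain f where f0: "solves n W (interval_module i j) (\<theta>) f"
    by (rule ext0E[OF E, of \<theta>]) (use ij r in \<open>auto simp: \<theta>_def\<close>)
  note f = solvesD[OF f0]
  have step: "f (Suc v) * amap W v = f v" if v: "i < v" "v < j" for v
    using f(3)[of v] f(1,2)[of v] that ij by (simp add: \<theta>_def amap_interval)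
  have "f v * path W (Suc i) v = f (Suc i)" if "Suc i \<le> v" "v \<le> j" for v
    using that
  proof (induction v rule: dec_induct)
    case base
    then show ?case using f(2)[of "Suc i"] ij by simp
  next
    case (step v)
    have "f (Suc v) * path W (Suc i) (Suc v) = f (Suc v) * amap W v * path W (Suc i) v"
      using step ij is_repD[OF W, of v] f(2)[of "Suc v"] dim_path[OF W, of "Suc i" v]
      by (simp add: path_Suc mat_assoc_dim)
    then show ?case using step ij \<open>\<And>v. i < v \<Longrightarrow> v < j \<Longrightarrow> f (Suc v) * amap W v = f v\<close>[of v] by simp
  qed
  from this[of j] have fj: "f j * path W (Suc i) j = f (Suc i)" using ij by simp
  have "amap (interval_module i j) i * f i = 0\<^sub>m 1 (vdim W i)"
    using f(1,2)[of i] ij by (intro eq_matI) (auto simp: scalar_prod_def)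
  then have "f (Suc i) * amap W i = r" using f(3)[of i] ij r by (simp add: \<theta>_def)
  then have "f j * path W i j = r"
    unfolding fj[symmetric] path_step_left[OF W ij, symmetric]
    using f(2)[of j] dim_path[OF W, of "Suc i" j] is_repD[OF W, of i] ij by (simp add: mat_assoc_dim)
  then show ?thesis using that[of "f j"] f(1,2)[of j] ij by simp
qed

lemma row_mult_index:
  fixes A B :: "'k::field mat"
  assumes "dim_col A = dim_row B" "r < dim_row A" "c < dim_col B"
  shows "(mat 1 (dim_col A) (\<lambda>(_, c). A $$ (r, c)) * B) $$ (0, c) = (A * B) $$ (r, c)"
  using assms by (simp add: scalar_prod_def)

theorem perp_interval_iff:
  fixes W :: "'k::field quiver_rep"
  assumes W: "is_rep n W" and ij: "i < j" "j \<le> n"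
  shows "hom0 n W (interval_module i j) \<and> ext0 n W (interval_module i j) \<longleftrightarrow> iso_at W i j"
proof
  assume iso: "iso_at W i j"
  then have "0 < i \<Longrightarrow> \<exists>L\<in>carrier_mat (vdim W i) (vdim W j). L * path W i j = 1\<^sub>m (vdim W i)"
    unfolding iso_at_def by auto
  then show "hom0 n W (interval_module i j) \<and> ext0 n W (interval_module i j)"
    using hom0_interval[OF W ij iso] ext0_interval[OF W ij] by blast
next
  assume HE: "hom0 n W (interval_module i j) \<and> ext0 n W (interval_module i j)"
  note row0 = hom0_interval_row[OF W ij conjunct1[OF HE]]
  show "iso_at W i j"
  proof (cases "i = 0")
    case True
    have "mat 1 (vdim W j) (\<lambda>_. 1) = (0\<^sub>m 1 (vdim W j) :: 'k mat)" using True by (intro row0) auto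
    then have "vdim W j = 0"
      by (metis (no_types, lifting) gr0I index_mat(1) index_zero_mat(1) less_one zero_neq_one)
    then show ?thesis using True by (simp add: iso_at_def)
  next
    case False
    then have i: "0 < i" "i \<le> j" using ij by auto
    define P where "P = path W i j"
    have P [simp]: "dim_row P = vdim W j" "dim_col P = vdim W i"
      using dim_path[OF W i ij(2)] by (auto simp: P_def)
    define e :: "nat \<Rightarrow> 'k mat" where "e r = mat 1 (vdim W i) (\<lambda>(_, c). 1\<^sub>m (vdim W i) $$ (r, c))" for r
    have "\<exists>l. dim_row l = 1 \<and> dim_col l = vdim W j \<and> l * P = e r" for r
    proof -
      have "dim_row (e r) = 1" "dim_col (e r) = vdim W i" by (simp_all add: e_def)
      then show ?thesis
        using ext0_interval_row[OF W i(1) ij conjunct2[OF HE], of "e r"] unfolding P_def by metis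
    qed
    then obtain l where l: "\<And>r. dim_row (l r) = 1" "\<And>r. dim_col (l r) = vdim W j" "\<And>r. l r * P = e r"
      by metis
    define N where "N = mat (vdim W i) (vdim W j) (\<lambda>(r, c). l r $$ (0, c))"
    have N [simp]: "dim_row N = vdim W i" "dim_col N = vdim W j" by (simp_all add: N_def)
    have NP: "N * P = 1\<^sub>m (vdim W i)"
    proof (rule eq_matI)
      fix r c assume rc: "r < dim_row (1\<^sub>m (vdim W i) :: 'k mat)" "c < dim_col (1\<^sub>m (vdim W i) :: 'k mat)"
      have "(N * P) $$ (r, c) = (l r * P) $$ (0, c)"
        using rc l(1,2)[of r] by (simp add: N_def scalar_prod_def)
      also have "\<dots> = 1\<^sub>m (vdim W i) $$ (r, c)" unfolding l(3) using rc by (simp add: e_def)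
      finally show "(N * P) $$ (r, c) = 1\<^sub>m (vdim W i) $$ (r, c)" .
    qed simp_all
    define D where "D = P * N - 1\<^sub>m (vdim W j)"
    have D [simp]: "dim_row D = vdim W j" "dim_col D = vdim W j" by (simp_all add: D_def)
    have DP: "D * P = 0\<^sub>m (vdim W j) (vdim W i)"
      by (simp add: D_def mat_minus_mult_dim mat_assoc_dim NP)
    have "D = 0\<^sub>m (vdim W j) (vdim W j)"
    proof (rule eq_matI)
      fix r c assume rc: "r < dim_row (0\<^sub>m (vdim W j) (vdim W j) :: 'k mat)"
        "c < dim_col (0\<^sub>m (vdim W j) (vdim W j) :: 'k mat)"
      define d where "d = mat 1 (dim_col D) (\<lambda>(_, c). D $$ (r, c))"
      have "d = 0\<^sub>m 1 (vdim W j)"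
      proof (rule row0)
        show "d * path W i j = 0\<^sub>m 1 (vdim W i)"
        proof (rule eq_matI)
          fix a b assume ab: "a < dim_row (0\<^sub>m 1 (vdim W i) :: 'k mat)" "b < dim_col (0\<^sub>m 1 (vdim W i) :: 'k mat)"
          then have "(d * P) $$ (a, b) = (D * P) $$ (r, b)"
            using row_mult_index[of D P r b] rc by (simp add: d_def)
          then show "(d * path W i j) $$ (a, b) = 0\<^sub>m 1 (vdim W i) $$ (a, b)"
            using DP ab rc by (simp add: P_def)
        qed (use P in \<open>auto simp: d_def P_def\<close>)
      qed (simp_all add: d_def)
      then have "d $$ (0, c) = 0" using rc by simp
      then show "D $$ (r, c) = 0\<^sub>m (vdim W j) (vdim W j) $$ (r, c)" using rc by (simp add: d_def)
    qed simp_all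
    moreover have "P * N = D + 1\<^sub>m (vdim W j)" unfolding D_def by (intro eq_matI) auto
    ultimately have "P * N = 1\<^sub>m (vdim W j)" by simp
    moreover have "N \<in> carrier_mat (vdim W i) (vdim W j)" by (simp add: N_def)
    ultimately show ?thesis using NP False unfolding iso_at_def P_def by auto
  qed
qed

lemma one_mat_eq_zero: "(1\<^sub>m k :: 'k::field mat) = 0\<^sub>m k k \<Longrightarrow> k = 0"
  by (metis gr0I index_one_mat(1) index_zero_mat(1) zero_neq_one)

lemma iso_at_interval:
  assumes "a < b" "c < d"
  shows "iso_at (interval_module a b :: 'k::field quiver_rep) c d \<longleftrightarrow> (a \<in> {c..<d} \<longleftrightarrow> b \<in> {c..<d})"
proof (cases "c = 0")
  case True
  then show ?thesis using assms by (auto simp: iso_at_def)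
next
  case False
  let ?M = "interval_module a b :: 'k quiver_rep"
  have dims: "dim_row (path ?M c d) = vdim ?M d" "dim_col (path ?M c d) = vdim ?M c"
    using dim_path[OF is_rep_interval[of d a b], of c d] False assms by auto
  have "iso_at ?M c d \<longleftrightarrow> vdim ?M c = vdim ?M d"
  proof
    assume "iso_at ?M c d"
    then obtain N where N: "N \<in> carrier_mat (vdim ?M c) (vdim ?M d)"
      "N * path ?M c d = 1\<^sub>m (vdim ?M c)" "path ?M c d * N = 1\<^sub>m (vdim ?M d)"
      using False unfolding iso_at_def by auto
    have 1: "vdim ?M c = 0" if "vdim ?M d = 0"
    proof (rule one_mat_eq_zero[where ?'k = 'k])
      show "(1\<^sub>m (vdim ?M c) :: 'k mat) = 0\<^sub>m (vdim ?M c) (vdim ?M c)"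
        unfolding N(2)[symmetric] using that N(1) dims by (intro eq_matI) (auto simp: scalar_prod_def)
    qed
    have 2: "vdim ?M d = 0" if "vdim ?M c = 0"
    proof (rule one_mat_eq_zero[where ?'k = 'k])
      show "(1\<^sub>m (vdim ?M d) :: 'k mat) = 0\<^sub>m (vdim ?M d) (vdim ?M d)"
        unfolding N(3)[symmetric] using that N(1) dims by (intro eq_matI) (auto simp: scalar_prod_def)
    qed
    show "vdim ?M c = vdim ?M d" using 1 2 by (metis vdim_interval)
  next
    assume eq: "vdim ?M c = vdim ?M d"
    show "iso_at ?M c d"
    proof (cases "vdim ?M c = 0")
      case True
      then have "0\<^sub>m 0 0 * path ?M c d = 1\<^sub>m 0" "path ?M c d * 0\<^sub>m 0 0 = 1\<^sub>m 0"
        using eq dims by (auto intro!: mat_zero_dims)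
      then show ?thesis using \<open>c \<noteq> 0\<close> eq True unfolding iso_at_def
        by (metis (no_types, lifting) zero_carrier_mat)
    next
      case False
      then have "a < c" "d \<le> b" using eq by (auto split: if_splits)
      then have "path ?M c d = 1\<^sub>m 1" using assms by (intro path_interval) auto
      then show ?thesis using \<open>c \<noteq> 0\<close> \<open>a < c\<close> \<open>d \<le> b\<close> assms
        unfolding iso_at_def by (auto intro!: bexI[of _ "1\<^sub>m 1"])
    qed
  qed
  then show ?thesis using assms by auto
qed

section \<open>Kernels, cokernels and interval summands\<close>

lemma mat_section_zero:
  fixes A B :: "'k::field mat"
  assumes "A * B = 1\<^sub>m k" "dim_col A = 0" "dim_row B = 0"
  shows "k = 0"
proof (rule one_mat_eq_zero[where ?'k = 'k])
  have "dim_row A = k" "dim_col B = k" using arg_cong[OF assms(1), of dim_row] arg_cong[OF assms(1), of dim_col] by auto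
  then show "(1\<^sub>m k :: 'k mat) = 0\<^sub>m k k"
    unfolding assms(1)[symmetric] using assms(2,3) by (intro eq_matI) (auto simp: scalar_prod_def)
qed

definition kernel_of :: "nat \<Rightarrow> 'k::field quiver_rep \<Rightarrow> 'k quiver_rep \<Rightarrow> (nat \<Rightarrow> 'k mat) \<Rightarrow>
    'k quiver_rep \<Rightarrow> (nat \<Rightarrow> 'k mat) \<Rightarrow> (nat \<Rightarrow> 'k mat) \<Rightarrow> (nat \<Rightarrow> 'k mat) \<Rightarrow> bool" where
  "kernel_of n X Y f K k p b \<longleftrightarrow> is_rep n K \<and> is_hom n K X k \<and> (\<forall>v. 0 < v \<longrightarrow> v \<le> n \<longrightarrow>
     dim_row (p v) = vdim K v \<and> dim_col (p v) = vdim X v \<and> dim_row (b v) = vdim X v \<and> dim_col (b v) = vdim Y v \<and>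
     p v * k v = 1\<^sub>m (vdim K v) \<and> f v * k v = 0\<^sub>m (vdim Y v) (vdim K v) \<and>
     k v * p v + b v * f v = 1\<^sub>m (vdim X v))"

definition cokernel_of :: "nat \<Rightarrow> 'k::field quiver_rep \<Rightarrow> 'k quiver_rep \<Rightarrow> (nat \<Rightarrow> 'k mat) \<Rightarrow>
    'k quiver_rep \<Rightarrow> (nat \<Rightarrow> 'k mat) \<Rightarrow> (nat \<Rightarrow> 'k mat) \<Rightarrow> (nat \<Rightarrow> 'k mat) \<Rightarrow> bool" where
  "cokernel_of n X Y f Q q s b \<longleftrightarrow> is_rep n Q \<and> is_hom n Y Q q \<and> (\<forall>v. 0 < v \<longrightarrow> v \<le> n \<longrightarrow>
     dim_row (s v) = vdim Y v \<and> dim_col (s v) = vdim Q v \<and> dim_row (b v) = vdim X v \<and> dim_col (b v) = vdim Y v \<and>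
     q v * s v = 1\<^sub>m (vdim Q v) \<and> q v * f v = 0\<^sub>m (vdim Q v) (vdim X v) \<and>
     s v * q v + f v * b v = 1\<^sub>m (vdim Y v))"

lemma kernel_ofD:
  assumes "kernel_of n X Y f K k p b"
  shows "is_rep n K" "is_hom n K X k"
    and "0 < v \<Longrightarrow> v \<le> n \<Longrightarrow> dim_row (p v) = vdim K v" "0 < v \<Longrightarrow> v \<le> n \<Longrightarrow> dim_col (p v) = vdim X v"
    and "0 < v \<Longrightarrow> v \<le> n \<Longrightarrow> dim_row (b v) = vdim X v" "0 < v \<Longrightarrow> v \<le> n \<Longrightarrow> dim_col (b v) = vdim Y v"
    and "0 < v \<Longrightarrow> v \<le> n \<Longrightarrow> p v * k v = 1\<^sub>m (vdim K v)"
    and "0 < v \<Longrightarrow> v \<le> n \<Longrightarrow> f v * k v = 0\<^sub>m (vdim Y v) (vdim K v)"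
    and "0 < v \<Longrightarrow> v \<le> n \<Longrightarrow> k v * p v + b v * f v = 1\<^sub>m (vdim X v)"
  using assms unfolding kernel_of_def by blast+

lemma cokernel_ofD:
  assumes "cokernel_of n X Y f Q q s b"
  shows "is_rep n Q" "is_hom n Y Q q"
    and "0 < v \<Longrightarrow> v \<le> n \<Longrightarrow> dim_row (s v) = vdim Y v" "0 < v \<Longrightarrow> v \<le> n \<Longrightarrow> dim_col (s v) = vdim Q v"
    and "0 < v \<Longrightarrow> v \<le> n \<Longrightarrow> dim_row (b v) = vdim X v" "0 < v \<Longrightarrow> v \<le> n \<Longrightarrow> dim_col (b v) = vdim Y v"
    and "0 < v \<Longrightarrow> v \<le> n \<Longrightarrow> q v * s v = 1\<^sub>m (vdim Q v)"
    and "0 < v \<Longrightarrow> v \<le> n \<Longrightarrow> q v * f v = 0\<^sub>m (vdim Q v) (vdim X v)"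
    and "0 < v \<Longrightarrow> v \<le> n \<Longrightarrow> s v * q v + f v * b v = 1\<^sub>m (vdim Y v)"
  using assms unfolding cokernel_of_def by blast+

lemma kernel_rep:
  fixes X Y :: "'k::field quiver_rep"
  assumes X: "is_rep n X" and Y: "is_rep n Y" and f: "is_hom n X Y f"
  obtains K k p b where "kernel_of n X Y f K k p b"
proof -
  define Q where "Q v d k p b \<longleftrightarrow> k \<in> carrier_mat (vdim X v) d \<and> p \<in> carrier_mat d (vdim X v) \<and>
    b \<in> carrier_mat (vdim X v) (vdim Y v) \<and> p * k = 1\<^sub>m d \<and> f v * k = 0\<^sub>m (vdim Y v) d \<and>
    k * p + b * f v = 1\<^sub>m (vdim X v)" for v d k p b
  have "\<exists>d k p b. Q v d k p b" if v: "0 < v" "v \<le> n" for v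
  proof -
    have fv: "f v \<in> carrier_mat (vdim Y v) (vdim X v)" using is_homD(1,2)[OF f v] by auto
    show ?thesis by (rule kernel_split[OF fv]) (auto simp: Q_def)
  qed
  then obtain d k p b where "\<And>v. 0 < v \<Longrightarrow> v \<le> n \<Longrightarrow> Q v (d v) (k v) (p v) (b v)" by metis
  then have q: "\<And>v. 0 < v \<Longrightarrow> v \<le> n \<Longrightarrow> dim_row (k v) = vdim X v" "\<And>v. 0 < v \<Longrightarrow> v \<le> n \<Longrightarrow> dim_col (k v) = d v"
    "\<And>v. 0 < v \<Longrightarrow> v \<le> n \<Longrightarrow> dim_row (p v) = d v" "\<And>v. 0 < v \<Longrightarrow> v \<le> n \<Longrightarrow> dim_col (p v) = vdim X v"
    "\<And>v. 0 < v \<Longrightarrow> v \<le> n \<Longrightarrow> dim_row (b v) = vdim X v" "\<And>v. 0 < v \<Longrightarrow> v \<le> n \<Longrightarrow> dim_col (b v) = vdim Y v"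
    "\<And>v. 0 < v \<Longrightarrow> v \<le> n \<Longrightarrow> p v * k v = 1\<^sub>m (d v)"
    "\<And>v. 0 < v \<Longrightarrow> v \<le> n \<Longrightarrow> f v * k v = 0\<^sub>m (vdim Y v) (d v)"
    "\<And>v. 0 < v \<Longrightarrow> v \<le> n \<Longrightarrow> k v * p v + b v * f v = 1\<^sub>m (vdim X v)"
    unfolding Q_def by (blast dest: carrier_matD)+
  define K where "K = Rep d (\<lambda>v. p (Suc v) * (amap X v * k v))"
  have dK: "vdim K v = d v" for v by (simp add: K_def)
  have K: "is_rep n K"
    using q(2,3) by (intro is_repI) (auto simp: K_def)
  have "is_hom n K X k"
  proof (rule is_homI)
    fix v assume v: "0 < v" "v < n"
    then have v': "v \<le> n" "0 < Suc v" "Suc v \<le> n" by auto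
    note [simp] = q(1-6)[OF v(1) v'(1)] q(1-6)[OF v'(2,3)] is_repD[OF X v] is_repD[OF Y v]
      is_hom_dims[OF f v]
    have "k (Suc v) * amap K v + b (Suc v) * (amap Y v * (f v * k v)) =
        k (Suc v) * (p (Suc v) * (amap X v * k v)) + b (Suc v) * (amap Y v * f v * k v)"
      by (simp add: K_def mat_assoc_dim)
    also have "\<dots> = (k (Suc v) * p (Suc v) + b (Suc v) * f (Suc v)) * (amap X v * k v)"
      unfolding is_homD(3)[OF f v, symmetric] by (simp add: mat_dim_simps)
    also have "\<dots> = amap X v * k v" by (simp add: q(9)[OF v'(2,3)])
    finally show "k (Suc v) * amap K v = amap X v * k v"
      by (simp add: q(8)[OF v(1) v'(1)] K_def)
  qed (use q dK in auto)
  with K show ?thesis using q(3-9) by (intro that[of K k p b]) (simp add: kernel_of_def dK)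
qed

lemma cokernel_rep:
  fixes X Y :: "'k::field quiver_rep"
  assumes X: "is_rep n X" and Y: "is_rep n Y" and f: "is_hom n X Y f"
  obtains Q q s b where "cokernel_of n X Y f Q q s b"
proof -
  define P where "P v d s q b \<longleftrightarrow> s \<in> carrier_mat (vdim Y v) d \<and> q \<in> carrier_mat d (vdim Y v) \<and>
    b \<in> carrier_mat (vdim X v) (vdim Y v) \<and> q * s = 1\<^sub>m d \<and> q * f v = 0\<^sub>m d (vdim X v) \<and>
    s * q + f v * b = 1\<^sub>m (vdim Y v)" for v d s q b
  have "\<exists>d s q b. P v d s q b" if v: "0 < v" "v \<le> n" for v
  proof -
    have fv: "f v \<in> carrier_mat (vdim Y v) (vdim X v)" using is_homD(1,2)[OF f v] by auto
    show ?thesis by (rule cokernel_split[OF fv]) (auto simp: P_def)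
  qed
  then obtain d s q b where "\<And>v. 0 < v \<Longrightarrow> v \<le> n \<Longrightarrow> P v (d v) (s v) (q v) (b v)" by metis
  then have q: "\<And>v. 0 < v \<Longrightarrow> v \<le> n \<Longrightarrow> dim_row (q v) = d v" "\<And>v. 0 < v \<Longrightarrow> v \<le> n \<Longrightarrow> dim_col (q v) = vdim Y v"
    "\<And>v. 0 < v \<Longrightarrow> v \<le> n \<Longrightarrow> dim_row (s v) = vdim Y v" "\<And>v. 0 < v \<Longrightarrow> v \<le> n \<Longrightarrow> dim_col (s v) = d v"
    "\<And>v. 0 < v \<Longrightarrow> v \<le> n \<Longrightarrow> dim_row (b v) = vdim X v" "\<And>v. 0 < v \<Longrightarrow> v \<le> n \<Longrightarrow> dim_col (b v) = vdim Y v"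
    "\<And>v. 0 < v \<Longrightarrow> v \<le> n \<Longrightarrow> q v * s v = 1\<^sub>m (d v)"
    "\<And>v. 0 < v \<Longrightarrow> v \<le> n \<Longrightarrow> q v * f v = 0\<^sub>m (d v) (vdim X v)"
    "\<And>v. 0 < v \<Longrightarrow> v \<le> n \<Longrightarrow> s v * q v + f v * b v = 1\<^sub>m (vdim Y v)"
    unfolding P_def by (blast dest: carrier_matD)+
  define Q where "Q = Rep d (\<lambda>v. q (Suc v) * (amap Y v * s v))"
  have dQ: "vdim Q v = d v" for v by (simp add: Q_def)
  have Q: "is_rep n Q"
    using q(1,4) by (intro is_repI) (auto simp: Q_def)
  have "is_hom n Y Q q"
  proof (rule is_homI)
    fix v assume v: "0 < v" "v < n"
    then have v': "v \<le> n" "0 < Suc v" "Suc v \<le> n" by auto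
    note [simp] = q(1-6)[OF v(1) v'(1)] q(1-6)[OF v'(2,3)] is_repD[OF X v] is_repD[OF Y v]
      is_hom_dims[OF f v]
    have "amap Q v * q v + (q (Suc v) * f (Suc v)) * (amap X v * b v) =
        q (Suc v) * (amap Y v * s v) * q v + q (Suc v) * (f (Suc v) * amap X v * b v)"
      by (simp add: Q_def mat_assoc_dim)
    also have "\<dots> = q (Suc v) * (amap Y v * (s v * q v + f v * b v))"
      unfolding is_homD(3)[OF f v] by (simp add: mat_dim_simps)
    also have "\<dots> = q (Suc v) * amap Y v" by (simp add: q(9)[OF v(1) v'(1)])
    finally show "q (Suc v) * amap Y v = amap Q v * q v"
      by (simp add: q(8)[OF v'(2,3)] Q_def)
  qed (use q dQ in auto)
  with Q show ?thesis using q(3-9) by (intro that[of Q q s b]) (simp add: cokernel_of_def dQ)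
qed

lemma iso_at_kernel:
  fixes X Y K :: "'k::field quiver_rep"
  assumes X: "is_rep n X" and Y: "is_rep n Y" and f: "is_hom n X Y f" and ker: "kernel_of n X Y f K k p b"
    and ij: "i < j" "j \<le> n" and iX: "iso_at X i j" and iY: "iso_at Y i j"
  shows "iso_at K i j"
proof -
  note K = kernel_ofD(1)[OF ker] and k = kernel_ofD(2)[OF ker] and d = kernel_ofD(3-6)[OF ker]
    and pk = kernel_ofD(7)[OF ker] and fk = kernel_ofD(8)[OF ker] and kp = kernel_ofD(9)[OF ker]
  have j: "0 < j" using ij by simp
  note [simp] = is_homD(1,2)[OF f j ij(2)] is_homD(1,2)[OF k j ij(2)] d[OF j ij(2)]
  show ?thesis
  proof (cases "i = 0")
    case True
    then have "vdim X j = 0" using iX by (simp add: iso_at_def)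
    then have "vdim K j = 0" using mat_section_zero[OF pk[OF j ij(2)]] by simp
    then show ?thesis using True by (simp add: iso_at_def)
  next
    case False
    then have i: "0 < i" "i \<le> j" "i \<le> n" using ij by auto
    obtain N where N: "N \<in> carrier_mat (vdim X i) (vdim X j)" "N * path X i j = 1\<^sub>m (vdim X i)"
        "path X i j * N = 1\<^sub>m (vdim X j)"
      using iX False unfolding iso_at_def by auto
    obtain M where M: "M \<in> carrier_mat (vdim Y i) (vdim Y j)" "M * path Y i j = 1\<^sub>m (vdim Y i)"
      using iY False unfolding iso_at_def by auto
    note [simp] = carrier_matD[OF N(1)] carrier_matD[OF M(1)] is_homD(1,2)[OF f i(1,3)] is_homD(1,2)[OF k i(1,3)]
      d[OF i(1,3)] dim_path[OF X i(1,2) ij(2)] dim_path[OF Y i(1,2) ij(2)] dim_path[OF K i(1,2) ij(2)]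
    note fp = is_hom_path[OF X Y f i(1,2) ij(2)] and kpath = is_hom_path[OF K X k i(1,2) ij(2)]
    have "p i * (N * k j) * path K i j = p i * (N * (k j * path K i j))" by (simp add: mat_assoc_dim)
    also have "\<dots> = p i * ((N * path X i j) * k i)" unfolding kpath by (simp add: mat_assoc_dim)
    also have "\<dots> = 1\<^sub>m (vdim K i)" by (simp add: N pk[OF i(1,3)])
    finally have 1: "p i * (N * k j) * path K i j = 1\<^sub>m (vdim K i)" .
    have "f i * (N * k j) = (M * path Y i j) * (f i * (N * k j))" by (simp add: M)
    also have "\<dots> = M * ((path Y i j * f i) * (N * k j))" by (simp add: mat_assoc_dim)
    also have "\<dots> = M * (f j * ((path X i j * N) * k j))" unfolding fp[symmetric] by (simp add: mat_assoc_dim)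
    also have "\<dots> = 0\<^sub>m (vdim Y i) (vdim K j)" by (simp add: N fk[OF j ij(2)])
    finally have fN: "f i * (N * k j) = 0\<^sub>m (vdim Y i) (vdim K j)" .
    have "N * k j = (k i * p i + b i * f i) * (N * k j)" by (simp add: kp[OF i(1,3)])
    also have "\<dots> = k i * (p i * (N * k j)) + b i * (f i * (N * k j))" by (simp add: mat_dim_simps)
    finally have Nk: "k i * (p i * (N * k j)) = N * k j" by (simp add: fN)
    have "path K i j * (p i * (N * k j)) = (p j * k j) * (path K i j * (p i * (N * k j)))" by (simp add: pk[OF j ij(2)])
    also have "\<dots> = p j * ((k j * path K i j) * (p i * (N * k j)))" by (simp add: mat_assoc_dim)
    also have "\<dots> = p j * (path X i j * (k i * (p i * (N * k j))))" unfolding kpath by (simp add: mat_assoc_dim)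
    also have "\<dots> = p j * ((path X i j * N) * k j)" unfolding Nk by (simp add: mat_assoc_dim)
    also have "\<dots> = 1\<^sub>m (vdim K j)" by (simp add: N pk[OF j ij(2)])
    finally have 2: "path K i j * (p i * (N * k j)) = 1\<^sub>m (vdim K j)" .
    have "p i * (N * k j) \<in> carrier_mat (vdim K i) (vdim K j)" by (intro carrier_matI) simp_all
    then show ?thesis using 1 2 False unfolding iso_at_def by auto
  qed
qed

lemma iso_at_cokernel:
  fixes X Y Q :: "'k::field quiver_rep"
  assumes X: "is_rep n X" and Y: "is_rep n Y" and f: "is_hom n X Y f" and coker: "cokernel_of n X Y f Q q s b"
    and ij: "i < j" "j \<le> n" and iX: "iso_at X i j" and iY: "iso_at Y i j"
  shows "iso_at Q i j"
proof -
  note Q = cokernel_ofD(1)[OF coker] and q = cokernel_ofD(2)[OF coker] and d = cokernel_ofD(3-6)[OF coker]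
    and qs = cokernel_ofD(7)[OF coker] and qf = cokernel_ofD(8)[OF coker] and sq = cokernel_ofD(9)[OF coker]
  have j: "0 < j" using ij by simp
  note [simp] = is_homD(1,2)[OF f j ij(2)] is_homD(1,2)[OF q j ij(2)] d[OF j ij(2)]
  show ?thesis
  proof (cases "i = 0")
    case True
    then have "vdim Y j = 0" using iY by (simp add: iso_at_def)
    then have "vdim Q j = 0" using mat_section_zero[OF qs[OF j ij(2)]] by simp
    then show ?thesis using True by (simp add: iso_at_def)
  next
    case False
    then have i: "0 < i" "i \<le> j" "i \<le> n" using ij by auto
    obtain N where N: "N \<in> carrier_mat (vdim Y i) (vdim Y j)" "N * path Y i j = 1\<^sub>m (vdim Y i)"
        "path Y i j * N = 1\<^sub>m (vdim Y j)"
      using iY False unfolding iso_at_def by auto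
    obtain M where M: "M \<in> carrier_mat (vdim X i) (vdim X j)" "path X i j * M = 1\<^sub>m (vdim X j)"
      using iX False unfolding iso_at_def by auto
    note [simp] = carrier_matD[OF N(1)] carrier_matD[OF M(1)] is_homD(1,2)[OF f i(1,3)] is_homD(1,2)[OF q i(1,3)]
      d[OF i(1,3)] dim_path[OF X i(1,2) ij(2)] dim_path[OF Y i(1,2) ij(2)] dim_path[OF Q i(1,2) ij(2)]
    note fp = is_hom_path[OF X Y f i(1,2) ij(2)] and qp = is_hom_path[OF Y Q q i(1,2) ij(2)]
    have "path Q i j * (q i * (N * s j)) = (path Q i j * q i) * (N * s j)" by (simp add: mat_assoc_dim)
    also have "\<dots> = q j * ((path Y i j * N) * s j)" unfolding qp[symmetric] by (simp add: mat_assoc_dim)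
    also have "\<dots> = 1\<^sub>m (vdim Q j)" by (simp add: N qs[OF j ij(2)])
    finally have 1: "path Q i j * (q i * (N * s j)) = 1\<^sub>m (vdim Q j)" .
    have "q i * (N * f j) = q i * (N * (f j * (path X i j * M)))" by (simp add: M)
    also have "\<dots> = q i * (N * ((f j * path X i j) * M))" by (simp add: mat_assoc_dim)
    also have "\<dots> = q i * ((N * path Y i j) * (f i * M))" unfolding fp by (simp add: mat_assoc_dim)
    also have "\<dots> = (q i * f i) * M" by (simp add: N mat_assoc_dim)
    also have "\<dots> = 0\<^sub>m (vdim Q i) (vdim X j)" by (simp add: qf[OF i(1,3)])
    finally have Nf: "q i * (N * f j) = 0\<^sub>m (vdim Q i) (vdim X j)" .
    have "q i * N = q i * (N * (s j * q j + f j * b j))" by (simp add: sq[OF j ij(2)])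
    also have "\<dots> = q i * (N * s j) * q j + q i * (N * f j) * b j" by (simp add: mat_dim_simps)
    finally have qN: "q i * (N * s j) * q j = q i * N" by (simp add: Nf)
    have "q i * (N * s j) * path Q i j = q i * (N * s j) * (path Q i j * (q i * s i))" by (simp add: qs[OF i(1,3)])
    also have "\<dots> = q i * (N * s j) * ((path Q i j * q i) * s i)" by (simp add: mat_assoc_dim)
    also have "\<dots> = (q i * (N * s j) * q j) * (path Y i j * s i)" unfolding qp[symmetric] by (simp add: mat_assoc_dim)
    also have "\<dots> = q i * ((N * path Y i j) * s i)" unfolding qN by (simp add: mat_assoc_dim)
    also have "\<dots> = 1\<^sub>m (vdim Q i)" by (simp add: N qs[OF i(1,3)])
    finally have 2: "q i * (N * s j) * path Q i j = 1\<^sub>m (vdim Q i)" .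
    have "q i * (N * s j) \<in> carrier_mat (vdim Q i) (vdim Q j)" by (intro carrier_matI) simp_all
    then show ?thesis using 1 2 False unfolding iso_at_def by auto
  qed
qed

lemma iso_at_retract:
  fixes A B :: "'k::field quiver_rep"
  assumes A: "is_rep n A" and B: "is_rep n B" and ij: "i < j" "j \<le> n" and "retract n A B" and iso: "iso_at B i j"
  shows "iso_at A i j"
proof -
  obtain s r where s: "is_hom n A B s" and r: "is_hom n B A r"
    and rs: "\<And>v. 0 < v \<Longrightarrow> v \<le> n \<Longrightarrow> r v * s v = 1\<^sub>m (vdim A v)"
    using \<open>retract n A B\<close> unfolding retract_def by blast
  note sr = is_hom_comp[OF B A B r s]
  define f where "f v = 1\<^sub>m (vdim B v) - s v * r v" for v
  have f: "is_hom n B B f"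
  proof (rule is_homI)
    fix v assume v: "0 < v" "v < n"
    note [simp] = is_repD[OF B v] is_hom_dims[OF sr v, simplified]
    show "f (Suc v) * amap B v = amap B v * f v"
      using is_homD(3)[OF sr v] by (simp add: f_def mat_minus_mult_dim mat_mult_minus_dim)
  qed (use is_homD(1,2)[OF sr] in \<open>simp_all add: f_def\<close>)
  have "f v * s v = 0\<^sub>m (vdim B v) (vdim A v)" "s v * r v + 1\<^sub>m (vdim B v) * f v = 1\<^sub>m (vdim B v)"
    if v: "0 < v" "v \<le> n" for v
  proof -
    note [simp] = is_homD(1,2)[OF s v] is_homD(1,2)[OF r v]
    show "f v * s v = 0\<^sub>m (vdim B v) (vdim A v)"
      by (simp add: f_def mat_minus_mult_dim mat_assoc_dim rs[OF v])
    have "f v \<in> carrier_mat (vdim B v) (vdim B v)" by (rule carrier_matI) (simp_all add: f_def)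
    then have "1\<^sub>m (vdim B v) * f v = f v" by (rule left_mult_one_mat)
    then show "s v * r v + 1\<^sub>m (vdim B v) * f v = 1\<^sub>m (vdim B v)"
      by (intro eq_matI) (auto simp: f_def)
  qed
  then have "kernel_of n B B f A s r (\<lambda>v. 1\<^sub>m (vdim B v))"
    using A s rs is_homD(1,2)[OF r] by (simp add: kernel_of_def)
  from iso_at_kernel[OF B B f this ij iso iso] show ?thesis .
qed

text \<open>
  A vector is followed as far to the right as it survives and pulled back as far to the left as
  possible, so that neither of its ends obstructs splitting off the interval that it generates.
\<close>

lemma interval_retract:
  fixes Q :: "'k::field quiver_rep"
  assumes Q: "is_rep n Q" and i: "0 < i" "i \<le> n" and ij: "i < j" "j \<le> Suc n"
    and x: "dim_row x = vdim Q i" "dim_col x = 1" "x \<noteq> 0\<^sub>m (vdim Q i) 1"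
    and dies: "j \<le> n \<Longrightarrow> path Q i j * x = 0\<^sub>m (vdim Q j) 1"
  obtains a b where "a < i" "i \<le> b" "b < j" "b \<le> n" "retract n (interval_module a b) Q"
proof -
  define R where "R s y \<longleftrightarrow> 0 < s \<and> s \<le> i \<and> dim_row y = vdim Q s \<and> dim_col y = 1 \<and>
    path Q s i * y \<noteq> 0\<^sub>m (vdim Q i) 1 \<and> (j \<le> n \<longrightarrow> path Q s j * y = 0\<^sub>m (vdim Q j) 1)" for s y
  define s where "s = (LEAST s. \<exists>y. R s y)"
  have "R i x" using i x dies by (simp add: R_def)
  then have "\<exists>y. R s y" unfolding s_def by (rule LeastI2_wellorder[where Q = "\<lambda>s. \<exists>y. R s y", OF exI]) blast
  then obtain y where "R s y" by blast
  then have y: "0 < s" "s \<le> i" "dim_row y = vdim Q s" "dim_col y = 1" "path Q s i * y \<noteq> 0\<^sub>m (vdim Q i) 1"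
    "j \<le> n \<Longrightarrow> path Q s j * y = 0\<^sub>m (vdim Q j) 1" unfolding R_def by blast+
  define T where "T = {t. i \<le> t \<and> t < j \<and> t \<le> n \<and> path Q s t * y \<noteq> 0\<^sub>m (vdim Q t) 1}"
  define t where "t = Max T"
  have T: "finite T" "i \<in> T" using y(5) i ij by (auto simp: T_def)
  then have "t \<in> T" unfolding t_def using Max_in by blast
  then have t: "i \<le> t" "t < j" "t \<le> n" "path Q s t * y \<noteq> 0\<^sub>m (vdim Q t) 1" by (auto simp: T_def)
  have st: "s \<le> t" using y t by simp
  have next0: "path Q s (Suc t) * y = 0\<^sub>m (vdim Q (Suc t)) 1" if "Suc t \<le> n"
  proof (cases "Suc t = j")
    case True
    then show ?thesis using y(6) that by simp
  next
    case False
    have "Suc t \<notin> T" using Max_ge[OF T(1)] unfolding t_def by (metis Suc_n_not_le_n)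
    then show ?thesis using False t that by (simp add: T_def)
  qed
  define z where "z = path Q s t * y"
  note dst = dim_path[OF Q y(1) st t(3)]
  have z: "dim_row z = vdim Q t" "dim_col z = 1" "z \<noteq> 0\<^sub>m (vdim Q t) 1"
    using dst y(4) t(4) by (simp_all add: z_def)
  define A where "A = (if s = Suc 0 then 0\<^sub>m (vdim Q t) 0 else path Q (s - 1) t)"
  define m where "m = (if s = Suc 0 then 0 else vdim Q (s - 1))"
  have A: "A \<in> carrier_mat (vdim Q t) m"
    using dim_path[OF Q, of "s - 1" t] y st t by (auto simp: A_def m_def)
  have notim: "z \<noteq> A * w" if w: "dim_row w = m" "dim_col w = 1" for w
  proof
    assume zw: "z = A * w"
    show False
    proof (cases "s = Suc 0")
      case True
      then have "A * w = 0\<^sub>m (vdim Q t) 1" using w by (intro eq_matI) (auto simp: A_def m_def scalar_prod_def)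
      then show False using z zw by simp
    next
      case False
      define s' where "s' = s - 1"
      have s': "0 < s'" "s' \<le> i" "s' \<le> s" "s' < s" "s' \<le> t" using False y st by (auto simp: s'_def)
      have w': "dim_row w = vdim Q s'" using w False by (simp add: m_def s'_def)
      have zw': "path Q s' t * w = z" using zw False by (simp add: A_def s'_def)
      note ds = dim_path[OF Q s'(1)]
      have 1: "path Q s' i * w \<noteq> 0\<^sub>m (vdim Q i) 1"
      proof
        assume a: "path Q s' i * w = 0\<^sub>m (vdim Q i) 1"
        have "z = path Q i t * (path Q s' i * w)"
          unfolding zw'[symmetric] path_trans[OF Q s'(1,2) t(1,3), symmetric]
          using ds[OF s'(2) i(2)] dim_path[OF Q i(1) t(1,3)] w' by (simp add: mat_assoc_dim)
        then show False using z(3) dim_path[OF Q i(1) t(1,3)] unfolding a by simp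
      qed
      have 2: "path Q s' j * w = 0\<^sub>m (vdim Q j) 1" if j: "j \<le> n"
      proof -
        have t0: "0 < t" "t \<le> j" using t i by auto
        note dt = dim_path[OF Q t0 j]
        have "path Q s' j * w = path Q t j * (path Q s' t * w)"
          unfolding path_trans[OF Q s'(1,5) t0(2) j, symmetric]
          using ds[OF s'(5) t(3)] dt w' by (simp add: mat_assoc_dim)
        also have "\<dots> = path Q t j * path Q s t * y"
          unfolding zw' z_def using dst dt y(3) by (simp add: mat_assoc_dim)
        also have "\<dots> = path Q s j * y" unfolding path_trans[OF Q y(1) st t0(2) j] ..
        finally show ?thesis using y(6)[OF j] by simp
      qed
      have "R s' w" unfolding R_def using s' w' w 1 2 by simp
      then have "s \<le> s'" unfolding s_def by (intro Least_le) blast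
      then show False using s' by simp
    qed
  qed
  obtain k S P B where SP: "S \<in> carrier_mat (vdim Q t) k" "P \<in> carrier_mat k (vdim Q t)"
    "B \<in> carrier_mat m (vdim Q t)" "P * S = 1\<^sub>m k" "P * A = 0\<^sub>m k m" "S * P + A * B = 1\<^sub>m (vdim Q t)"
    by (rule cokernel_split[OF A])
  note dSP [simp] = carrier_matD[OF SP(1)] carrier_matD[OF SP(2)] carrier_matD[OF SP(3)] carrier_matD[OF A] z(1,2)
  have "P * z \<noteq> 0\<^sub>m k 1"
  proof
    assume Pz: "P * z = 0\<^sub>m k 1"
    have "z = (S * P + A * B) * z" by (simp add: SP(6))
    also have "\<dots> = S * (P * z) + A * (B * z)" by (simp add: mat_dim_simps)
    also have "\<dots> = A * (B * z)" by (simp add: Pz)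
    finally show False using notim[of "B * z"] by simp
  qed
  have "\<exists>r<k. (P * z) $$ (r, 0) \<noteq> 0"
  proof (rule ccontr)
    assume "\<not> (\<exists>r<k. (P * z) $$ (r, 0) \<noteq> 0)"
    then have "P * z = 0\<^sub>m k 1" by (intro eq_matI) auto
    with \<open>P * z \<noteq> 0\<^sub>m k 1\<close> show False ..
  qed
  then obtain r where r: "r < k" "(P * z) $$ (r, 0) \<noteq> 0" by blast
  define c where "c = mat 1 k (\<lambda>(_, l). if l = r then 1 / (P * z) $$ (r, 0) else 0)"
  have c [simp]: "dim_row c = 1" "dim_col c = k" by (simp_all add: c_def)
  define l where "l = c * P"
  have l [simp]: "dim_row l = 1" "dim_col l = vdim Q t" by (simp_all add: l_def)
  have lz: "l * z = 1\<^sub>m 1"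
  proof -
    have "dim_row (P * z) = k" by simp
    from select_row[OF this r(1)] have "c * (P * z) = 1\<^sub>m 1"
      unfolding c_def using r(2) by (intro eq_matI) auto
    then show ?thesis by (simp add: l_def mat_assoc_dim)
  qed
  have lA: "l * A = 0\<^sub>m 1 m" by (simp add: l_def mat_assoc_dim SP(5))
  define M :: "'k quiver_rep" where "M = interval_module (s - 1) t"
  define \<iota> where "\<iota> v = (if s \<le> v \<and> v \<le> t then path Q s v * y else 0\<^sub>m (vdim Q v) 0)" for v
  define \<rho> where "\<rho> v = (if s \<le> v \<and> v \<le> t then l * path Q v t else 0\<^sub>m 0 (vdim Q v))" for v
  have dM: "vdim M v = (if s \<le> v \<and> v \<le> t then 1 else 0)" for v using y(1) by (auto simp: M_def)
  have dim_aM: "dim_row (amap M v) = (if s \<le> Suc v \<and> Suc v \<le> t then 1 else 0)"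
    "dim_col (amap M v) = (if s \<le> v \<and> v \<le> t then 1 else 0)" for v using y(1) by (auto simp: M_def)
  have aM: "amap M v = 1\<^sub>m 1" if "s \<le> v" "v < t" for v unfolding M_def using that y(1) by (intro amap_interval) auto
  have d\<iota>: "dim_row (\<iota> v) = vdim Q v" "dim_col (\<iota> v) = vdim M v"
    and d\<rho>: "dim_row (\<rho> v) = vdim M v" "dim_col (\<rho> v) = vdim Q v" if v: "0 < v" "v \<le> n" for v
    using dim_path[OF Q y(1), of v] dim_path[OF Q v(1), of t] y(4) t(3) by (auto simp: \<iota>_def \<rho>_def dM)
  have "is_hom n M Q \<iota>"
  proof (rule is_homI)
    fix v assume v: "0 < v" "v < n"
    then have v': "v \<le> n" "0 < Suc v" "Suc v \<le> n" by auto
    note [simp] = is_repD[OF Q v] d\<iota>[OF v(1) v'(1)] d\<iota>[OF v'(2,3)] dim_aM dM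
    consider "s \<le> v" "v < t" | "v = t" | "v < s \<or> t < v" by linarith
    then show "\<iota> (Suc v) * amap M v = amap Q v * \<iota> v"
    proof cases
      case 1
      then show ?thesis using dim_path[OF Q y(1), of v] v' y(3,4)
        by (simp add: \<iota>_def aM path_Suc mat_assoc_dim)
    next
      case 2
      have "amap Q v * \<iota> v = path Q s (Suc t) * y"
        using 2 st dst y(3) is_repD[OF Q v] by (simp add: \<iota>_def path_Suc mat_assoc_dim)
      then have "amap Q v * \<iota> v = 0\<^sub>m (vdim Q (Suc t)) 1" using next0 v' 2 by simp
      moreover have "\<iota> (Suc v) * amap M v = 0\<^sub>m (vdim Q (Suc t)) 1"
        using 2 st d\<iota>[OF v'(2,3)] by (intro eq_matI) (auto simp: scalar_prod_def)
      ultimately show ?thesis by simp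
    next
      case 3
      then show ?thesis by (intro mat_zero_dims) auto
    qed
  qed (use d\<iota> in auto)
  moreover have "is_hom n Q M \<rho>"
  proof (rule is_homI)
    fix v assume v: "0 < v" "v < n"
    then have v': "v \<le> n" "0 < Suc v" "Suc v \<le> n" by auto
    note [simp] = is_repD[OF Q v] d\<rho>[OF v(1) v'(1)] d\<rho>[OF v'(2,3)] dim_aM dM
    consider "s \<le> v" "v < t" | "Suc v = s" | "Suc v < s \<or> t < Suc v" by linarith
    then show "\<rho> (Suc v) * amap Q v = amap M v * \<rho> v"
    proof cases
      case 1
      then show ?thesis
        using dim_path[OF Q v(1), of t] dim_path[OF Q v'(2), of t] t(3) path_step_left[OF Q v(1) 1(2) t(3)]
        by (simp add: \<rho>_def aM mat_assoc_dim)
    next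
      case 2
      have "\<rho> (Suc v) * amap Q v = l * (path Q (Suc v) t * amap Q v)"
        using 2 st dim_path[OF Q v'(2), of t] t(3) is_repD[OF Q v] by (simp add: \<rho>_def mat_assoc_dim)
      also have "\<dots> = l * A"
      proof -
        have "A = path Q v t" using 2 v by (auto simp: A_def)
        then show ?thesis using path_step_left[OF Q v(1), of t] 2 st t(3) by simp
      qed
      also have "\<dots> = 0\<^sub>m 1 (vdim Q v)" unfolding lA using 2 v by (auto simp: m_def)
      finally have "\<rho> (Suc v) * amap Q v = 0\<^sub>m 1 (vdim Q v)" .
      moreover have "amap M v * \<rho> v = 0\<^sub>m 1 (vdim Q v)"
        using 2 st d\<rho>[OF v(1) v'(1)] by (intro eq_matI) (auto simp: scalar_prod_def)
      ultimately show ?thesis by simp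
    next
      case 3
      then show ?thesis by (intro mat_zero_dims) auto
    qed
  qed (use d\<rho> in auto)
  moreover have "\<rho> v * \<iota> v = 1\<^sub>m (vdim M v)" if v: "0 < v" "v \<le> n" for v
  proof (cases "s \<le> v \<and> v \<le> t")
    case True
    then have "\<rho> v * \<iota> v = l * (path Q v t * path Q s v * y)"
      using dim_path[OF Q y(1), of v] dim_path[OF Q v(1), of t] t(3) y(3)
      by (simp add: \<rho>_def \<iota>_def mat_assoc_dim)
    also have "path Q v t * path Q s v = path Q s t" using True t(3) by (intro path_trans[OF Q y(1)]) auto
    finally show ?thesis using True lz by (simp add: dM z_def)
  next
    case False
    then show ?thesis using d\<rho>[OF v] d\<iota>[OF v] by (intro mat_zero_dims) (auto simp: dM)
  qed
  ultimately have "retract n M Q" unfolding retract_def by blast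
  then show ?thesis using that[of "s - 1" t] y(1,2) t(1,2,3) unfolding M_def by simp
qed

section \<open>Direct sums and the classification of indecomposables\<close>

lemma direct_sum_ext_rep: 
  assumes "is_rep n V" "is_rep n W" "0 < v" "v < n"
  shows "amap (direct_sum V W) v =
     in_l V W (Suc v) * amap V v * pr_l V W v +
     in_r V W (Suc v) * amap W v * pr_r V W v"
proof -
  have "amap V v \<in> carrier_mat (vdim V (Suc v)) (vdim V v)" "amap W v \<in> carrier_mat (vdim W (Suc v)) (vdim W v)"
    using is_repD[OF assms(1,3,4)] is_repD[OF assms(2,3,4)] by auto
  from four_block_mat_biproduct[OF this(1) zero_carrier_mat this(2)] this show ?thesis
    by (simp add: direct_sum_def)
qed

lemma vdim_direct_sum [simp]: "vdim (direct_sum V W) v = vdim V v + vdim W v"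
  by (simp add: direct_sum_def)

lemma is_rep_direct_sum:
  assumes "is_rep n V" "is_rep n W" shows "is_rep n (direct_sum V W)"
  using is_repD[OF assms(1)] is_repD[OF assms(2)] by (intro is_repI) (simp_all add: direct_sum_def)

lemma direct_sum_biproduct:
  fixes V W :: "'k::field quiver_rep"
  assumes V: "is_rep n V" and W: "is_rep n W"
  shows "is_hom n V (direct_sum V W) (\<lambda>v. in_l V W v)"
    and "is_hom n W (direct_sum V W) (\<lambda>v. in_r V W v)"
    and "is_hom n (direct_sum V W) V (\<lambda>v. pr_l V W v)"
    and "is_hom n (direct_sum V W) W (\<lambda>v. pr_r V W v)"
proof -
  have "in_l V W (Suc v) * amap V v = amap (direct_sum V W) v * in_l V W v"
    "in_r V W (Suc v) * amap W v = amap (direct_sum V W) v * in_r V W v"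
    "pr_l V W (Suc v) * amap (direct_sum V W) v = amap V v * pr_l V W v"
    "pr_r V W (Suc v) * amap (direct_sum V W) v = amap W v * pr_r V W v"
    if v: "0 < v" "v < n" for v
    using is_repD[OF V v] is_repD[OF W v] by (simp_all add: direct_sum_ext_rep[OF V W v] mat_dim_simps)
  then show "is_hom n V (direct_sum V W) (\<lambda>v. in_l V W v)"
    "is_hom n W (direct_sum V W) (\<lambda>v. in_r V W v)"
    "is_hom n (direct_sum V W) V (\<lambda>v. pr_l V W v)"
    "is_hom n (direct_sum V W) W (\<lambda>v. pr_r V W v)"
    by (auto intro!: is_homI)
qed

lemma direct_sum_biprod:
  fixes V W :: "'k::field quiver_rep"
  assumes "is_rep n V" "is_rep n W"
  shows "biprod n V W (direct_sum V W) (\<lambda>v. in_l V W v) (\<lambda>v. pr_l V W v)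
    (\<lambda>v. in_r V W v) (\<lambda>v. pr_r V W v)"
  using assms is_rep_direct_sum[OF assms] direct_sum_biproduct[OF assms] by (simp add: biprod_def)

lemma direct_sum_retract:
  fixes V W :: "'k::field quiver_rep"
  assumes V: "is_rep n V" and W: "is_rep n W"
  shows "retract n V (direct_sum V W)" "retract n W (direct_sum V W)"
  unfolding retract_def using direct_sum_biproduct[OF assms] biproduct(1,4) by blast+

lemma hom0_direct_sum:
  fixes V W Z :: "'k::field quiver_rep"
  assumes Z: "is_rep n Z" and V: "is_rep n V" and W: "is_rep n W"
  shows "hom0 n Z (direct_sum V W) \<longleftrightarrow> hom0 n Z V \<and> hom0 n Z W"
proof
  assume "hom0 n Z (direct_sum V W)"
  then show "hom0 n Z V \<and> hom0 n Z W"
    using hom0_retract[OF Z _ is_rep_direct_sum[OF V W]] V W direct_sum_retract[OF V W] by blast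
next
  assume H: "hom0 n Z V \<and> hom0 n Z W"
  note VW = is_rep_direct_sum[OF V W]
  show "hom0 n Z (direct_sum V W)"
    unfolding hom0_def
  proof (intro allI impI)
    fix f v assume f: "is_hom n Z (direct_sum V W) f" and v: "0 < v" "v \<le> n"
    have "is_hom n Z V (\<lambda>v. pr_l V W v * f v)" "is_hom n Z W (\<lambda>v. pr_r V W v * f v)"
      using is_hom_comp[OF Z VW V f direct_sum_biproduct(3)[OF V W]]
        is_hom_comp[OF Z VW W f direct_sum_biproduct(4)[OF V W]] by auto
    then have z: "pr_l V W v * f v = 0\<^sub>m (vdim V v) (vdim Z v)"
      "pr_r V W v * f v = 0\<^sub>m (vdim W v) (vdim Z v)"
      using H v unfolding hom0_def by blast+
    note [simp] = is_homD(1,2)[OF f v]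
    have "f v = (in_l V W v * pr_l V W v +
        in_r V W v * pr_r V W v) * f v"
      unfolding biproduct_sum by simp
    also have "\<dots> = in_l V W v * (pr_l V W v * f v) +
        in_r V W v * (pr_r V W v * f v)"
      by (simp add: mat_dim_simps del: biproduct_sum)
    finally show "f v = 0\<^sub>m (vdim (direct_sum V W) v) (vdim Z v)" by (simp add: z)
  qed
qed

lemma ext0_direct_sum:
  fixes V W Z :: "'k::field quiver_rep"
  assumes Z: "is_rep n Z" and V: "is_rep n V" and W: "is_rep n W"
  shows "ext0 n Z (direct_sum V W) \<longleftrightarrow> ext0 n Z V \<and> ext0 n Z W"
proof
  assume "ext0 n Z (direct_sum V W)"
  then show "ext0 n Z V \<and> ext0 n Z W"
    using ext0_retract[OF Z _ is_rep_direct_sum[OF V W]] V W direct_sum_retract[OF V W] by blast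
next
  assume H: "ext0 n Z V \<and> ext0 n Z W"
  show "ext0 n Z (direct_sum V W)"
  proof (rule ext0I)
    fix \<theta> :: "nat \<Rightarrow> 'k mat"
    assume \<theta>: "\<And>v. 0 < v \<Longrightarrow> v < n \<Longrightarrow> dim_row (\<theta> v) = vdim (direct_sum V W) (Suc v)"
      "\<And>v. 0 < v \<Longrightarrow> v < n \<Longrightarrow> dim_col (\<theta> v) = vdim Z v"
    let ?il = "\<lambda>v. in_l V W v :: 'k mat" and ?ir = "\<lambda>v. in_r V W v :: 'k mat"
    let ?pl = "\<lambda>v. pr_l V W v :: 'k mat" and ?pr = "\<lambda>v. pr_r V W v :: 'k mat"
    obtain f where f0: "solves n Z V (\<lambda>v. ?pl (Suc v) * \<theta> v) f"
      by (rule ext0E[OF conjunct1[OF H], of "\<lambda>v. ?pl (Suc v) * \<theta> v"]) (use \<theta> in auto)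
    note f = solvesD[OF f0]
    obtain g where g0: "solves n Z W (\<lambda>v. ?pr (Suc v) * \<theta> v) g"
      by (rule ext0E[OF conjunct2[OF H], of "\<lambda>v. ?pr (Suc v) * \<theta> v"]) (use \<theta> in auto)
    note g = solvesD[OF g0]
    define h where "h v = ?il v * f v + ?ir v * g v" for v
    have "h (Suc v) * amap Z v = amap (direct_sum V W) v * h v + \<theta> v" if v: "0 < v" "v < n" for v
    proof -
      have v': "v \<le> n" "0 < Suc v" "Suc v \<le> n" using v by auto
      note [simp] = is_repD[OF Z v] is_repD[OF V v] is_repD[OF W v] \<theta>[OF v, simplified]
        f(1,2)[OF v(1) v'(1)] f(1,2)[OF v'(2,3)] g(1,2)[OF v(1) v'(1)] g(1,2)[OF v'(2,3)]
      have "\<theta> v = (?il (Suc v) * ?pl (Suc v) + ?ir (Suc v) * ?pr (Suc v)) * \<theta> v"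
        unfolding biproduct_sum by simp
      then have t: "?il (Suc v) * (?pl (Suc v) * \<theta> v) + ?ir (Suc v) * (?pr (Suc v) * \<theta> v) = \<theta> v"
        by (simp add: mat_dim_simps del: biproduct_sum)
      have "h (Suc v) * amap Z v = ?il (Suc v) * (f (Suc v) * amap Z v) + ?ir (Suc v) * (g (Suc v) * amap Z v)"
        by (simp add: h_def mat_dim_simps)
      also have "\<dots> = (?il (Suc v) * (amap V v * f v) + ?il (Suc v) * (?pl (Suc v) * \<theta> v)) +
          (?ir (Suc v) * (amap W v * g v) + ?ir (Suc v) * (?pr (Suc v) * \<theta> v))"
        unfolding f(3)[OF v] g(3)[OF v] by (simp add: mat_mult_add_dim)
      also have "\<dots> = (?il (Suc v) * (amap V v * f v) + ?ir (Suc v) * (amap W v * g v)) +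
          (?il (Suc v) * (?pl (Suc v) * \<theta> v) + ?ir (Suc v) * (?pr (Suc v) * \<theta> v))"
        by (intro eq_matI) (simp_all del: index_mult_mat(1))
      also have "?il (Suc v) * (amap V v * f v) + ?ir (Suc v) * (amap W v * g v) = amap (direct_sum V W) v * h v"
        by (simp add: direct_sum_ext_rep[OF V W v] h_def mat_dim_simps)
      finally show ?thesis unfolding t .
    qed
    moreover have "dim_row (h v) = vdim (direct_sum V W) v \<and> dim_col (h v) = vdim Z v" if "0 < v" "v \<le> n" for v
      using g(2)[OF that] by (simp add: h_def)
    ultimately show "\<exists>f. solves n Z (direct_sum V W) \<theta> f"
      unfolding solves_def by blast
  qed
qed

lemma left_perp_iff:
  assumes "\<And>V. V \<in> set Vs \<Longrightarrow> is_rep n V"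
  shows "W \<in> left_perp n (direct_sum_list Vs) \<longleftrightarrow>
    is_rep n W \<and> (\<forall>V\<in>set Vs. hom0 n W V \<and> ext0 n W V)"
proof (cases "is_rep n W")
  case W: True
  have "is_rep n (direct_sum_list Vs) \<and>
    (hom0 n W (direct_sum_list Vs) \<and> ext0 n W (direct_sum_list Vs) \<longleftrightarrow> (\<forall>V\<in>set Vs. hom0 n W V \<and> ext0 n W V))"
    using assms
  proof (induction Vs)
    case Nil
    have rep: "is_rep n (zero_rep :: 'a quiver_rep)" by (rule is_repI) (simp_all add: zero_rep_def)
    have "hom0 n W zero_rep"
      unfolding hom0_def zero_rep_def is_hom_def by (auto intro!: mat_zero_dims)
    moreover have "ext0 n W zero_rep"
    proof (rule ext0I, rule exI[of _ "\<lambda>v. 0\<^sub>m 0 (vdim W v)"], unfold solves_def, intro conjI allI impI)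
      fix \<theta> :: "nat \<Rightarrow> 'a mat" and v assume v: "0 < v" "v < n"
        and "\<And>v. 0 < v \<Longrightarrow> v < n \<Longrightarrow> dim_row (\<theta> v) = vdim (zero_rep :: 'a quiver_rep) (Suc v)"
        "\<And>v. 0 < v \<Longrightarrow> v < n \<Longrightarrow> dim_col (\<theta> v) = vdim W v"
      then show "0\<^sub>m 0 (vdim W (Suc v)) * amap W v = amap zero_rep v * 0\<^sub>m 0 (vdim W v) + \<theta> v"
        using is_repD[OF W v] by (intro mat_zero_dims) (auto simp: zero_rep_def)
    qed (simp_all add: zero_rep_def)
    ultimately show ?case using rep by (simp add: direct_sum_list_def)
  next
    case (Cons V Vs)
    then have V: "is_rep n V" and IH: "is_rep n (direct_sum_list Vs)"
      "hom0 n W (direct_sum_list Vs) \<and> ext0 n W (direct_sum_list Vs) \<longleftrightarrow> (\<forall>V\<in>set Vs. hom0 n W V \<and> ext0 n W V)"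
      by auto
    have "direct_sum_list (V # Vs) = direct_sum V (direct_sum_list Vs)" by (simp add: direct_sum_list_def)
    then show ?case
      using is_rep_direct_sum[OF V IH(1)] hom0_direct_sum[OF W V IH(1)] ext0_direct_sum[OF W V IH(1)] IH(2) by auto
  qed
  then show ?thesis using W Hom_zero_iff[OF W] Ext1_zero_iff[OF W] unfolding left_perp_def by blast
next
  case False
  then show ?thesis by (simp add: left_perp_def)
qed

lemma indecomposable_retract_iso:
  fixes M A :: "'k::field quiver_rep"
  assumes M: "indecomposable n M" and A: "is_rep n A" "\<not> is_zero_rep n A" and "retract n A M"
  shows "isomorphic n M A"
proof -
  have rM: "is_rep n M" and ind: "\<And>V W. is_rep n V \<Longrightarrow> is_rep n W \<Longrightarrow> isomorphic n M (direct_sum V W) \<Longrightarrow>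
        is_zero_rep n V \<or> is_zero_rep n W" using M unfolding indecomposable_def by auto
  obtain s r where s: "is_hom n A M s" and r: "is_hom n M A r"
    and rs: "\<And>v. 0 < v \<Longrightarrow> v \<le> n \<Longrightarrow> r v * s v = 1\<^sub>m (vdim A v)"
    using \<open>retract n A M\<close> unfolding retract_def by blast
  obtain K k p b where ker: "kernel_of n M A r K k p b"
    by (rule kernel_rep[OF rM A(1) r])
  note K = kernel_ofD(1)[OF ker] and k = kernel_ofD(2)[OF ker] and d = kernel_ofD(3-6)[OF ker]
    and pk = kernel_ofD(7)[OF ker] and rk = kernel_ofD(8)[OF ker] and kp = kernel_ofD(9)[OF ker]
  define p' where "p' v = p v * (1\<^sub>m (vdim M v) - s v * r v)" for v
  have id: "k v * p' v + s v * r v = 1\<^sub>m (vdim M v)" "p' v * k v = 1\<^sub>m (vdim K v)"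
    and dp': "dim_row (p' v) = vdim K v" "dim_col (p' v) = vdim M v"
    if v: "0 < v" "v \<le> n" for v
  proof -
    note [simp] = is_homD(1,2)[OF s v] is_homD(1,2)[OF r v] is_homD(1,2)[OF k v] d[OF v]
    show "dim_row (p' v) = vdim K v" "dim_col (p' v) = vdim M v" by (simp_all add: p'_def)
    have "r v * (1\<^sub>m (vdim M v) - s v * r v) = r v - (r v * s v) * r v"
      by (simp add: mat_mult_minus_dim mat_assoc_dim)
    then have rz: "r v * (1\<^sub>m (vdim M v) - s v * r v) = 0\<^sub>m (vdim A v) (vdim M v)" by (simp add: rs[OF v])
    have "1\<^sub>m (vdim M v) - s v * r v = (k v * p v + b v * r v) * (1\<^sub>m (vdim M v) - s v * r v)"
      by (simp add: kp[OF v])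
    also have "\<dots> = k v * p' v + b v * (r v * (1\<^sub>m (vdim M v) - s v * r v))"
      unfolding p'_def by (subst mat_add_mult_dim) (simp_all add: mat_assoc_dim)
    finally have kp': "k v * p' v = 1\<^sub>m (vdim M v) - s v * r v" using rz by (simp add: p'_def)
    show "k v * p' v + s v * r v = 1\<^sub>m (vdim M v)"
      unfolding kp' by (intro eq_matI) auto
    have "p' v * k v = p v * k v - p v * (s v * (r v * k v))"
      by (simp add: p'_def mat_dim_simps)
    then show "p' v * k v = 1\<^sub>m (vdim K v)" by (simp add: rk[OF v] pk[OF v])
  qed
  have B: "biprod n K A M k p' s r"
    using dp' id rs by (intro biprodI[OF K A(1) rM k s r]) auto
  obtain h where "restrict h {1..n} \<in> rep_isos n M (direct_sum K A)"
    by (rule biprod_iso[OF B direct_sum_biprod[OF K A(1)]])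
  then have "isomorphic n M (direct_sum K A)" unfolding isomorphic_def by blast
  then have "is_zero_rep n K" using ind[OF K A(1)] A(2) by blast
  then have K0: "vdim K v = 0" if "0 < v" "v \<le> n" for v using that by (simp add: is_zero_rep_def)
  have "s v * r v = 1\<^sub>m (vdim M v)" if v: "0 < v" "v \<le> n" for v
  proof -
    note [simp] = is_homD(1,2)[OF s v] is_homD(1,2)[OF r v] is_homD(1,2)[OF k v] dp'[OF v]
    have "k v * p' v = 0\<^sub>m (vdim M v) (vdim M v)"
      using K0[OF v] by (intro eq_matI) (auto simp: scalar_prod_def)
    then show ?thesis using id(1)[OF v] by simp
  qed
  then show ?thesis by (intro isomorphicI[OF r s]) (use rs in auto)
qed

lemma indecomposable_interval:
  fixes M :: "'k::field quiver_rep"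
  assumes M: "indecomposable n M"
  obtains a b where "a < b" "b \<le> n" "isomorphic n M (interval_module a b)"
proof -
  have rM: "is_rep n M" and "\<not> is_zero_rep n M" using M unfolding indecomposable_def by auto
  then obtain i where "i \<in> {1..n}" "vdim M i \<noteq> 0" unfolding is_zero_rep_def by blast
  then have i: "0 < i" "i \<le> n" "vdim M i \<noteq> 0" by auto
  define x :: "'k mat" where "x = mat (vdim M i) 1 (\<lambda>_. 1)"
  have "x $$ (0, 0) = 1" using i by (simp add: x_def)
  then have x0: "x \<noteq> 0\<^sub>m (vdim M i) 1" using i by auto
  obtain a b where ab: "a < i" "i \<le> b" "b < Suc n" "b \<le> n" "retract n (interval_module a b) M"
    by (rule interval_retract[OF rM i(1,2), of "Suc n" x]) (use i x0 in \<open>auto simp: x_def\<close>)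
  have "\<not> is_zero_rep n (interval_module a b :: 'k quiver_rep)"
    using ab i unfolding is_zero_rep_def by (auto intro!: bexI[of _ i])
  then have "isomorphic n M (interval_module a b)"
    using indecomposable_retract_iso[OF M is_rep_interval _ ab(5)] by blast
  then show ?thesis using that[of a b] ab by simp
qed

section \<open>Relative injectivity\<close>

lemma retract_support:
  assumes "retract n A B" "0 < v" "v \<le> n" "vdim B v = 0"
  shows "vdim A v = 0"
proof -
  obtain s r where s: "is_hom n A B s" and r: "is_hom n B A r"
    and rs: "\<And>v. 0 < v \<Longrightarrow> v \<le> n \<Longrightarrow> r v * s v = 1\<^sub>m (vdim A v)"
    using assms(1) unfolding retract_def by blast
  show ?thesis
    using mat_section_zero[OF rs[OF assms(2,3)]] is_homD(1)[OF s assms(2,3)] is_homD(2)[OF r assms(2,3)] assms(4)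
    by simp
qed

lemma isomorphic_interval_unique:
  fixes X :: "'k::field quiver_rep"
  assumes "isomorphic n X (interval_module a b)" "a < b" "b \<le> n"
    and "isomorphic n X (interval_module c d)" "c < d" "d \<le> n"
  shows "(a, b) = (c, d)"
proof -
  have supp: "{v. 0 < v \<and> v \<le> n \<and> vdim X v \<noteq> 0} = {a<..b}"
    if iso: "isomorphic n X (interval_module a b)" and "a < b" "b \<le> n" for a b
  proof -
    have *: "vdim X v \<noteq> 0 \<longleftrightarrow> a < v \<and> v \<le> b" if v: "0 < v" "v \<le> n" for v
    proof -
      have "vdim X v = 0 \<longleftrightarrow> vdim (interval_module a b :: 'k quiver_rep) v = 0"
        using retract_support[OF isomorphic_retract(1)[OF iso] v]
          retract_support[OF isomorphic_retract(2)[OF iso] v] by blast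
      then show ?thesis by simp
    qed
    have "v \<in> {v. 0 < v \<and> v \<le> n \<and> vdim X v \<noteq> 0} \<longleftrightarrow> v \<in> {a<..b}" for v
      using *[of v] that(2,3) by (cases "0 < v \<and> v \<le> n") auto
    then show ?thesis by blast
  qed
  have eq: "{a<..b} = {c<..d}" using supp[OF assms(1-3)] supp[OF assms(4-6)] by simp
  have "b \<in> {c<..d}" "Suc a \<in> {c<..d}" unfolding eq[symmetric] using assms(2) by simp_all
  moreover have "d \<in> {a<..b}" "Suc c \<in> {a<..b}" unfolding eq using assms(5) by simp_all
  ultimately show ?thesis by auto
qed

lemma injective_extension:
  fixes X Y I :: "'k::field quiver_rep"
  assumes X: "is_rep n X" and Y: "is_rep n Y" and I: "is_rep n I" and f: "is_hom n X Y f"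
    and l: "\<And>v. 0 < v \<Longrightarrow> v \<le> n \<Longrightarrow> dim_row (l v) = vdim X v" "\<And>v. 0 < v \<Longrightarrow> v \<le> n \<Longrightarrow> dim_col (l v) = vdim Y v"
      "\<And>v. 0 < v \<Longrightarrow> v \<le> n \<Longrightarrow> l v * f v = 1\<^sub>m (vdim X v)"
    and coker: "cokernel_of n X Y f Q q s b"
    and E: "ext0 n Q I" and g: "is_hom n X I g"
  obtains h where "is_hom n Y I h" "\<And>v. 0 < v \<Longrightarrow> v \<le> n \<Longrightarrow> h v * f v = g v"
proof -
  note Q = cokernel_ofD(1)[OF coker] and q = cokernel_ofD(2)[OF coker] and d = cokernel_ofD(3-6)[OF coker]
    and qf = cokernel_ofD(8)[OF coker] and sq = cokernel_ofD(9)[OF coker]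
  define D where "D v = amap I v * (g v * l v) - g (Suc v) * (l (Suc v) * amap Y v)" for v
  have dD: "dim_row (D v) = vdim I (Suc v)" "dim_col (D v) = vdim Y v" if v: "0 < v" "v < n" for v
    using is_repD[OF Y v] is_homD(1)[OF g, of "Suc v"] v by (auto simp: D_def)
  obtain \<phi> where \<phi>0: "solves n Q I (\<lambda>v. D v * s v) \<phi>"
    by (rule ext0E[OF E, of "\<lambda>v. D v * s v"]) (use dD d in auto)
  note \<phi> = solvesD[OF \<phi>0]
  define h where "h v = g v * l v + \<phi> v * q v" for v
  have dh: "dim_row (h v) = vdim I v" "dim_col (h v) = vdim Y v" if v: "0 < v" "v \<le> n" for v
    using is_homD(1,2)[OF q v] \<phi>(1,2)[OF v] by (simp_all add: h_def)
  have "h (Suc v) * amap Y v = amap I v * h v" if v: "0 < v" "v < n" for v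
  proof -
    have v': "v \<le> n" "0 < Suc v" "Suc v \<le> n" using v by auto
    note [simp] = is_repD[OF X v] is_repD[OF Y v] is_repD[OF Q v] is_repD[OF I v] dD[OF v]
      is_hom_dims[OF f v] is_hom_dims[OF q v]
      is_hom_dims[OF g v] l(1,2)[OF v(1) v'(1)] l(1,2)[OF v'(2,3)]
      d[OF v(1) v'(1)] d[OF v'(2,3)] \<phi>(1,2)[OF v(1) v'(1)] \<phi>(1,2)[OF v'(2,3)]
    have "D v * f v = amap I v * (g v * (l v * f v)) - g (Suc v) * (l (Suc v) * (amap Y v * f v))"
      by (simp add: D_def mat_dim_simps)
    also have "\<dots> = amap I v * g v - g (Suc v) * ((l (Suc v) * f (Suc v)) * amap X v)"
      unfolding is_homD(3)[OF f v, symmetric] by (simp add: l(3)[OF v(1) v'(1)] mat_assoc_dim)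
    also have "\<dots> = 0\<^sub>m (vdim I (Suc v)) (vdim X v)"
      using is_homD(3)[OF g v] by (simp add: l(3)[OF v'(2,3)])
    finally have Df: "D v * f v = 0\<^sub>m (vdim I (Suc v)) (vdim X v)" .
    have "D v = D v * (s v * q v + f v * b v)" by (simp add: sq[OF v(1) v'(1)])
    also have "\<dots> = D v * s v * q v + (D v * f v) * b v" by (simp add: mat_mult_add_dim mat_assoc_dim)
    finally have Dsq: "D v * s v * q v = D v" by (simp add: Df)
    have "h (Suc v) * amap Y v = g (Suc v) * (l (Suc v) * amap Y v) + \<phi> (Suc v) * (q (Suc v) * amap Y v)"
      by (simp add: h_def mat_dim_simps)
    also have "\<phi> (Suc v) * (q (Suc v) * amap Y v) = (\<phi> (Suc v) * amap Q v) * q v"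
      unfolding is_homD(3)[OF q v] by (simp add: mat_assoc_dim)
    also have "\<dots> = amap I v * \<phi> v * q v + D v"
      unfolding \<phi>(3)[OF v] using Dsq by (simp add: mat_add_mult_dim)
    also have "g (Suc v) * (l (Suc v) * amap Y v) + (amap I v * \<phi> v * q v + D v)
        = amap I v * (g v * l v) + amap I v * \<phi> v * q v"
      unfolding D_def by (intro eq_matI) (simp_all del: index_mult_mat(1))
    also have "\<dots> = amap I v * h v" by (simp add: h_def mat_dim_simps)
    finally show ?thesis .
  qed
  then have "is_hom n Y I h" using dh by (intro is_homI) auto
  moreover have "h v * f v = g v" if v: "0 < v" "v \<le> n" for v
  proof -
    note [simp] = is_homD(1,2)[OF f v] is_homD(1,2)[OF q v] is_homD(1,2)[OF g v] l(1,2)[OF v] \<phi>(1,2)[OF v]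
    have "h v * f v = g v * (l v * f v) + \<phi> v * (q v * f v)" by (simp add: h_def mat_dim_simps)
    then show ?thesis by (simp add: l(3)[OF v] qf[OF v])
  qed
  ultimately show ?thesis by (rule that)
qed

definition perp_class :: "nat \<Rightarrow> (nat \<times> nat) list \<Rightarrow> nat \<Rightarrow> 'k::field quiver_rep set" where
  "perp_class n s p = {W. is_rep n W \<and> (\<forall>q<p. iso_at W (fst (s ! q)) (snd (s ! q)))}"

context
  fixes n p :: nat and s :: "(nat \<times> nat) list"
  assumes strands: "\<And>q. q < p \<Longrightarrow> fst (s ! q) < snd (s ! q) \<and> snd (s ! q) \<le> n"
begin

lemma interval_perp_class:
  "a < b \<Longrightarrow> (interval_module a b :: 'k::field quiver_rep) \<in> perp_class n s p \<longleftrightarrow> sim s p a b"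
  unfolding perp_class_def sim_def using strands iso_at_interval[of a b, where ?'k = 'k] by auto

lemma retract_perp_class:
  assumes "is_rep n A" "B \<in> perp_class n s p" "retract n A B"
  shows "A \<in> perp_class n s p"
  using assms strands iso_at_retract[OF assms(1) _ _ _ assms(3)] unfolding perp_class_def by auto

lemma mono_in_perp_class:
  fixes X Y :: "'k::field quiver_rep"
  assumes mono: "mono_in n (perp_class n s p) X Y f"
  obtains l where "\<And>v. 0 < v \<Longrightarrow> v \<le> n \<Longrightarrow> dim_row (l v) = vdim X v"
    "\<And>v. 0 < v \<Longrightarrow> v \<le> n \<Longrightarrow> dim_col (l v) = vdim Y v"
    "\<And>v. 0 < v \<Longrightarrow> v \<le> n \<Longrightarrow> l v * f v = 1\<^sub>m (vdim X v)"
proof -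
  have XY: "X \<in> perp_class n s p" "Y \<in> perp_class n s p" and f: "is_hom n X Y f"
    using mono by (auto simp: mono_in_def rep_hom_iff)
  have can: "\<And>Z g h. Z \<in> perp_class n s p \<Longrightarrow> g \<in> rep_hom n Z X \<Longrightarrow> h \<in> rep_hom n Z X \<Longrightarrow>
      rep_comp n f g = rep_comp n f h \<Longrightarrow> g = h"
    using mono unfolding mono_in_def by blast
  have X: "is_rep n X" and Y: "is_rep n Y" using XY by (auto simp: perp_class_def)
  obtain K k p' b where ker: "kernel_of n X Y f K k p' b"
    by (rule kernel_rep[OF X Y f])
  note K = kernel_ofD(1)[OF ker] and k = kernel_ofD(2)[OF ker] and d = kernel_ofD(3-6)[OF ker]
    and fk = kernel_ofD(8)[OF ker] and kp = kernel_ofD(9)[OF ker]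
  have KC: "K \<in> perp_class n s p"
    using K XY strands iso_at_kernel[OF X Y f ker] unfolding perp_class_def by auto
  define z :: "nat \<Rightarrow> 'k mat" where "z v = 0\<^sub>m (vdim X v) (vdim K v)" for v
  have z: "is_hom n K X z"
    using is_repD[OF K] is_repD[OF X] by (intro is_homI) (simp_all add: z_def)
  have "rep_comp n f (restrict k {1..n}) = rep_comp n f (restrict z {1..n})"
  proof -
    have ext: "rep_comp n f (restrict z {1..n}) \<in> extensional {1..n}" by (simp add: rep_comp_def)
    show ?thesis
      unfolding rep_comp_eq_iff[OF ext]
      using fk is_homD(1,2)[OF f] by (simp add: rep_comp_def z_def)
  qed
  then have kz_eq: "restrict k {1..n} = restrict z {1..n}"
    by (rule can[OF KC restrict_rep_hom[OF k] restrict_rep_hom[OF z]])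
  have kz: "k v = 0\<^sub>m (vdim X v) (vdim K v)" if "0 < v" "v \<le> n" for v
    using that fun_cong[OF kz_eq, of v] by (simp add: z_def)
  have "b v * f v = 1\<^sub>m (vdim X v)" if v: "0 < v" "v \<le> n" for v
    using kp[OF v] d[OF v] is_homD(1,2)[OF f v] by (simp add: kz[OF v])
  then show ?thesis using that[of b] d(3,4) by blast
qed

theorem injective_in_perp_class_iff:
  fixes I :: "'k::field quiver_rep"
  assumes ij: "i < j" "j \<le> n" and I: "I \<in> perp_class n s p" and iso: "isomorphic n I (interval_module i j)"
  shows "injective_in n (perp_class n s p) I \<longleftrightarrow>
    \<not> (\<exists>x y. x < y \<and> y \<le> n \<and> sim s p x y \<and> x \<notin> {i..<j} \<and> y \<in> {i..<j})"
proof
  assume inj: "injective_in n (perp_class n s p) I"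
  show "\<not> (\<exists>x y. x < y \<and> y \<le> n \<and> sim s p x y \<and> x \<notin> {i..<j} \<and> y \<in> {i..<j})"
  proof
    assume "\<exists>x y. x < y \<and> y \<le> n \<and> sim s p x y \<and> x \<notin> {i..<j} \<and> y \<in> {i..<j}"
    then obtain x y where "x < y" "y \<le> n" "sim s p x y" "x \<notin> {i..<j}" "y \<in> {i..<j}" by blast
    then have xy: "x < i" "i \<le> y" "y < j" "sim s p x y" by auto
    define M :: "'k quiver_rep" where "M = interval_module i j"
    define N :: "'k quiver_rep" where "N = interval_module x j"
    have MC: "M \<in> perp_class n s p"
      unfolding M_def using retract_perp_class[OF is_rep_interval I isomorphic_retract(2)[OF iso]] .
    then have sij: "sim s p i j" using interval_perp_class[OF ij(1), where ?'k = 'k] by (simp add: M_def)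
    have "sim s p x i" using sim_cross[OF xy(4) sij] xy by simp
    then have "sim s p x j" using sij by (rule sim_trans)
    then have NC: "N \<in> perp_class n s p" using interval_perp_class[of x j, where ?'k = 'k] xy ij by (simp add: N_def)
    define f where "f v = (if i < v \<and> v \<le> j then 1\<^sub>m 1 else 0\<^sub>m (vdim N v) 0 :: 'k mat)" for v
    have df: "dim_row (f v) = vdim N v" "dim_col (f v) = vdim M v" for v
      using xy by (auto simp: f_def N_def M_def)
    have f: "is_hom n M N f"
    proof (rule is_homI)
      fix v assume v: "0 < v" "v < n"
      show "f (Suc v) * amap M v = amap N v * f v"
      proof (cases "i < v \<and> v < j")
        case True
        then show ?thesis using xy by (simp add: f_def M_def N_def amap_interval)
      next
        case False
        then show ?thesis
          using df[of v] df[of "Suc v"] xy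
          by (intro mat_zero_dims) (auto simp: M_def N_def)
      qed
    qed (use df in auto)
    define l where "l v = (if i < v \<and> v \<le> j then 1\<^sub>m 1 else 0\<^sub>m 0 (vdim N v) :: 'k mat)" for v
    have lf: "l v * f v = 1\<^sub>m (vdim M v)" for v
      by (auto simp: l_def f_def M_def intro!: mat_zero_dims)
    have dl: "dim_col (l v) = vdim N v" for v using xy by (auto simp: l_def N_def)
    have rM: "is_rep n M" and rN: "is_rep n N" by (simp_all add: M_def N_def)
    have mono: "mono_in n (perp_class n s p) M N (restrict f {1..n})"
      unfolding mono_in_def
    proof (intro conjI MC NC restrict_rep_hom[OF f] ballI impI)
      fix Z :: "'k quiver_rep" and g h
      assume gh: "g \<in> rep_hom n Z M" "h \<in> rep_hom n Z M"
        and eq: "rep_comp n (restrict f {1..n}) g = rep_comp n (restrict f {1..n}) h"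
      show "g = h"
      proof (rule extensionalityI)
        show "g \<in> extensional {1..n}" "h \<in> extensional {1..n}" using gh by (auto simp: rep_hom_iff)
        fix v assume v: "v \<in> {1..n}"
        then have v': "0 < v" "v \<le> n" by auto
        have hom: "is_hom n Z M g" "is_hom n Z M h" using gh by (auto simp: rep_hom_iff)
        have "f v * g v = f v * h v"
          using fun_cong[OF eq, of v] v by (simp add: rep_comp_def)
        then have "l v * f v * g v = l v * f v * h v"
          using is_homD(1,2)[OF hom(1) v'] is_homD(1,2)[OF hom(2) v'] df[of v] dl[of v]
          by (simp add: mat_assoc_dim)
        then show "g v = h v"
          unfolding lf using is_homD(1,2)[OF hom(1) v'] is_homD(1,2)[OF hom(2) v'] by simp
      qed
    qed
    have rI: "is_rep n I" using I by (simp add: perp_class_def)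
    obtain w u where w: "is_hom n I M w" and u: "is_hom n M I u"
      and uw: "\<And>v. 0 < v \<Longrightarrow> v \<le> n \<Longrightarrow> u v * w v = 1\<^sub>m (vdim I v)"
      and wu: "\<And>v. 0 < v \<Longrightarrow> v \<le> n \<Longrightarrow> w v * u v = 1\<^sub>m (vdim M v)"
      by (rule isomorphicD[OF iso[folded M_def]]) (rule that)
    obtain h where h: "h \<in> rep_hom n N I" "rep_comp n h (restrict f {1..n}) = restrict u {1..n}"
      using inj mono restrict_rep_hom[OF u] unfolding injective_in_def by blast
    have hh: "is_hom n N I h" using h(1) by (simp add: rep_hom_iff)
    define k where "k v = w v * h v" for v
    have k: "is_hom n N M k" unfolding k_def by (rule is_hom_comp[OF rN rI rM hh w])
    have i: "0 < i" "i < n" "0 < Suc i" "Suc i \<le> n" "i \<le> n" using xy ij by auto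
    note [simp] = is_homD(1,2)[OF k i(1,5)] is_homD(1,2)[OF k i(3,4)] is_homD(1,2)[OF hh i(3,4)]
      is_homD(1,2)[OF w i(3,4)]
    have "h (Suc i) * f (Suc i) = u (Suc i)"
      using fun_cong[OF h(2), of "Suc i"] i by (simp add: rep_comp_def)
    then have "k (Suc i) * f (Suc i) = 1\<^sub>m (vdim M (Suc i))"
      using wu[OF i(3,4)] df[of "Suc i"] by (simp add: k_def mat_assoc_dim)
    then have "k (Suc i) = 1\<^sub>m 1"
      using ij xy is_homD(2)[OF k i(3,4)] by (simp add: f_def M_def N_def)
    moreover have "k (Suc i) = 0\<^sub>m 1 1"
    proof -
      have "k (Suc i) * amap N i = amap M i * k i" by (rule is_homD(3)[OF k i(1,2)])
      moreover have "amap N i = 1\<^sub>m 1" unfolding N_def using xy by (intro amap_interval) auto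
      moreover have "amap M i * k i = 0\<^sub>m 1 1"
        using is_homD(1,2)[OF k i(1,5)] xy ij
        by (intro eq_matI) (auto simp: M_def N_def scalar_prod_def)
      ultimately show ?thesis
        using is_homD(1,2)[OF k i(3,4)] xy ij by (simp add: N_def)
    qed
    ultimately have "(1\<^sub>m 1 :: 'k mat) = 0\<^sub>m 1 1" by simp
    from one_mat_eq_zero[OF this] show False by simp
  qed
next
  assume none: "\<not> (\<exists>x y. x < y \<and> y \<le> n \<and> sim s p x y \<and> x \<notin> {i..<j} \<and> y \<in> {i..<j})"
  have rI: "is_rep n I" using I by (simp add: perp_class_def)
  have ext: "ext0 n Q I" if QC: "Q \<in> perp_class n s p" for Q :: "'k quiver_rep"
  proof -
    have Q: "is_rep n Q" using QC by (simp add: perp_class_def)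
    have "\<exists>L\<in>carrier_mat (vdim Q i) (vdim Q j). L * path Q i j = 1\<^sub>m (vdim Q i)" if i: "0 < i"
    proof -
      have ij': "i \<le> j" "i \<le> n" using ij by auto
      note dP = dim_path[OF Q i ij'(1) ij(2)]
      have "path Q i j \<in> carrier_mat (vdim Q j) (vdim Q i)" using dP by auto
      then obtain k S P B where SP: "S \<in> carrier_mat (vdim Q i) k" "P \<in> carrier_mat k (vdim Q i)"
        "B \<in> carrier_mat (vdim Q i) (vdim Q j)" "P * S = 1\<^sub>m k" "path Q i j * S = 0\<^sub>m (vdim Q j) k"
        "S * P + B * path Q i j = 1\<^sub>m (vdim Q i)"
        by (rule kernel_split)
      note [simp] = carrier_matD[OF SP(1)] carrier_matD[OF SP(2)] carrier_matD[OF SP(3)] dP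
      have "k = 0"
      proof (rule ccontr)
        assume "k \<noteq> 0"
        define e :: "'k mat" where "e = mat k 1 (\<lambda>(r, _). if r = 0 then 1 else 0)"
        have e: "dim_row e = k" "dim_col e = 1" "e $$ (0, 0) = 1" using \<open>k \<noteq> 0\<close> by (simp_all add: e_def)
        have "S * e \<noteq> 0\<^sub>m (vdim Q i) 1"
        proof
          assume "S * e = 0\<^sub>m (vdim Q i) 1"
          then have "P * S * e = 0\<^sub>m k 1" using e by (simp add: mat_assoc_dim)
          then have "e = 0\<^sub>m k 1" unfolding SP(4) using e by simp
          then show False using e \<open>k \<noteq> 0\<close> by auto
        qed
        moreover have "path Q i j * (S * e) = 0\<^sub>m (vdim Q j) 1"
          using SP(5) e by (simp flip: mat_assoc_dim)
        ultimately obtain a b where ab: "a < i" "i \<le> b" "b < j" "b \<le> n" "retract n (interval_module a b) Q"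
          using e interval_retract[OF Q i ij'(2) ij(1), of "S * e"] ij(2) by auto
        have "sim s p a b"
          using retract_perp_class[OF is_rep_interval QC ab(5)] interval_perp_class[of a b, where ?'k = 'k] ab by simp
        then show False using none ab by (metis atLeastLessThan_iff leD less_le_trans)
      qed
      then have "S * P = 0\<^sub>m (vdim Q i) (vdim Q i)" by (intro eq_matI) (auto simp: scalar_prod_def)
      then have "B * path Q i j = 1\<^sub>m (vdim Q i)" using SP(6) by simp
      then show ?thesis using SP(3) by blast
    qed
    then have "ext0 n Q (interval_module i j)" by (rule ext0_interval[OF Q ij])
    then show ?thesis
      by (rule ext0_retract[OF Q rI is_rep_interval isomorphic_retract(1)[OF iso]])
  qed
  show "injective_in n (perp_class n s p) I"
    unfolding injective_in_def
  proof (intro conjI allI impI ballI I)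
    fix X Y :: "'k quiver_rep" and f g
    assume mono: "mono_in n (perp_class n s p) X Y f" and g: "g \<in> rep_hom n X I"
    have XY: "X \<in> perp_class n s p" "Y \<in> perp_class n s p" and f: "is_hom n X Y f"
      using mono by (auto simp: mono_in_def rep_hom_iff)
    have X: "is_rep n X" and Y: "is_rep n Y" using XY by (auto simp: perp_class_def)
    obtain l where l: "\<And>v. 0 < v \<Longrightarrow> v \<le> n \<Longrightarrow> dim_row (l v) = vdim X v"
      "\<And>v. 0 < v \<Longrightarrow> v \<le> n \<Longrightarrow> dim_col (l v) = vdim Y v"
      "\<And>v. 0 < v \<Longrightarrow> v \<le> n \<Longrightarrow> l v * f v = 1\<^sub>m (vdim X v)"
      by (rule mono_in_perp_class[OF mono]) (rule that)
    obtain Q q t b where coker: "cokernel_of n X Y f Q q t b"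
      by (rule cokernel_rep[OF X Y f])
    have "Q \<in> perp_class n s p"
      using cokernel_ofD(1)[OF coker] XY strands iso_at_cokernel[OF X Y f coker] unfolding perp_class_def by auto
    then have E: "ext0 n Q I" by (rule ext)
    have gh: "is_hom n X I g" and gext: "g \<in> extensional {1..n}" using g by (auto simp: rep_hom_iff)
    obtain h where h: "is_hom n Y I h" "\<And>v. 0 < v \<Longrightarrow> v \<le> n \<Longrightarrow> h v * f v = g v"
      by (rule injective_extension[OF X Y rI f l coker E gh]) (assumption | rule that)+
    have "rep_comp n (restrict h {1..n}) f = g"
      unfolding rep_comp_eq_iff[OF gext] using h(2) by simp
    then show "\<exists>h\<in>rep_hom n Y I. rep_comp n h f = g" using restrict_rep_hom[OF h(1)] by blast
  qed
qed

end

lemma perp_isomorphic: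
  fixes W V M :: "'k::field quiver_rep"
  assumes W: "is_rep n W" and V: "is_rep n V" and M: "is_rep n M" and iso: "isomorphic n V M"
  shows "hom0 n W V \<and> ext0 n W V \<longleftrightarrow> hom0 n W M \<and> ext0 n W M"
  using hom0_retract[OF W V M isomorphic_retract(1)[OF iso]]
    hom0_retract[OF W M V isomorphic_retract(2)[OF iso]]
    ext0_retract[OF W V M isomorphic_retract(1)[OF iso]]
    ext0_retract[OF W M V isomorphic_retract(2)[OF iso]] by blast

theorem proposition6p7:
  fixes n i j :: nat and S :: "'k::field quiver_rep set" and X :: "'k quiver_rep"
  assumes "n \<ge> 1"
    and "exceptional_set n S"
    and "i < j" and "j \<le> n"
    and "X \<in> S" and "isomorphic n X (interval_module i j)"
  shows "\<forall>E p. exceptional_sequence n E \<and> set E = S \<and> p < n \<and> E ! p = X \<longrightarrow>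
    (relatively_injective n E p \<longleftrightarrow> oriented_right (strand_diagram n S) i j)"
proof (intro allI impI, elim conjE)
  fix E p assume E: "exceptional_sequence n E" and S: "set E = S" and p: "p < n" and X: "E ! p = X"
  have len: "length E = n" and ind: "\<And>q. q < n \<Longrightarrow> indecomposable n (E ! q)"
    and perp: "\<And>q r. r < n \<Longrightarrow> q < r \<Longrightarrow> Hom_zero n (E ! r) (E ! q) \<and> Ext1_zero n (E ! r) (E ! q)"
    using E unfolding exceptional_sequence_def by auto
  have rep: "is_rep n (E ! q)" if "q < n" for q using ind[OF that] unfolding indecomposable_def by blast
  have "\<exists>c. fst c < snd c \<and> snd c \<le> n \<and> isomorphic n (E ! q) (interval_module (fst c) (snd c))" if "q < n" for q
    by (rule indecomposable_interval[OF ind[OF that]]) force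
  then obtain c where c: "\<And>q. q < n \<Longrightarrow> fst (c q) < snd (c q)" "\<And>q. q < n \<Longrightarrow> snd (c q) \<le> n"
    "\<And>q. q < n \<Longrightarrow> isomorphic n (E ! q) (interval_module (fst (c q)) (snd (c q)))" by metis
  define s where "s = map c [0..<n]"
  have s: "s ! q = c q" if "q < n" for q using that by (simp add: s_def)
  have perp_iff: "hom0 n W (E ! q) \<and> ext0 n W (E ! q) \<longleftrightarrow> iso_at W (fst (s ! q)) (snd (s ! q))"
    if W: "is_rep n W" and q: "q < n" for W q
    unfolding s[OF q] perp_isomorphic[OF W rep[OF q] is_rep_interval c(3)[OF q]]
    by (rule perp_interval_iff[OF W c(1)[OF q] c(2)[OF q]])
  have strands: "\<And>q. q < p \<Longrightarrow> fst (s ! q) < snd (s ! q) \<and> snd (s ! q) \<le> n" using c p s by simp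
  have iso_E: "iso_at (E ! r) (fst (s ! q)) (snd (s ! q))" if "r < n" "q < r" for q r
  proof -
    have q: "q < n" using that by simp
    show ?thesis
      using perp[OF that] Hom_zero_iff[OF rep[OF that(1)] rep[OF q]] Ext1_zero_iff[OF rep[OF that(1)] rep[OF q]]
        perp_iff[OF rep[OF that(1)] q] by blast
  qed
  have seq: "perp_seq n s"
    unfolding perp_seq_def
  proof (intro conjI allI impI)
    show "length s = n" by (simp add: s_def)
    fix r assume r: "r < n"
    show "fst (s ! r) < snd (s ! r)" "snd (s ! r) \<le> n" using c r s by auto
    fix q assume q: "q < r"
    have "iso_at (interval_module (fst (s ! r)) (snd (s ! r)) :: 'k quiver_rep) (fst (s ! q)) (snd (s ! q))"
      unfolding s[OF r]
      by (rule iso_at_retract[OF is_rep_interval rep[OF r] _ _ isomorphic_retract(2)[OF c(3)[OF r]] iso_E[OF r q]])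
        (use c r q s in auto)
    then show "fst (s ! r) \<in> {fst (s ! q)..<snd (s ! q)} \<longleftrightarrow> snd (s ! r) \<in> {fst (s ! q)..<snd (s ! q)}"
      using iso_at_interval[of "fst (s ! r)" "snd (s ! r)" "fst (s ! q)" "snd (s ! q)", where ?'k = 'k] c r q s by simp
  qed
  have sp: "s ! p = (i, j)"
    using isomorphic_interval_unique[OF c(3)[OF p] c(1)[OF p] c(2)[OF p], unfolded X, OF assms(6,3,4)] s[OF p] by simp
  have left: "left_perp n (direct_sum_list (take p E)) = perp_class n s p"
  proof -
    have "set (take p E) = (\<lambda>q. E ! q) ` {..<p}"
      using p len by (simp add: nth_image[symmetric] lessThan_atLeast0)
    then have set: "V \<in> set (take p E) \<longleftrightarrow> (\<exists>q<p. V = E ! q)" for V by auto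
    have take: "is_rep n V" if "V \<in> set (take p E)" for V
      using that rep p unfolding set by (metis less_trans)
    have "W \<in> left_perp n (direct_sum_list (take p E)) \<longleftrightarrow>
        is_rep n W \<and> (\<forall>V\<in>set (take p E). hom0 n W V \<and> ext0 n W V)" for W
      by (rule left_perp_iff) (rule take)
    then have "W \<in> left_perp n (direct_sum_list (take p E)) \<longleftrightarrow>
        is_rep n W \<and> (\<forall>q<p. hom0 n W (E ! q) \<and> ext0 n W (E ! q))" for W
      unfolding Ball_def set by blast
    moreover have "W \<in> perp_class n s p \<longleftrightarrow> is_rep n W \<and> (\<forall>q<p. hom0 n W (E ! q) \<and> ext0 n W (E ! q))" for W
      unfolding perp_class_def using perp_iff[of W] less_trans[OF _ p] by auto
    ultimately have "W \<in> left_perp n (direct_sum_list (take p E)) \<longleftrightarrow> W \<in> perp_class n s p" for W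
      by blast
    then show ?thesis by blast
  qed
  have XC: "X \<in> perp_class n s p"
    using rep[OF p] iso_E[OF p] unfolding X perp_class_def by simp
  have "strands n S = set s"
  proof
    show "strands n S \<subseteq> set s"
    proof
      fix e assume "e \<in> strands n S"
      then obtain a b Y where ab: "e = (a, b)" "a < b" "b \<le> n" "Y \<in> S" "isomorphic n Y (interval_module a b)"
        unfolding strands_def by auto
      then obtain q where q: "q < n" "E ! q = Y" using S len by (metis in_set_conv_nth)
      have "e = c q"
        using isomorphic_interval_unique[OF ab(5,2,3) c(3)[OF q(1), unfolded q(2)] c(1)[OF q(1)] c(2)[OF q(1)]] ab(1) by simp
      then show "e \<in> set s" using q(1) by (simp add: s_def)
    qed
    show "set s \<subseteq> strands n S"
    proof
      fix e assume "e \<in> set s"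
      then obtain q where q: "q < n" "e = c q" by (auto simp: s_def)
      then show "e \<in> strands n S" using c[OF q(1)] S len nth_mem[of q E] unfolding strands_def by (cases e) auto
    qed
  qed
  moreover have "link s {..<n} = set s \<union> (set s)\<inverse>"
  proof -
    have "set s = (\<lambda>q. s ! q) ` {..<n}"
      using nth_image[of n s] by (simp add: s_def lessThan_atLeast0)
    then show ?thesis unfolding link_def by (auto simp: prod_eq_iff image_iff)
  qed
  ultimately have G: "pverts (strand_diagram n S) = {0..n}" "parcs (strand_diagram n S) = link s {..<n}"
    by (simp_all add: strand_diagram_def)
  have "relatively_injective n E p \<longleftrightarrow> \<not> (\<exists>x y. x < y \<and> y \<le> n \<and> sim s p x y \<and> x \<notin> {i..<j} \<and> y \<in> {i..<j})"
    unfolding relatively_injective_def left X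
    by (rule injective_in_perp_class_iff[OF strands assms(3,4) XC assms(6)])
  also have "\<dots> \<longleftrightarrow> (0, i) \<in> cut s n p"
    unfolding sim_crossing_iff[OF seq p sp] by simp
  also have "\<dots> \<longleftrightarrow> oriented_right (strand_diagram n S) i j"
    by (rule oriented_right_iff[OF seq G p sp, symmetric])
  finally show "relatively_injective n E p \<longleftrightarrow> oriented_right (strand_diagram n S) i j" .
qed

end
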